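(* Let $\beta>1/2$ (a real number, not necessarily an integer) and $0<L<\infty$, and let $$\gamma(\beta,L)=(2\beta+1)\left(\frac{\pi(2\beta+1)(\beta+1)}{\beta}\right)^{-\frac{2\beta}{2\beta+1}}L^{\frac1{2\beta+1}}.$$ Then $$\liminf_{n\to\infty}\ \inf_{\widetilde f_n}\ \sup_{f\in\mathcal S_\beta(L)} n^{\frac{2\beta}{2\beta+1}}\,E_f\|\widetilde f_n-f\|_2^2\ \ge\ \gamma(\beta,L),$$ where the infimum is over all estimators $\widetilde f_n$ of $f$ based on a sample $X_1,\dots,X_n$ of i.i.d. random variables with density $f$.
   Context: $\widehat f(\omega)=\int_{\mathbb R} f(x)e^{i\omega x}\,dx$ denotes the Fourier transform. $\mathcal S_\beta(L)$ is the Sobolev class of all $L_2$-integrable probability densities $f$ on $\mathbb R$ satisfying $\frac1{2\pi}\int_{\mathbb R}|\omega|^{2\beta}|\widehat f(\omega)|^2\,d\omega\le L$. An estimator $\widetilde f_n$ is an arbitrary (measurable) function-valued statistic depending only on the sample $X_1,\dots,X_n$; $E_f$ is the expectation when $X_1,\dots,X_n$ are i.i.d. with density $f$; $\|\cdot\|_2$ is the $L_2(\mathbb R)$ norm. *)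

theory Defs
  imports "HOL-Probability.Probability"
begin

definition fourier :: "(real \<Rightarrow> real) \<Rightarrow> real \<Rightarrow> complex" where
  "fourier f \<omega> = (CLINT x|lborel. complex_of_real (f x) * exp (\<i> * complex_of_real (\<omega> * x)))"

definition prob_density :: "(real \<Rightarrow> real) \<Rightarrow> bool" where
  "prob_density f \<longleftrightarrow>
     f \<in> borel_measurable borel \<and> (\<forall>x. 0 \<le> f x) \<and>
     integrable lborel f \<and> (LINT x|lborel. f x) = 1"

(* The Sobolev integral is taken in ennreal, so that it is infinite (and the bound fails)
   when the integrand is not integrable. *)
definition sobolev_class :: "real \<Rightarrow> real \<Rightarrow> (real \<Rightarrow> real) set" where
  "sobolev_class \<beta> L =
     {f. prob_density f \<and> integrable lborel (\<lambda>x. (f x)\<^sup>2) \<and>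
         ennreal (1 / (2 * pi)) *
           (\<integral>\<^sup>+ \<omega>. ennreal (\<bar>\<omega>\<bar> powr (2 * \<beta>) * (cmod (fourier f \<omega>))\<^sup>2) \<partial>lborel)
         \<le> ennreal L}"

(* Squared L2 norm; infinite for functions that are not square integrable. *)
definition L2_norm_sq :: "(real \<Rightarrow> real) \<Rightarrow> ennreal" where
  "L2_norm_sq g = (\<integral>\<^sup>+ x. ennreal ((g x)\<^sup>2) \<partial>lborel)"

(* Joint law of n i.i.d. observations with density f; a sample is a function on {1..n}. *)
definition sample_law :: "nat \<Rightarrow> (real \<Rightarrow> real) \<Rightarrow> (nat \<Rightarrow> real) measure" where
  "sample_law n f = (\<Pi>\<^sub>M i\<in>{1..n}. density lborel (\<lambda>x. ennreal (f x)))"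

(* T X x is the value at x of the function estimated from the sample X. Measurability is joint
   in (X, x); T X need not be a density, and its loss may be infinite. *)
definition estimators :: "nat \<Rightarrow> ((nat \<Rightarrow> real) \<Rightarrow> real \<Rightarrow> real) set" where
  "estimators n =
     {T. (\<lambda>(X, x). T X x) \<in> borel_measurable ((\<Pi>\<^sub>M i\<in>{1..n}. borel) \<Otimes>\<^sub>M borel)}"

definition risk :: "nat \<Rightarrow> ((nat \<Rightarrow> real) \<Rightarrow> real \<Rightarrow> real) \<Rightarrow> (real \<Rightarrow> real) \<Rightarrow> ennreal" where
  "risk n T f = (\<integral>\<^sup>+ X. L2_norm_sq (\<lambda>x. T X x - f x) \<partial>(sample_law n f))"

definition pinsker_const :: "real \<Rightarrow> real \<Rightarrow> real" where
  "pinsker_const \<beta> L =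
     (2 * \<beta> + 1) * (pi * (2 * \<beta> + 1) * (\<beta> + 1) / \<beta>) powr (- (2 * \<beta> / (2 * \<beta> + 1))) *
     L powr (1 / (2 * \<beta> + 1))"

end

theory Submission
  imports Defs "HOL-Probability.Hoeffding"
begin

text \<open>
The supremum of the risk over the Sobolev class is at least the average risk over any
prior living on a finite-dimensional subfamily of the class. The subfamily below is chosen so
that estimating its member is, asymptotically, Pinsker's problem of estimating a sequence of
independent Gaussian coordinates under an ellipsoidal constraint.

The subfamily. Let \<open>base_density B\<close> be a smooth, nearly uniform density on a long interval. Being a
function of \<open>x / B\<close>, it uses only a vanishing part of the budget \<open>L\<close> when \<open>B\<close> is large. On the
interval \<open>[-H, H]\<close> where it is constant, windowed cosines of frequencies \<open>\<pi> k / (2 H)\<close> are added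
with random coefficients of order \<open>n powr (-1/2)\<close>. About \<open>n powr (1 / (2 \<beta> + 1))\<close> frequencies
matter, and since \<open>\<beta> > 1/2\<close> the sum of all perturbations is uniformly small. Hence every member is a
density, and one observation carries Fisher information of at most about the length of the interval
about each coefficient.

The Bayes risk. For a coefficient with prior \<open>\<pi>\<close> the van Trees inequality (\<open>van_trees_linear\<close>) bounds
the risk from below by \<open>s\<^sup>2 / (n I + J)\<close>, where \<open>J\<close> is the Fisher information of the prior. The
priors are rescaled powers of \<open>1 - u\<^sup>2\<close>: they are bounded, and variance times information tends to
1, the value for a Gaussian. The loss is only tested against the cosines on \<open>[-H, H]\<close>, which are
exactly orthonormal. So Bessel's inequality suffices and the windowed cosines need not
be orthogonal: only the diagonal slope \<open>s\<close>, which is close to 1, enters.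

The energy. Up to an error of lower order, \<open>\<bar>\<omega>\<bar> powr \<beta>\<close> times the Fourier transform of a windowed cosine sum is the
transform of the sum with coefficients multiplied by the powers of their frequencies
(\<open>perturbation_energy\<close>). Plancherel's inequality (\<open>plancherel_le\<close>) then gives the
ellipsoid weights \<open>freq H k powr (2 * \<beta>)\<close>, for fractional and integral \<open>\<beta>\<close> alike. The energy of
a random member is a sum of independent bounded terms and concentrates at its mean by Hoeffding's
inequality. On the exceptional event the loss of a suitably truncated estimator is of the order of
the risk itself, so that this event is negligible (\<open>bayes_risk_lower_bound\<close>).

The constant. With coefficient variances proportional to \<open>(N / k) powr \<beta> - 1\<close>, energy and risk of
the family are Riemann sums; \<open>asymptotic_lower_bound\<close> evaluates them. Letting the energy
exhaust \<open>L\<close> determines \<open>N\<close>, and the risk becomes the Pinsker constant (\<open>pinsker_const_eq\<close>).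
\<close>

section \<open>Fourier transforms and the Plancherel inequality\<close>

lemmas L1_intros = Bochner_Integration.integrable_add Bochner_Integration.integrable_diff
  Bochner_Integration.integrable_sum Bochner_Integration.integrable_mult_right

lemma fourier_measurable [measurable]:
  assumes [measurable]: "f \<in> borel_measurable borel"
  shows "fourier f \<in> borel_measurable borel"
  unfolding fourier_def[abs_def] by measurable

lemma fourier_integrable:
  assumes "integrable lborel f"
  shows "integrable lborel (\<lambda>x. complex_of_real (f x) * iexp (\<omega> * x))"
proof (rule Bochner_Integration.integrable_bound[OF assms])
  have [measurable]: "f \<in> borel_measurable borel" using assms by auto
  show "(\<lambda>x. complex_of_real (f x) * iexp (\<omega> * x)) \<in> borel_measurable lborel"
    by measurable
qed (auto simp: norm_mult simp del: of_real_mult)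

lemma fourier_bound:
  assumes "integrable lborel f"
  shows "cmod (fourier f \<omega>) \<le> (LINT x|lborel. \<bar>f x\<bar>)"
proof -
  have "cmod (fourier f \<omega>) \<le> (LINT x|lborel. cmod (complex_of_real (f x) * iexp (\<omega> * x)))"
    unfolding fourier_def by (rule integral_norm_bound)
  also have "\<dots> = (LINT x|lborel. \<bar>f x\<bar>)"
    by (simp add: norm_mult del: of_real_mult)
  finally show ?thesis .
qed

lemma norm_integral_le_nn_integral:
  fixes f :: "'a \<Rightarrow> 'b::{banach, second_countable_topology}"
  shows "ennreal (norm (integral\<^sup>L M f)) \<le> (\<integral>\<^sup>+x. ennreal (norm (f x)) \<partial>M)"
  using integral_norm_bound_ennreal[of M f] not_integrable_integral_eq[of M f] by (cases "integrable M f") auto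

lemma char_normal_scaled:
  "(CLINT z|std_normal_distribution. iexp (z * t)) = complex_of_real (exp (- (t\<^sup>2) / 2))"
  using fun_cong[OF char_std_normal_distribution, of t]
  by (simp add: char_def mult_ac)

text \<open>The squared transform is a double integral whose phase is integrated against a Gaussian weight. The
weight makes all integrals absolutely convergent, so that Fubini applies, and turns the
phase into a Gaussian kernel in \<open>x - y\<close>.\<close>

lemma gaussian_energy_identity:
  fixes s :: real
  assumes f: "integrable lborel f" and s: "s > 0"
  defines "M \<equiv> std_normal_distribution"
  shows "(CLINT z|M. complex_of_real ((cmod (fourier f (z / s)))\<^sup>2)) =
    (CLINT x|lborel. CLINT y|lborel. complex_of_real (f x * f y * exp (- (((x - y) / s)\<^sup>2) / 2)))"
proof -
  have [measurable]: "f \<in> borel_measurable borel" using f by auto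
  interpret M: prob_space M unfolding M_def by (rule prob_space_normal_density) simp
  have sM [measurable_cong]: "sets M = sets borel" by (simp add: M_def)
  interpret P: pair_sigma_finite M lborel
    by (intro pair_sigma_finite.intro M.sigma_finite_measure_axioms sigma_finite_lborel)
  define C where "C = (LINT x|lborel. \<bar>f x\<bar>)"
  define F where "F = (\<lambda>z. fourier f (z / s))"
  have [measurable]: "cnj \<in> borel_measurable borel"
    by (intro borel_measurable_continuous_onI continuous_intros)
  have F_m [measurable]: "F \<in> borel_measurable borel" unfolding F_def by measurable
  have FC: "cmod (F z) \<le> C" for z unfolding F_def C_def by (rule fourier_bound[OF f])
  have bdd: "integrable M g" if "g \<in> borel_measurable borel" "\<And>z. cmod (g z) \<le> D" for g :: "real \<Rightarrow> complex" and D
    by (rule M.integrable_const_bound[of _ D]) (use that in auto)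
  have "integrable (M \<Otimes>\<^sub>M lborel) (\<lambda>(z, x). complex_of_real (f x) * iexp (z / s * x) * cnj (F z))"
  proof (rule P.Fubini_integrable)
    show "(\<lambda>(z, x). complex_of_real (f x) * iexp (z / s * x) * cnj (F z)) \<in> borel_measurable (M \<Otimes>\<^sub>M lborel)"
      by measurable
    have "integrable M (\<lambda>z. C * cmod (F z))"
      using bdd[of F C] FC by (intro L1_intros integrable_norm) auto
    then show "integrable M (\<lambda>z. LINT x|lborel. norm (case (z, x) of (z, x) \<Rightarrow> complex_of_real (f x) * iexp (z / s * x) * cnj (F z)))"
      by (simp add: norm_mult C_def del: of_real_mult of_real_divide)
    show "AE z in M. integrable lborel (\<lambda>x. case (z, x) of (z, x) \<Rightarrow> complex_of_real (f x) * iexp (z / s * x) * cnj (F z))"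
      by (intro AE_I2, unfold prod.case) (intro Bochner_Integration.integrable_mult_left fourier_integrable[OF f])
  qed
  note F1 = P.Fubini_integral[OF this]
  have inner: "(CLINT z|M. iexp (z / s * x) * cnj (F z)) =
    (CLINT y|lborel. complex_of_real (f y * exp (- (((x - y) / s)\<^sup>2) / 2)))" for x
  proof -
    have I2: "integrable (M \<Otimes>\<^sub>M lborel) (\<lambda>(z, y). iexp (z / s * x) * (complex_of_real (f y) * exp (- (\<i> * complex_of_real (z / s * y)))))"
    proof (rule P.Fubini_integrable)
      show "(\<lambda>(z, y). iexp (z / s * x) * (complex_of_real (f y) * exp (- (\<i> * complex_of_real (z / s * y))))) \<in> borel_measurable (M \<Otimes>\<^sub>M lborel)"
        by measurable
      show "integrable M (\<lambda>z. LINT y|lborel. norm (case (z, y) of (z, y) \<Rightarrow> iexp (z / s * x) * (complex_of_real (f y) * exp (- (\<i> * complex_of_real (z / s * y))))))"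
        by (simp add: norm_mult M.integrable_const del: of_real_mult of_real_divide)
      show "AE z in M. integrable lborel (\<lambda>y. case (z, y) of (z, y) \<Rightarrow> iexp (z / s * x) * (complex_of_real (f y) * exp (- (\<i> * complex_of_real (z / s * y)))))"
        using fourier_integrable[OF f, of "- _ / s"]
        by (auto simp del: of_real_mult of_real_divide intro!: Bochner_Integration.integrable_mult_right)
    qed
    have "cnj (F z) = (CLINT y|lborel. complex_of_real (f y) * exp (- (\<i> * complex_of_real (z / s * y))))" for z
      unfolding F_def fourier_def
      by (subst Bochner_Integration.integral_cnj[symmetric]) (simp add: exp_cnj)
    then have "(CLINT z|M. iexp (z / s * x) * cnj (F z)) =
       (CLINT z|M. CLINT y|lborel. iexp (z / s * x) * (complex_of_real (f y) * exp (- (\<i> * complex_of_real (z / s * y)))))"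
      by simp
    also have "\<dots> = (CLINT y|lborel. CLINT z|M. iexp (z / s * x) * (complex_of_real (f y) * exp (- (\<i> * complex_of_real (z / s * y)))))"
      using P.Fubini_integral[OF I2] by simp
    also have "\<dots> = (CLINT y|lborel. complex_of_real (f y) * (CLINT z|M. iexp (z * ((x - y) / s))))"
    proof -
      have "iexp (z / s * x) * (complex_of_real (f y) * exp (- (\<i> * complex_of_real (z / s * y)))) =
        complex_of_real (f y) * iexp (z * ((x - y) / s))" for z y
      proof -
        have "\<i> * complex_of_real (z * ((x - y) / s)) = \<i> * complex_of_real (z / s * x) + - (\<i> * complex_of_real (z / s * y))"
          using s by (simp add: field_simps)
        then show ?thesis by (simp only: exp_add mult_ac)
      qed
      then show ?thesis by (simp only: integral_mult_right_zero)
    qed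
    also have "\<dots> = (CLINT y|lborel. complex_of_real (f y * exp (- (((x - y) / s)\<^sup>2) / 2)))"
      unfolding M_def by (subst char_normal_scaled) simp
    finally show ?thesis .
  qed
  have "complex_of_real ((cmod (fourier f (z / s)))\<^sup>2) =
     (CLINT x|lborel. complex_of_real (f x) * iexp (z / s * x) * cnj (F z))" for z
    unfolding complex_norm_square F_def by (subst (1) fourier_def) simp
  then have "(CLINT z|M. complex_of_real ((cmod (fourier f (z / s)))\<^sup>2)) =
     (CLINT z|M. CLINT x|lborel. complex_of_real (f x) * iexp (z / s * x) * cnj (F z))"
    by simp
  also have "\<dots> = (CLINT x|lborel. CLINT z|M. complex_of_real (f x) * iexp (z / s * x) * cnj (F z))"
    using F1 by simp
  also have "\<dots> = (CLINT x|lborel. complex_of_real (f x) * (CLINT z|M. iexp (z / s * x) * cnj (F z)))"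
    by (simp only: mult.assoc integral_mult_right_zero)
  also have "\<dots> = (CLINT x|lborel. CLINT y|lborel. complex_of_real (f x * f y * exp (- (((x - y) / s)\<^sup>2) / 2)))"
    unfolding inner by (simp only: integral_mult_right_zero[symmetric] of_real_mult mult.assoc)
  finally show ?thesis .
qed

lemma nn_integral_gaussian_kernel:
  fixes s :: real assumes s: "s > 0"
  shows "(\<integral>\<^sup>+y. ennreal (exp (- (((x - y) / s)\<^sup>2) / 2)) \<partial>lborel) = ennreal (s * sqrt (2 * pi))"
proof -
  have "exp (- (((x - y) / s)\<^sup>2) / 2) = s * sqrt (2 * pi) * normal_density x s y" for y
    using s by (simp add: normal_density_def real_sqrt_mult power_divide power2_commute field_simps)
  then have "(\<integral>\<^sup>+y. ennreal (exp (- (((x - y) / s)\<^sup>2) / 2)) \<partial>lborel) = 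
     (\<integral>\<^sup>+y. ennreal (s * sqrt (2 * pi)) * ennreal (normal_density x s y) \<partial>lborel)"
    using s by (simp add: ennreal_mult)
  also have "\<dots> = ennreal (s * sqrt (2 * pi)) * (\<integral>\<^sup>+y. ennreal (normal_density x s y) \<partial>lborel)"
    by (rule nn_integral_cmult) simp
  also have "(\<integral>\<^sup>+y. ennreal (normal_density x s y) \<partial>lborel) = 1"
    using s by (subst nn_integral_eq_integral) (auto simp: integral_normal_density integrable_normal_density)
  finally show ?thesis by simp
qed

text \<open>By \<open>f x * f y \<le> (f x\<^sup>2 + f y\<^sup>2) / 2\<close> the double integral is at most the integral of \<open>f\<^sup>2\<close> times the
mass of the Gaussian kernel, whatever its width \<open>s\<close>.\<close>

lemma damped_plancherel_le:
  assumes f: "integrable lborel f" and s: "s > 0"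
  shows "(\<integral>\<^sup>+\<omega>. ennreal ((cmod (fourier f \<omega>))\<^sup>2 * exp (- (s * \<omega>)\<^sup>2 / 2)) \<partial>lborel)
     \<le> ennreal (2 * pi) * (\<integral>\<^sup>+x. ennreal ((f x)\<^sup>2) \<partial>lborel)"
proof -
  have [measurable]: "f \<in> borel_measurable borel" using f by auto
  define M where "M = std_normal_distribution"
  interpret M: prob_space M unfolding M_def by (rule prob_space_normal_density) simp
  have sM [measurable_cong]: "sets M = sets borel" by (simp add: M_def)
  define K where "K = (\<lambda>x y. exp (- (((x - y) / s)\<^sup>2) / 2))"
  define R where "R = (LINT z|M. (cmod (fourier f (z / s)))\<^sup>2)"
  have Km [measurable]: "(\<lambda>(x, y). K x y) \<in> borel_measurable (borel \<Otimes>\<^sub>M borel)"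
    unfolding K_def by measurable
  have K0: "K x y \<ge> 0" for x y by (simp add: K_def)
  have Ksym: "K x y = K y x" for x y by (simp add: K_def power_divide power2_commute)
  have Kint: "(\<integral>\<^sup>+y. ennreal (K x y) \<partial>lborel) = ennreal (s * sqrt (2 * pi))" for x
    unfolding K_def by (rule nn_integral_gaussian_kernel[OF s])
  have bd: "integrable M (\<lambda>z. (cmod (fourier f (z / s)))\<^sup>2)"
    by (rule M.integrable_const_bound[of _ "(LINT x|lborel. \<bar>f x\<bar>)\<^sup>2"])
       (auto intro!: power_mono fourier_bound[OF f])
  have R0: "R \<ge> 0" unfolding R_def by simp
  have "complex_of_real R = (CLINT x|lborel. CLINT y|lborel. complex_of_real (f x * f y * K x y))"
    using gaussian_energy_identity[OF f s] unfolding R_def M_def K_def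
    by (simp del: of_real_mult of_real_power)
  then have "ennreal R = ennreal (cmod (CLINT x|lborel. CLINT y|lborel. complex_of_real (f x * f y * K x y)))"
    using R0 by (metis abs_of_nonneg norm_of_real)
  also have "\<dots> \<le> (\<integral>\<^sup>+x. ennreal (cmod (CLINT y|lborel. complex_of_real (f x * f y * K x y))) \<partial>lborel)"
    by (rule norm_integral_le_nn_integral)
  also have "\<dots> \<le> (\<integral>\<^sup>+x. \<integral>\<^sup>+y. ennreal (cmod (complex_of_real (f x * f y * K x y))) \<partial>lborel \<partial>lborel)"
    by (intro nn_integral_mono norm_integral_le_nn_integral)
  also have "\<dots> \<le> (\<integral>\<^sup>+x. \<integral>\<^sup>+y. (ennreal ((f x)\<^sup>2 / 2 * K x y) + ennreal ((f y)\<^sup>2 / 2 * K x y)) \<partial>lborel \<partial>lborel)"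
  proof (intro nn_integral_mono)
    fix x y
    have "\<bar>f x\<bar> * \<bar>f y\<bar> \<le> (f x)\<^sup>2 / 2 + (f y)\<^sup>2 / 2"
      using sum_squares_bound[of "\<bar>f x\<bar>" "\<bar>f y\<bar>"] by simp
    from mult_right_mono[OF this K0[of x y]]
    show "ennreal (cmod (complex_of_real (f x * f y * K x y))) \<le> ennreal ((f x)\<^sup>2 / 2 * K x y) + ennreal ((f y)\<^sup>2 / 2 * K x y)"
      using K0 by (simp add: ennreal_plus[symmetric] distrib_right norm_mult del: ennreal_plus)
  qed
  also have "\<dots> = (\<integral>\<^sup>+x. \<integral>\<^sup>+y. ennreal ((f x)\<^sup>2 / 2 * K x y) \<partial>lborel \<partial>lborel) + (\<integral>\<^sup>+x. \<integral>\<^sup>+y. ennreal ((f y)\<^sup>2 / 2 * K x y) \<partial>lborel \<partial>lborel)"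
    by (simp add: nn_integral_add)
  also have "(\<integral>\<^sup>+x. \<integral>\<^sup>+y. ennreal ((f y)\<^sup>2 / 2 * K x y) \<partial>lborel \<partial>lborel) = (\<integral>\<^sup>+y. \<integral>\<^sup>+x. ennreal ((f y)\<^sup>2 / 2 * K x y) \<partial>lborel \<partial>lborel)"
    by (rule lborel_pair.Fubini') measurable
  also have "(\<integral>\<^sup>+y. \<integral>\<^sup>+x. ennreal ((f y)\<^sup>2 / 2 * K x y) \<partial>lborel \<partial>lborel) = (\<integral>\<^sup>+x. \<integral>\<^sup>+y. ennreal ((f x)\<^sup>2 / 2 * K x y) \<partial>lborel \<partial>lborel)"
    by (subst Ksym) simp
  also have "(\<integral>\<^sup>+x. \<integral>\<^sup>+y. ennreal ((f x)\<^sup>2 / 2 * K x y) \<partial>lborel \<partial>lborel) = (\<integral>\<^sup>+x. ennreal ((f x)\<^sup>2 / 2) * ennreal (s * sqrt (2 * pi)) \<partial>lborel)"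
  proof (intro nn_integral_cong)
    fix x
    have "(\<integral>\<^sup>+y. ennreal ((f x)\<^sup>2 / 2 * K x y) \<partial>lborel) = (\<integral>\<^sup>+y. ennreal ((f x)\<^sup>2 / 2) * ennreal (K x y) \<partial>lborel)"
      by (intro nn_integral_cong ennreal_mult K0) simp
    also have "\<dots> = ennreal ((f x)\<^sup>2 / 2) * (\<integral>\<^sup>+y. ennreal (K x y) \<partial>lborel)"
      by (rule nn_integral_cmult) measurable
    finally show "(\<integral>\<^sup>+y. ennreal ((f x)\<^sup>2 / 2 * K x y) \<partial>lborel) = ennreal ((f x)\<^sup>2 / 2) * ennreal (s * sqrt (2 * pi))"
      unfolding Kint .
  qed
  also have "\<dots> = (\<integral>\<^sup>+x. ennreal ((s * sqrt (2 * pi)) / 2) * ennreal ((f x)\<^sup>2) \<partial>lborel)"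
    using s by (simp add: ennreal_mult[symmetric] mult_ac)
  also have "\<dots> = ennreal ((s * sqrt (2 * pi)) / 2) * (\<integral>\<^sup>+x. ennreal ((f x)\<^sup>2) \<partial>lborel)"
    by (rule nn_integral_cmult) measurable
  finally have R_le: "ennreal R \<le> ennreal (s * sqrt (2 * pi)) * (\<integral>\<^sup>+x. ennreal ((f x)\<^sup>2) \<partial>lborel)"
    using s by (simp add: distrib_right[symmetric] ennreal_plus[symmetric] del: ennreal_plus)
  have "ennreal R = (\<integral>\<^sup>+z. ennreal ((cmod (fourier f (z / s)))\<^sup>2) \<partial>M)"
    unfolding R_def by (rule nn_integral_eq_integral[symmetric, OF bd]) simp
  also have "\<dots> = (\<integral>\<^sup>+z. ennreal (std_normal_density z) * ennreal ((cmod (fourier f (z / s)))\<^sup>2) \<partial>lborel)"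
    unfolding M_def by (subst nn_integral_density) auto
  also have "\<dots> = ennreal s * (\<integral>\<^sup>+\<omega>. ennreal (std_normal_density (s * \<omega>)) * ennreal ((cmod (fourier f \<omega>))\<^sup>2) \<partial>lborel)"
    using s by (subst nn_integral_real_affine[where c=s and t=0]) auto
  also have "(\<integral>\<^sup>+\<omega>. ennreal (std_normal_density (s * \<omega>)) * ennreal ((cmod (fourier f \<omega>))\<^sup>2) \<partial>lborel) =
     (\<integral>\<^sup>+\<omega>. ennreal (1 / sqrt (2 * pi)) * ennreal ((cmod (fourier f \<omega>))\<^sup>2 * exp (- (s * \<omega>)\<^sup>2 / 2)) \<partial>lborel)"
    by (intro nn_integral_cong) (simp add: normal_density_def ennreal_mult[symmetric] mult_ac)
  also have "\<dots> = ennreal (1 / sqrt (2 * pi)) * (\<integral>\<^sup>+\<omega>. ennreal ((cmod (fourier f \<omega>))\<^sup>2 * exp (- (s * \<omega>)\<^sup>2 / 2)) \<partial>lborel)"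
    (is "_ = _ * ?G")
    by (rule nn_integral_cmult) measurable
  finally have R_eq: "ennreal R = ennreal (s / sqrt (2 * pi)) * ?G"
    using s by (simp add: mult.assoc[symmetric] ennreal_mult[symmetric])
  have c: "ennreal (sqrt (2 * pi) / s) * ennreal (s / sqrt (2 * pi)) = 1"
    using s by (simp add: ennreal_mult[symmetric])
  have "?G = ennreal (sqrt (2 * pi) / s) * ennreal R"
    unfolding R_eq mult.assoc[symmetric] c by simp
  also have "\<dots> \<le> ennreal (sqrt (2 * pi) / s) * (ennreal (s * sqrt (2 * pi)) * (\<integral>\<^sup>+x. ennreal ((f x)\<^sup>2) \<partial>lborel))"
    by (intro mult_left_mono R_le) simp
  also have "\<dots> = ennreal (2 * pi) * (\<integral>\<^sup>+x. ennreal ((f x)\<^sup>2) \<partial>lborel)"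
    using s by (simp add: mult.assoc[symmetric] ennreal_mult[symmetric])
  finally show ?thesis .
qed

text \<open>The damping is removed by Fatou's lemma, which gives only one half of Plancherel's theorem;
an upper bound for the energy in frequency is all that the perturbations below require.\<close>

lemma plancherel_le:
  assumes f: "integrable lborel f"
  shows "(\<integral>\<^sup>+\<omega>. ennreal ((cmod (fourier f \<omega>))\<^sup>2) \<partial>lborel)
     \<le> ennreal (2 * pi) * (\<integral>\<^sup>+x. ennreal ((f x)\<^sup>2) \<partial>lborel)"
proof -
  have [measurable]: "f \<in> borel_measurable borel" using f by auto
  define g where "g = (\<lambda>(i::nat) \<omega>. ennreal ((cmod (fourier f \<omega>))\<^sup>2 * exp (- (inverse (real (Suc i)) * \<omega>)\<^sup>2 / 2)))"
  have lim: "(\<lambda>i. g i \<omega>) \<longlonglongrightarrow> ennreal ((cmod (fourier f \<omega>))\<^sup>2)" for \<omega>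
  proof -
    have "(\<lambda>i. (cmod (fourier f \<omega>))\<^sup>2 * exp (- (inverse (real (Suc i)) * \<omega>)\<^sup>2 / 2)) \<longlonglongrightarrow> (cmod (fourier f \<omega>))\<^sup>2 * exp (- (0 * \<omega>)\<^sup>2 / 2)"
      by (intro tendsto_intros LIMSEQ_inverse_real_of_nat) auto
    then show ?thesis unfolding g_def by (intro tendsto_ennrealI) simp
  qed
  have "(\<integral>\<^sup>+\<omega>. ennreal ((cmod (fourier f \<omega>))\<^sup>2) \<partial>lborel) = (\<integral>\<^sup>+\<omega>. liminf (\<lambda>i. g i \<omega>) \<partial>lborel)"
    by (intro nn_integral_cong) (use lim lim_imp_Liminf[OF _ lim] in \<open>auto\<close>)
  also have "\<dots> \<le> liminf (\<lambda>i. \<integral>\<^sup>+\<omega>. g i \<omega> \<partial>lborel)"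
    by (rule nn_integral_liminf) (simp add: g_def)
  also have "\<dots> \<le> liminf (\<lambda>i. ennreal (2 * pi) * (\<integral>\<^sup>+x. ennreal ((f x)\<^sup>2) \<partial>lborel))"
    unfolding g_def by (intro Liminf_mono eventuallyI damped_plancherel_le[OF f]) simp
  also have "\<dots> = ennreal (2 * pi) * (\<integral>\<^sup>+x. ennreal ((f x)\<^sup>2) \<partial>lborel)"
    by (simp add: Liminf_const)
  finally show ?thesis .
qed

section \<open>Smooth windows with decaying Fourier transform\<close>

text \<open>Each moving average divides the Fourier transform by one power of the frequency, keeps the range
\<open>[0, 1]\<close>, and changes plateau and support only by the width \<open>d\<close>. Iterating it produces
windows of any prescribed smoothness without differentiating anything.\<close>

definition moving_average :: "real \<Rightarrow> (real \<Rightarrow> real) \<Rightarrow> real \<Rightarrow> real" where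
  "moving_average d f x = (LINT t|lborel. indicator {-d..d} t * f (x + t)) / (2 * d)"

lemma moving_average_measurable [measurable]:
  assumes [measurable]: "f \<in> borel_measurable borel"
  shows "moving_average d f \<in> borel_measurable borel"
  unfolding moving_average_def[abs_def] by measurable

lemma integrable_indicator_Icc: "integrable lborel (indicator {a..b::real} :: real \<Rightarrow> real)"
  by (rule integrable_real_indicator) (auto simp: emeasure_lborel_Icc_eq)

lemma integrable_Icc_bounded:
  fixes f :: "real \<Rightarrow> real"
  assumes [measurable]: "f \<in> borel_measurable borel" and bd: "\<And>x. \<bar>f x\<bar> \<le> C"
  shows "integrable lborel (\<lambda>t. indicator {a..b} t * f t)"
proof (rule Bochner_Integration.integrable_bound)
  show "integrable lborel (\<lambda>t. C * indicator {a..b} t :: real)"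
    by (intro L1_intros integrable_indicator_Icc)
  show "AE x in lborel. norm (indicator {a..b} x * f x) \<le> norm (C * indicator {a..b} x)"
    using bd by (auto simp: indicator_def intro!: AE_I2 order_trans[OF bd])
qed simp

lemma integrable_compact_support:
  fixes f :: "real \<Rightarrow> real"
  assumes [measurable]: "f \<in> borel_measurable borel" and bd: "\<And>x. \<bar>f x\<bar> \<le> C" and supp: "\<And>x. \<bar>x\<bar> > R \<Longrightarrow> f x = 0"
  shows "integrable lborel f"
proof -
  have "f = (\<lambda>t. indicator {-R..R} t * f t)"
    using supp by (auto simp: fun_eq_iff indicator_def) (meson abs_le_D1 abs_le_D2 minus_le_iff not_le)+
  then show ?thesis using integrable_Icc_bounded[OF assms(1) bd, of "-R" R] by simp
qed

lemma norm_integral_exp_le: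
  assumes "\<omega> \<noteq> 0" "d > 0"
  shows "cmod (CLINT t|lborel. indicator {-d..d} t *\<^sub>R exp (- (\<i> * complex_of_real (\<omega> * t)))) \<le> 2 / \<bar>\<omega>\<bar>"
proof -
  define F where "F = (\<lambda>t. exp (- (\<i> * complex_of_real (\<omega> * t))) / (- \<i> * complex_of_real \<omega>))"
  have "(CLINT t|lborel. indicator {-d..d} t *\<^sub>R exp (- (\<i> * complex_of_real (\<omega> * t)))) = F d - F (-d)"
  proof (rule integral_FTC_atLeastAtMost)
    fix x assume "- d \<le> x" "x \<le> d"
    have "((\<lambda>z. exp (- (\<i> * (complex_of_real \<omega> * z))) / (- \<i> * complex_of_real \<omega>)) has_field_derivative exp (- (\<i> * complex_of_real (\<omega> * x)))) (at (complex_of_real x))"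
      using assms by (auto intro!: derivative_eq_intros simp: field_simps)
    from has_vector_derivative_real_field[OF this]
    show "(F has_vector_derivative exp (- (\<i> * complex_of_real (\<omega> * x)))) (at x within {-d..d})"
      unfolding F_def by (auto intro: has_vector_derivative_at_within)
  qed (use assms in \<open>auto intro!: continuous_intros\<close>)
  moreover have "cmod (F t) = 1 / \<bar>\<omega>\<bar>" for t
    unfolding F_def using norm_exp_i_times[of "- (\<omega> * t)"] by (simp add: norm_divide norm_mult)
  ultimately show ?thesis
    using norm_triangle_ineq4[of "F d" "F (-d)"] by simp
qed

lemma fourier_moving_average_le:
  assumes [measurable]: "f \<in> borel_measurable borel" and f: "integrable lborel f" and d: "d > 0" and w: "\<omega> \<noteq> 0"
  shows "cmod (fourier (moving_average d f) \<omega>) \<le> cmod (fourier f \<omega>) / (d * \<bar>\<omega>\<bar>)"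
proof -
  let ?e = "\<lambda>x. iexp (\<omega> * x)"
  have shift: "integrable lborel (\<lambda>x. complex_of_real (f (x + t)) * ?e x)" for t
  proof -
    have "integrable lborel (\<lambda>x. f (x + t))"
      using lborel_integrable_real_affine[OF f, of 1 t] by (simp add: add.commute)
    from fourier_integrable[OF this] show ?thesis by simp
  qed
  have "integrable (lborel \<Otimes>\<^sub>M lborel) (\<lambda>(t, x). complex_of_real (indicator {-d..d} t * f (x + t)) * ?e x)"
  proof (rule lborel_pair.Fubini_integrable)
    show "(\<lambda>(t, x). complex_of_real (indicator {-d..d} t * f (x + t)) * ?e x) \<in> borel_measurable (lborel \<Otimes>\<^sub>M lborel)"
      by measurable
    have "(LINT x|lborel. norm (complex_of_real (indicator {-d..d} t * f (x + t)) * ?e x)) = indicator {-d..d} t * (LINT x|lborel. \<bar>f x\<bar>)" for t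
    proof -
      have "(LINT x|lborel. \<bar>f x\<bar>) = (LINT x|lborel. \<bar>f (x + t)\<bar>)"
        using lborel_integral_real_affine[of 1 "\<lambda>x. \<bar>f x\<bar>" t] by (simp add: add.commute)
      then show ?thesis by (simp add: norm_mult abs_mult del: of_real_mult)
    qed
    then show "integrable lborel (\<lambda>t. LINT x|lborel. norm (case (t, x) of (t, x) \<Rightarrow> complex_of_real (indicator {-d..d} t * f (x + t)) * ?e x))"
      using integrable_indicator_Icc[of "-d" d] by (simp del: of_real_mult)
    show "AE t in lborel. integrable lborel (\<lambda>x. case (t, x) of (t, x) \<Rightarrow> complex_of_real (indicator {-d..d} t * f (x + t)) * ?e x)"
    proof (rule AE_I2, unfold prod.case)
      fix t
      have "(\<lambda>x. complex_of_real (indicator {-d..d} t * f (x + t)) * ?e x) = (\<lambda>x. complex_of_real (indicator {-d..d} t) * (complex_of_real (f (x + t)) * ?e x))"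
        by (simp add: mult.assoc)
      then show "integrable lborel (\<lambda>x. complex_of_real (indicator {-d..d} t * f (x + t)) * ?e x)"
        using shift[of t] by (simp only: Bochner_Integration.integrable_mult_right)
    qed
  qed
  note Fub = lborel_pair.Fubini_integral[OF this]
  have "fourier (moving_average d f) \<omega> = (CLINT x|lborel. complex_of_real (1 / (2 * d)) * (CLINT t|lborel. complex_of_real (indicator {-d..d} t * f (x + t)) * ?e x))"
    unfolding fourier_def moving_average_def
    by (simp add: integral_mult_left_zero del: of_real_mult)
  also have "\<dots> = complex_of_real (1 / (2 * d)) * (CLINT t|lborel. CLINT x|lborel. complex_of_real (indicator {-d..d} t * f (x + t)) * ?e x)"
    using Fub by simp
  also have "(\<lambda>t. CLINT x|lborel. complex_of_real (indicator {-d..d} t * f (x + t)) * ?e x) = (\<lambda>t. indicator {-d..d} t *\<^sub>R exp (- (\<i> * complex_of_real (\<omega> * t))) * fourier f \<omega>)"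
  proof
    fix t
    have "fourier f \<omega> = (CLINT x|lborel. complex_of_real (f (x + t)) * ?e (x + t))"
      unfolding fourier_def using lborel_integral_real_affine[of 1 "\<lambda>x. complex_of_real (f x) * ?e x" t] by (simp add: add.commute)
    also have "\<dots> = (CLINT x|lborel. ?e t * (complex_of_real (f (x + t)) * ?e x))"
      by (simp add: exp_add[symmetric] algebra_simps)
    finally have 1: "fourier f \<omega> = ?e t * (CLINT x|lborel. complex_of_real (f (x + t)) * ?e x)" by simp
    have 2: "exp (- (\<i> * complex_of_real (\<omega> * t))) * ?e t = 1"
      by (simp add: exp_add[symmetric])
    have "exp (- (\<i> * complex_of_real (\<omega> * t))) * fourier f \<omega> = (CLINT x|lborel. complex_of_real (f (x + t)) * ?e x)"
      unfolding 1 mult.assoc[symmetric] 2 by simp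
    then show "(CLINT x|lborel. complex_of_real (indicator {-d..d} t * f (x + t)) * ?e x) = indicator {-d..d} t *\<^sub>R exp (- (\<i> * complex_of_real (\<omega> * t))) * fourier f \<omega>"
      by (simp add: mult.assoc scaleR_conv_of_real)
  qed
  also have "(CLINT t|lborel. indicator {-d..d} t *\<^sub>R exp (- (\<i> * complex_of_real (\<omega> * t))) * fourier f \<omega>) = (CLINT t|lborel. indicator {-d..d} t *\<^sub>R exp (- (\<i> * complex_of_real (\<omega> * t)))) * fourier f \<omega>"
    by (rule integral_mult_left_zero)
  finally have "cmod (fourier (moving_average d f) \<omega>) = 1 / (2 * d) * cmod (CLINT t|lborel. indicator {-d..d} t *\<^sub>R exp (- (\<i> * complex_of_real (\<omega> * t)))) * cmod (fourier f \<omega>)"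
    using d by (simp add: norm_mult norm_divide)
  also have "\<dots> \<le> 1 / (2 * d) * (2 / \<bar>\<omega>\<bar>) * cmod (fourier f \<omega>)"
    using d norm_integral_exp_le[OF w d] by (intro mult_right_mono mult_left_mono) auto
  finally show ?thesis using d by simp
qed

lemma moving_average_bounds:
  assumes [measurable]: "f \<in> borel_measurable borel" and f01: "\<And>x. 0 \<le> f x \<and> f x \<le> 1" and d: "d > 0"
  shows "0 \<le> moving_average d f x \<and> moving_average d f x \<le> 1"
proof -
  have int: "integrable lborel (\<lambda>t. indicator {-d..d} t * f (x + t))"
    by (rule integrable_Icc_bounded[where C=1]) (use f01 in auto)
  have "(LINT t|lborel. indicator {-d..d} t * f (x + t)) \<ge> 0"
    using f01 by (intro integral_nonneg_AE) auto
  moreover have "(LINT t|lborel. indicator {-d..d} t * f (x + t)) \<le> (LINT t|lborel. indicator {-d..d} t)"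
    using f01 by (intro integral_mono int integrable_indicator_Icc) (simp add: indicator_def)
  then have "(LINT t|lborel. indicator {-d..d} t * f (x + t)) \<le> 2 * d" using d by simp
  ultimately show ?thesis using d by (simp add: moving_average_def)
qed

lemma moving_average_const:
  assumes "\<And>t. \<bar>t\<bar> \<le> d \<Longrightarrow> f (x + t) = c" "d > 0"
  shows "moving_average d f x = c"
proof -
  have "(\<lambda>t. indicator {-d..d} t * f (x + t)) = (\<lambda>t. c * indicator {-d..d} t)"
    using assms(1) by (auto simp: indicator_def fun_eq_iff abs_le_iff)
  then show ?thesis using assms(2) by (simp add: moving_average_def)
qed

lemma window_exists_decay:
  fixes r R :: real
  assumes "0 < r" "r < R"
  shows "\<exists>q C. q \<in> borel_measurable borel \<and> (\<forall>x. 0 \<le> q x \<and> q x \<le> 1) \<and> (\<forall>x. \<bar>x\<bar> > R \<longrightarrow> q x = 0) \<and>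
     (\<forall>x. \<bar>x\<bar> \<le> r \<longrightarrow> q x = 1) \<and> (\<forall>\<omega>. cmod (fourier q \<omega>) * \<bar>\<omega>\<bar> ^ m \<le> C)"
  using assms
proof (induction m arbitrary: r R)
  case 0
  define q :: "real \<Rightarrow> real" where "q = indicator {-R..R}"
  have "cmod (fourier q \<omega>) \<le> (LINT x|lborel. \<bar>q x\<bar>)" for \<omega>
    by (rule fourier_bound) (simp add: q_def integrable_indicator_Icc)
  moreover have "q \<in> borel_measurable borel" "\<And>x. 0 \<le> q x \<and> q x \<le> 1" "\<And>x. \<bar>x\<bar> > R \<Longrightarrow> q x = 0" "\<And>x. \<bar>x\<bar> \<le> r \<Longrightarrow> q x = 1"
    using 0 by (auto simp: q_def indicator_def)
  ultimately show ?case
    by (intro exI[of _ q] exI[of _ "LINT x|lborel. \<bar>q x\<bar>"]) simp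
next
  case (Suc m)
  \<comment> \<open>A third of the transition zone goes to this average, on either side; the rest is left
to the window of the induction hypothesis.\<close>
  define d where "d = (R - r) / 3"
  have d: "d > 0" "0 < r + d" "r + d < R - d" using Suc.prems by (auto simp: d_def field_simps)
  from Suc.IH[OF d(2,3)] obtain f C where f [measurable]: "f \<in> borel_measurable borel"
    and f01: "\<And>x. 0 \<le> f x \<and> f x \<le> 1" and fz: "\<And>x. \<bar>x\<bar> > R - d \<Longrightarrow> f x = 0" and f1: "\<And>x. \<bar>x\<bar> \<le> r + d \<Longrightarrow> f x = 1"
    and fC: "\<And>\<omega>. cmod (fourier f \<omega>) * \<bar>\<omega>\<bar> ^ m \<le> C" by metis
  have fi: "integrable lborel f"
    by (rule integrable_compact_support[where C=1 and R="R - d"]) (use f01 fz in auto)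
  have C0: "0 \<le> C" using order_trans[OF _ fC[of 0]] by simp
  have "cmod (fourier (moving_average d f) \<omega>) * \<bar>\<omega>\<bar> ^ Suc m \<le> C / d" for \<omega>
  proof (cases "\<omega> = 0")
    case True then show ?thesis using C0 d by simp
  next
    case False
    have "cmod (fourier (moving_average d f) \<omega>) * \<bar>\<omega>\<bar> ^ Suc m \<le> cmod (fourier f \<omega>) / (d * \<bar>\<omega>\<bar>) * \<bar>\<omega>\<bar> ^ Suc m"
      by (intro mult_right_mono fourier_moving_average_le f fi d(1) False) simp
    also have "\<dots> = cmod (fourier f \<omega>) * \<bar>\<omega>\<bar> ^ m / d" using False by simp
    also have "\<dots> \<le> C / d" using fC d by (intro divide_right_mono) auto
    finally show ?thesis .
  qed
  moreover have "moving_average d f x = 0" if "\<bar>x\<bar> > R" for x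
    by (rule moving_average_const[OF _ d(1)], rule fz) (use that in linarith)
  moreover have "moving_average d f x = 1" if "\<bar>x\<bar> \<le> r" for x
    by (rule moving_average_const[OF _ d(1)], rule f1) (use that in linarith)
  ultimately show ?case
    using moving_average_bounds[OF f f01 d(1)] f
    by (intro exI[of _ "moving_average d f"] exI[of _ "C / d"]) (simp del: power_Suc)
qed

lemma nn_integral_inverse_1_plus_square_finite:
  "(\<integral>\<^sup>+x. ennreal (inverse (1 + x\<^sup>2)) \<partial>lborel) < \<infinity>"
proof -
  have "integrable lborel (\<lambda>x::real. inverse (1 + x\<^sup>2))"
    using integrable_inverse_1_plus_square by (simp add: set_integrable_def)
  then show ?thesis by (subst nn_integral_eq_integral) auto
qed

text \<open>After \<open>m \<ge> \<beta> + 1\<close> averages the transform is bounded near 0 and \<open>O(\<bar>\<omega>\<bar> powr (- m))\<close> at infinity, so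
the weighted square is dominated by a multiple of \<open>1 / (1 + \<omega>\<^sup>2)\<close>.\<close>

lemma window_exists:
  fixes e \<beta> :: real
  assumes e: "0 < e" "e < 1" and b: "\<beta> > 0"
  shows "\<exists>q. q \<in> borel_measurable borel \<and> (\<forall>x. 0 \<le> q x \<and> q x \<le> 1) \<and> (\<forall>x. \<bar>x\<bar> > 1 \<longrightarrow> q x = 0) \<and>
     (\<forall>x. \<bar>x\<bar> \<le> 1 - e \<longrightarrow> q x = 1) \<and>
     (\<integral>\<^sup>+\<omega>. ennreal ((1 + \<bar>\<omega>\<bar>) powr (2 * \<beta>) * (cmod (fourier q \<omega>))\<^sup>2) \<partial>lborel) < \<infinity>"
proof -
  define m where "m = nat \<lceil>\<beta>\<rceil> + 1"
  have m: "real m \<ge> \<beta> + 1" unfolding m_def using b by linarith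
  obtain q C where q [measurable]: "q \<in> borel_measurable borel"
    and q01: "\<And>x. 0 \<le> q x \<and> q x \<le> 1" and qz: "\<And>x. \<bar>x\<bar> > 1 \<Longrightarrow> q x = 0" and q1: "\<And>x. \<bar>x\<bar> \<le> 1 - e \<Longrightarrow> q x = 1"
    and qC: "\<And>\<omega>. cmod (fourier q \<omega>) * \<bar>\<omega>\<bar> ^ m \<le> C"
    using window_exists_decay[of "1 - e" 1 m] e by auto
  have qi: "integrable lborel q"
    by (rule integrable_compact_support[where C=1 and R=1]) (use q01 qz in auto)
  define A where "A = (LINT x|lborel. \<bar>q x\<bar>)"
  have A: "cmod (fourier q \<omega>) \<le> A" for \<omega> unfolding A_def by (rule fourier_bound[OF qi])
  have A0: "A \<ge> 0" and C0: "C \<ge> 0" using order_trans[OF _ A[of 0]] order_trans[OF _ qC[of 0]] by auto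
  define K where "K = 2 powr (2 * \<beta>) * (A\<^sup>2 + C\<^sup>2) * 2"
  have K0: "K \<ge> 0" by (simp add: K_def)
  have bound: "(1 + \<bar>\<omega>\<bar>) powr (2 * \<beta>) * (cmod (fourier q \<omega>))\<^sup>2 \<le> K * inverse (1 + \<omega>\<^sup>2)" for \<omega>
  proof -
    have "(1 + \<bar>\<omega>\<bar>) powr (2 * \<beta>) * (cmod (fourier q \<omega>))\<^sup>2 * (1 + \<omega>\<^sup>2) \<le> K"
    proof (cases "\<bar>\<omega>\<bar> \<le> 1")
      case True
      have "(1 + \<bar>\<omega>\<bar>) powr (2 * \<beta>) \<le> 2 powr (2 * \<beta>)" using True b by (intro powr_mono2) auto
      moreover have "(cmod (fourier q \<omega>))\<^sup>2 \<le> A\<^sup>2 + C\<^sup>2" using power_mono[OF A[of \<omega>], of 2] by (simp add: add_increasing2)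
      moreover have "1 + \<omega>\<^sup>2 \<le> 2" using True by (simp add: abs_square_le_1)
      ultimately show ?thesis unfolding K_def by (intro mult_mono) auto
    next
      case False
      then have w1: "\<bar>\<omega>\<bar> \<ge> 1" by simp
      have "(1 + \<bar>\<omega>\<bar>) powr (2 * \<beta>) \<le> (2 * \<bar>\<omega>\<bar>) powr (2 * \<beta>)" using w1 b by (intro powr_mono2) auto
      also have "\<dots> = 2 powr (2 * \<beta>) * \<bar>\<omega>\<bar> powr (2 * \<beta>)" by (simp add: powr_mult)
      finally have 1: "(1 + \<bar>\<omega>\<bar>) powr (2 * \<beta>) \<le> 2 powr (2 * \<beta>) * \<bar>\<omega>\<bar> powr (2 * \<beta>)" .
      have 2: "1 + \<omega>\<^sup>2 \<le> 2 * \<bar>\<omega>\<bar> powr 2"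
        using w1 one_le_power[OF w1, of 2] by (simp add: powr_numeral)
      have "\<bar>\<omega>\<bar> powr (2 * \<beta>) * \<bar>\<omega>\<bar> powr 2 = \<bar>\<omega>\<bar> powr (2 * \<beta> + 2)" by (simp add: powr_add)
      also have "\<dots> \<le> \<bar>\<omega>\<bar> powr (real (2 * m))" using w1 m by (intro powr_mono) auto
      also have "\<dots> = (\<bar>\<omega>\<bar> ^ m)\<^sup>2" using w1 by (subst powr_realpow) (auto simp: power_mult[symmetric] mult.commute)
      finally have 3: "\<bar>\<omega>\<bar> powr (2 * \<beta>) * \<bar>\<omega>\<bar> powr 2 \<le> (\<bar>\<omega>\<bar> ^ m)\<^sup>2" .
      have "(1 + \<bar>\<omega>\<bar>) powr (2 * \<beta>) * (cmod (fourier q \<omega>))\<^sup>2 * (1 + \<omega>\<^sup>2) \<le>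
          (2 powr (2 * \<beta>) * \<bar>\<omega>\<bar> powr (2 * \<beta>)) * (cmod (fourier q \<omega>))\<^sup>2 * (2 * \<bar>\<omega>\<bar> powr 2)"
        using 1 2 by (intro mult_mono) auto
      also have "\<dots> = 2 powr (2 * \<beta>) * 2 * (cmod (fourier q \<omega>))\<^sup>2 * (\<bar>\<omega>\<bar> powr (2 * \<beta>) * \<bar>\<omega>\<bar> powr 2)" by (simp add: mult_ac)
      also have "\<dots> \<le> 2 powr (2 * \<beta>) * 2 * (cmod (fourier q \<omega>))\<^sup>2 * (\<bar>\<omega>\<bar> ^ m)\<^sup>2"
        using 3 by (intro mult_left_mono) auto
      also have "\<dots> = 2 powr (2 * \<beta>) * 2 * (cmod (fourier q \<omega>) * \<bar>\<omega>\<bar> ^ m)\<^sup>2" by (simp add: power_mult_distrib mult_ac)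
      also have "\<dots> \<le> 2 powr (2 * \<beta>) * 2 * C\<^sup>2"
        using qC[of \<omega>] by (intro mult_left_mono power_mono) auto
      also have "\<dots> \<le> K" unfolding K_def by (simp add: algebra_simps)
      finally show ?thesis .
    qed
    then show ?thesis by (simp add: field_simps add_pos_nonneg divide_simps)
  qed
  have "(\<integral>\<^sup>+\<omega>. ennreal ((1 + \<bar>\<omega>\<bar>) powr (2 * \<beta>) * (cmod (fourier q \<omega>))\<^sup>2) \<partial>lborel) \<le> (\<integral>\<^sup>+\<omega>. ennreal K * ennreal (inverse (1 + \<omega>\<^sup>2)) \<partial>lborel)"
    using bound K0 by (intro nn_integral_mono) (simp add: ennreal_mult[symmetric] ennreal_leI)
  also have "\<dots> = ennreal K * (\<integral>\<^sup>+\<omega>. ennreal (inverse (1 + \<omega>\<^sup>2)) \<partial>lborel)"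
    by (rule nn_integral_cmult) measurable
  also have "\<dots> < \<infinity>"
    using nn_integral_inverse_1_plus_square_finite by (auto simp: ennreal_mult_less_top)
  finally show ?thesis
    using q q01 qz q1 by blast
qed

lemma fourier_scaled:
  assumes c: "c > 0"
  shows "fourier (\<lambda>x. f (x / c)) \<omega> = complex_of_real c * fourier f (c * \<omega>)"
proof -
  have "fourier (\<lambda>x. f (x / c)) \<omega> = \<bar>c\<bar> *\<^sub>R (CLINT x|lborel. complex_of_real (f ((0 + c * x) / c)) * iexp (\<omega> * (0 + c * x)))"
    unfolding fourier_def using c by (subst lborel_integral_real_affine[of c _ 0]) auto
  also have "\<dots> = complex_of_real c * fourier f (c * \<omega>)"
    using c by (simp add: fourier_def scaleR_conv_of_real mult_ac)
  finally show ?thesis .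
qed

section \<open>The law of the sample and a polynomial prior\<close>

lemma integral_le_nn_integral:
  fixes f :: "'a \<Rightarrow> real"
  assumes "integrable M f"
  shows "ennreal (integral\<^sup>L M f) \<le> (\<integral>\<^sup>+x. ennreal (f x) \<partial>M)"
proof -
  have "integral\<^sup>L M f \<le> (LINT x|M. max 0 (f x))"
    using assms by (intro integral_mono) auto
  then have "ennreal (integral\<^sup>L M f) \<le> ennreal (LINT x|M. max 0 (f x))"
    by (rule ennreal_leI)
  also have "\<dots> = (\<integral>\<^sup>+x. ennreal (max 0 (f x)) \<partial>M)"
    using assms by (intro nn_integral_eq_integral[symmetric]) auto
  also have "\<dots> = (\<integral>\<^sup>+x. ennreal (f x) \<partial>M)"
    by (intro nn_integral_cong) (auto simp: max_def ennreal_neg)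
  finally show ?thesis .
qed

lemma prob_density_prob_space:
  assumes "prob_density f"
  shows "prob_space (density lborel (\<lambda>x. ennreal (f x)))"
proof
  have "emeasure (density lborel (\<lambda>x. ennreal (f x))) (space (density lborel (\<lambda>x. ennreal (f x)))) = (\<integral>\<^sup>+x. ennreal (f x) \<partial>lborel)"
    using assms by (subst emeasure_density) (auto simp: prob_density_def)
  also have "\<dots> = 1"
    using assms by (subst nn_integral_eq_integral) (auto simp: prob_density_def)
  finally show "emeasure (density lborel (\<lambda>x. ennreal (f x))) (space (density lborel (\<lambda>x. ennreal (f x)))) = 1" .
qed

lemma sample_law_prob_space:
  assumes "prob_density f"
  shows "prob_space (sample_law n f)"
  unfolding sample_law_def by (intro prob_space_PiM prob_density_prob_space assms)

lemma sets_sample_law [measurable_cong]: "sets (sample_law n f) = sets (PiM {1..n} (\<lambda>_. borel))"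
  unfolding sample_law_def by (intro sets_PiM_cong) auto

lemma sample_law_eq_density:
  assumes f: "prob_density f"
  shows "sample_law n f = density (PiM {1..n} (\<lambda>_. lborel)) (\<lambda>X. \<Prod>i\<in>{1..n}. ennreal (f (X i)))"
proof -
  have [measurable]: "f \<in> borel_measurable borel" using f by (simp add: prob_density_def)
  interpret D: prob_space "density lborel (\<lambda>x. ennreal (f x))" by (rule prob_density_prob_space[OF f])
  interpret product_sigma_finite "\<lambda>_::nat. density lborel (\<lambda>x. ennreal (f x))"
    by (intro product_sigma_finite.intro D.sigma_finite_measure_axioms)
  interpret L: product_sigma_finite "\<lambda>_::nat. lborel::real measure"
    by (intro product_sigma_finite.intro sigma_finite_lborel)
  show ?thesis unfolding sample_law_def
  proof (rule PiM_eqI[symmetric])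
    show "sets (density (PiM {1..n} (\<lambda>_. lborel)) (\<lambda>X. \<Prod>i\<in>{1..n}. ennreal (f (X i)))) = sets (PiM {1..n} (\<lambda>_. density lborel (\<lambda>x. ennreal (f x))))"
      unfolding sets_density by (intro sets_PiM_cong) auto
    fix A :: "nat \<Rightarrow> real set" assume A: "\<And>i. i \<in> {1..n} \<Longrightarrow> A i \<in> sets (density lborel (\<lambda>x. ennreal (f x)))"
    then have A': "A i \<in> sets lborel" if "i \<in> {1..n}" for i using that by auto
    have [measurable]: "A i \<in> sets borel" if "i \<in> {1..n}" for i using A'[OF that] by simp
    have "emeasure (density (PiM {1..n} (\<lambda>_. lborel)) (\<lambda>X. \<Prod>i\<in>{1..n}. ennreal (f (X i)))) (Pi\<^sub>E {1..n} A)
      = (\<integral>\<^sup>+X. (\<Prod>i\<in>{1..n}. ennreal (f (X i))) * indicator (Pi\<^sub>E {1..n} A) X \<partial>PiM {1..n} (\<lambda>_. lborel))"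
      using A' by (intro emeasure_density sets_PiM_I_finite) auto
    also have "\<dots> = (\<integral>\<^sup>+X. (\<Prod>i\<in>{1..n}. ennreal (f (X i)) * indicator (A i) (X i)) \<partial>PiM {1..n} (\<lambda>_. lborel))"
      by (intro nn_integral_cong)
         (auto simp: prod.distrib indicator_def space_PiM PiE_iff extensional_def intro!: arg_cong2[where f="(*)"])
    also have "\<dots> = (\<Prod>i\<in>{1..n}. \<integral>\<^sup>+x. ennreal (f x) * indicator (A i) x \<partial>lborel)"
      by (rule L.product_nn_integral_prod) auto
    also have "\<dots> = (\<Prod>i\<in>{1..n}. emeasure (density lborel (\<lambda>x. ennreal (f x))) (A i))"
      using A' by (intro prod.cong refl emeasure_density[symmetric]) auto
    finally show "emeasure (density (PiM {1..n} (\<lambda>_. lborel)) (\<lambda>X. \<Prod>i\<in>{1..n}. ennreal (f (X i)))) (Pi\<^sub>E {1..n} A) = (\<Prod>i\<in>{1..n}. emeasure (density lborel (\<lambda>x. ennreal (f x))) (A i))" .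
  qed auto
qed

lemma measurable_PiM_lborel: "measurable (PiM I (\<lambda>_. lborel)) N = measurable (PiM I (\<lambda>_. borel)) N"
  by (intro measurable_cong_sets sets_PiM_cong) auto

lemma nn_integral_sample_law:
  assumes f: "prob_density f" and [measurable]: "g \<in> borel_measurable (PiM {1..n} (\<lambda>_. borel))"
  shows "(\<integral>\<^sup>+X. g X \<partial>sample_law n f) = (\<integral>\<^sup>+X. (\<Prod>i\<in>{1..n}. ennreal (f (X i))) * g X \<partial>PiM {1..n} (\<lambda>_. lborel))"
proof -
  have [measurable]: "f \<in> borel_measurable borel" using f by (simp add: prob_density_def)
  have [measurable]: "g \<in> borel_measurable (PiM {1..n} (\<lambda>_. lborel))"
    using assms(2) unfolding measurable_PiM_lborel .
  show ?thesis
    unfolding sample_law_eq_density[OF f]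
  proof (rule nn_integral_density)
    show "(\<lambda>X. \<Prod>i\<in>{1..n}. ennreal (f (X i))) \<in> borel_measurable (PiM {1..n} (\<lambda>_. lborel))" by measurable
  qed fact
qed

text \<open>This is used with \<open>y\<close> the score of one observation and \<open>r\<close> the score of the prior: the
mixed terms vanish because scores have mean zero.\<close>

lemma sample_sum_second_moment:
  fixes y :: "real \<Rightarrow> real"
  assumes f: "prob_density f" and [measurable]: "y \<in> borel_measurable borel" and bd: "\<And>x. \<bar>y x\<bar> \<le> C"
    and mean: "(LINT x|lborel. f x * y x) = 0" and var: "(LINT x|lborel. f x * (y x)\<^sup>2) \<le> V"
  shows "(\<integral>\<^sup>+X. ennreal (((\<Sum>i\<in>{1..n}. y (X i)) + r)\<^sup>2) \<partial>sample_law n f) \<le> ennreal (real n * V + r\<^sup>2)"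
proof -
  have [measurable]: "f \<in> borel_measurable borel" and f0: "\<And>x. f x \<ge> 0" using f by (auto simp: prob_density_def)
  define D where "D = density lborel (\<lambda>x. ennreal (f x))"
  interpret D: prob_space D unfolding D_def by (rule prob_density_prob_space[OF f])
  interpret product_sigma_finite "\<lambda>_::nat. D"
    by (intro product_sigma_finite.intro D.sigma_finite_measure_axioms)
  interpret N: prob_space "sample_law n f" by (rule sample_law_prob_space[OF f])
  have sl: "sample_law n f = PiM {1..n} (\<lambda>_. D)" by (simp add: sample_law_def D_def)
  have [measurable_cong]: "sets D = sets borel" by (simp add: D_def)
  have Dm: "(LINT x|D. y x) = 0"
    unfolding D_def using mean f0 by (subst integral_density) auto
  have Dv: "(LINT x|D. (y x)\<^sup>2) \<le> V"
    unfolding D_def using var f0 by (subst integral_density) auto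
  have iD: "integrable D g" if "g \<in> borel_measurable borel" "\<And>x. \<bar>g x\<bar> \<le> K" for g :: "real \<Rightarrow> real" and K
    by (rule D.integrable_const_bound[of _ K]) (use that in auto)
  have C0: "0 \<le> C" using bd[of 0] by linarith
  have bd2: "\<bar>(y x)\<^sup>2\<bar> \<le> C\<^sup>2" for x using bd[of x] by (simp add: abs_le_square_iff[symmetric] C0)
  have iN: "integrable (sample_law n f) g" if "g \<in> borel_measurable (PiM {1..n} (\<lambda>_. borel))" "\<And>x. x \<in> space (sample_law n f) \<Longrightarrow> \<bar>g x\<bar> \<le> K" for g :: "(nat \<Rightarrow> real) \<Rightarrow> real" and K
    by (rule N.integrable_const_bound[of _ K]) (use that in \<open>auto simp: measurable_cong_sets[OF sets_sample_law refl]\<close>)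
  have prodE: "(LINT X|sample_law n f. (\<Prod>i\<in>{1..n}. g i (X i))) = (\<Prod>i\<in>{1..n}. LINT x|D. g i x)"
    if "\<And>i. g i \<in> borel_measurable borel" "\<And>i x. \<bar>g i x\<bar> \<le> K" for g :: "nat \<Rightarrow> real \<Rightarrow> real" and K
    unfolding sl by (rule product_integral_prod) (auto intro!: iD that)
  have E1: "(LINT X|sample_law n f. y (X i)) = 0" if i: "i \<in> {1..n}" for i
  proof -
    have "(LINT X|sample_law n f. y (X i)) = (LINT X|sample_law n f. (\<Prod>j\<in>{1..n}. (if j = i then y (X j) else 1)))"
      using i by (intro Bochner_Integration.integral_cong refl) (subst prod.delta, auto)
    also have "\<dots> = (\<Prod>j\<in>{1..n}. LINT x|D. (if j = i then y x else 1))"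
      by (rule prodE[of _ "max C 1"]) (use bd in \<open>auto simp: le_max_iff_disj\<close>)
    also have "\<dots> = 0"
      by (rule prod_zero) (use i Dm in \<open>auto intro!: bexI[of _ i]\<close>)
    finally show ?thesis .
  qed
  have E2: "(LINT X|sample_law n f. y (X i) * y (X j)) = (if i = j then (LINT x|D. (y x)\<^sup>2) else 0)"
    if i: "i \<in> {1..n}" and j: "j \<in> {1..n}" for i j
  proof (cases "i = j")
    case True
    have "(LINT X|sample_law n f. y (X i) * y (X j)) = (LINT X|sample_law n f. (\<Prod>k\<in>{1..n}. (if k = i then (y (X k))\<^sup>2 else 1)))"
      using i True by (intro Bochner_Integration.integral_cong refl) (subst prod.delta, auto simp: power2_eq_square)
    also have "\<dots> = (\<Prod>k\<in>{1..n}. LINT x|D. (if k = i then (y x)\<^sup>2 else 1))"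
      by (rule prodE[of _ "max (C\<^sup>2) 1"]) (use bd2 in \<open>auto simp: le_max_iff_disj\<close>)
    also have "\<dots> = (\<Prod>k\<in>{1..n}. if k = i then (LINT x|D. (y x)\<^sup>2) else 1)"
      by (intro prod.cong refl) (auto simp: D.prob_space)
    also have "\<dots> = (LINT x|D. (y x)\<^sup>2)" using i by (subst prod.delta) auto
    finally show ?thesis using True by simp
  next
    case False
    have "(LINT X|sample_law n f. y (X i) * y (X j)) = (LINT X|sample_law n f. (\<Prod>k\<in>{1..n}. (if k = i then y (X k) else 1) * (if k = j then y (X k) else 1)))"
      using i j by (intro Bochner_Integration.integral_cong refl) (subst prod.distrib, subst prod.delta, simp, subst prod.delta, auto)
    also have "\<dots> = (\<Prod>k\<in>{1..n}. LINT x|D. (if k = i then y x else 1) * (if k = j then y x else 1))"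
      by (rule prodE[of _ "max C 1 * max C 1"]) 
         (measurable, unfold abs_mult, intro mult_mono, insert bd, auto simp: le_max_iff_disj)
    also have "\<dots> = 0"
      by (rule prod_zero) (use i Dm False in \<open>auto intro!: bexI[of _ i]\<close>)
    finally show ?thesis using False by simp
  qed
  have b1: "\<bar>y (X i) * y (X j)\<bar> \<le> C * C" for X :: "nat \<Rightarrow> real" and i j
    by (auto simp: abs_mult intro!: mult_mono bd C0)
  define S where "S = (\<lambda>X. \<Sum>i\<in>{1..n}. y (X i))"
  have expand: "(S X + r)\<^sup>2 = (\<Sum>i\<in>{1..n}. \<Sum>j\<in>{1..n}. y (X i) * y (X j)) + 2 * r * (\<Sum>i\<in>{1..n}. y (X i)) + r\<^sup>2" for X :: "nat \<Rightarrow> real"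
    unfolding S_def by (simp add: power2_eq_square sum_product algebra_simps)
  have ij: "integrable (sample_law n f) (\<lambda>X. y (X i) * y (X j))" if "i \<in> {1..n}" "j \<in> {1..n}" for i j
    using that by (intro iN[of _ "C * C"] b1) auto
  have i1: "integrable (sample_law n f) (\<lambda>X. y (X i))" if "i \<in> {1..n}" for i
    using that by (intro iN[of _ C] bd) auto
  have int: "integrable (sample_law n f) (\<lambda>X. (S X + r)\<^sup>2)"
    unfolding expand by (intro L1_intros ij i1 N.integrable_const)
  have "(LINT X|sample_law n f. (S X + r)\<^sup>2) = (\<Sum>i\<in>{1..n}. \<Sum>j\<in>{1..n}. (LINT X|sample_law n f. y (X i) * y (X j))) + 2 * r * (\<Sum>i\<in>{1..n}. (LINT X|sample_law n f. y (X i))) + r\<^sup>2"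
  proof -
    note ints = L1_intros ij i1 N.integrable_const
    have 1: "(LINT X|sample_law n f. (\<Sum>i\<in>{1..n}. \<Sum>j\<in>{1..n}. y (X i) * y (X j))) = (\<Sum>i\<in>{1..n}. \<Sum>j\<in>{1..n}. (LINT X|sample_law n f. y (X i) * y (X j)))"
      by (subst Bochner_Integration.integral_sum, intro ints, assumption+)
         (intro sum.cong refl Bochner_Integration.integral_sum ints)
    have 2: "(LINT X|sample_law n f. 2 * r * (\<Sum>i\<in>{1..n}. y (X i))) = 2 * r * (\<Sum>i\<in>{1..n}. (LINT X|sample_law n f. y (X i)))"
      by (subst Bochner_Integration.integral_sum[symmetric]) (use i1 in auto)
    show ?thesis unfolding expand
      by (subst Bochner_Integration.integral_add, (intro ints; assumption), (intro ints; assumption),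
          subst Bochner_Integration.integral_add, (intro ints; assumption), (intro ints; assumption))
         (simp only: 1 2, simp add: N.prob_space)
  qed
  also have "\<dots> = (\<Sum>i\<in>{1..n}. \<Sum>j\<in>{1..n}. if i = j then (LINT x|D. (y x)\<^sup>2) else 0) + r\<^sup>2"
  proof -
    have "(\<Sum>i\<in>{1..n}. \<Sum>j\<in>{1..n}. (LINT X|sample_law n f. y (X i) * y (X j))) = (\<Sum>i\<in>{1..n}. \<Sum>j\<in>{1..n}. if i = j then (LINT x|D. (y x)\<^sup>2) else 0)"
      by (intro sum.cong refl E2)
    moreover have "(\<Sum>i\<in>{1..n}. (LINT X|sample_law n f. y (X i))) = 0"
      by (intro sum.neutral ballI E1)
    ultimately show ?thesis by simp
  qed
  also have "\<dots> \<le> real n * V + r\<^sup>2"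
    using Dv by (simp add: mult_left_mono)
  finally have le: "(LINT X|sample_law n f. (S X + r)\<^sup>2) \<le> real n * V + r\<^sup>2" .
  have "(\<integral>\<^sup>+X. ennreal ((S X + r)\<^sup>2) \<partial>sample_law n f) = ennreal (LINT X|sample_law n f. (S X + r)\<^sup>2)"
    by (rule nn_integral_eq_integral[OF int]) simp
  also have "\<dots> \<le> ennreal (real n * V + r\<^sup>2)" by (rule ennreal_leI[OF le])
  finally show ?thesis unfolding S_def .
qed

text \<open>The beta-type densities proportional to \<open>(1 - u\<^sup>2) ^ p\<close> approach a Gaussian after rescaling as \<open>p\<close>
grows, but have compact support. Their moments follow from a one-step recursion.\<close>

definition bump :: "nat \<Rightarrow> real \<Rightarrow> real" where
  "bump p u = indicator {-1..1} u * (1 - u\<^sup>2) ^ p"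

definition bump_mass :: "nat \<Rightarrow> real" where
  "bump_mass p = (LINT u|lborel. bump p u)"

lemma bump_measurable [measurable]: "bump p \<in> borel_measurable borel"
  unfolding bump_def[abs_def] by measurable

lemma bump_nonneg: "bump p u \<ge> 0"
  by (auto simp: bump_def indicator_def abs_square_le_1 abs_le_iff)

lemma integrable_on_Icc:
  fixes g :: "real \<Rightarrow> real"
  assumes "continuous_on {a..b} g"
  shows "integrable lborel (\<lambda>u. indicator {a..b} u * g u)"
  using borel_integrable_atLeastAtMost'[OF assms] by (simp add: set_integrable_def)

lemma bump_integrable: "integrable lborel (bump p)"
  unfolding bump_def[abs_def] by (intro integrable_on_Icc continuous_intros)

lemma FTC_Icc:
  fixes F f :: "real \<Rightarrow> real"
  assumes "a \<le> b" "\<And>x. a \<le> x \<Longrightarrow> x \<le> b \<Longrightarrow> (F has_real_derivative f x) (at x)" "continuous_on {a..b} f"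
  shows "(LINT x|lborel. indicator {a..b} x * f x) = F b - F a"
  using integral_FTC_atLeastAtMost[of a b F f] assms
  by (auto simp: has_real_derivative_iff_has_vector_derivative has_vector_derivative_at_within)

text \<open>The derivative of \<open>u (1 - u\<^sup>2) ^ (p + 1)\<close> integrates to zero over \<open>[-1, 1]\<close>.\<close>

lemma bump_mass_Suc: "real (2 * p + 3) * bump_mass (Suc p) = real (2 * p + 2) * bump_mass p"
proof -
  have "(LINT u|lborel. indicator {-1..1} u * ((1 - u\<^sup>2) ^ Suc p - real (2 * p + 2) * u\<^sup>2 * (1 - u\<^sup>2) ^ p)) = 1 * (1 - 1\<^sup>2) ^ Suc p - (- 1) * (1 - (- 1)\<^sup>2) ^ Suc p"
    by (rule FTC_Icc[where F="\<lambda>u. u * (1 - u\<^sup>2) ^ Suc p"])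
       (auto intro!: derivative_eq_intros continuous_intros simp del: power_Suc simp: algebra_simps power2_eq_square)
  also have "\<dots> = 0" by simp
  also have "(\<lambda>u. indicator {-1..1} u * ((1 - u\<^sup>2) ^ Suc p - real (2 * p + 2) * u\<^sup>2 * (1 - u\<^sup>2) ^ p)) = (\<lambda>u. real (2 * p + 3) * bump (Suc p) u - real (2 * p + 2) * bump p u)"
    by (auto simp: bump_def fun_eq_iff indicator_def algebra_simps)
  finally show ?thesis
    using bump_integrable by (simp add: bump_mass_def)
qed

lemma bump_mass_pos: "bump_mass p > 0"
proof (induction p)
  case 0
  have "bump_mass 0 = 2" by (simp add: bump_mass_def bump_def)
  then show ?case by simp
next
  case (Suc p)
  have "real (2 * p + 3) * bump_mass (Suc p) > 0"
    unfolding bump_mass_Suc using Suc by simp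
  then show ?case by (simp add: zero_less_mult_iff)
qed

lemma bump_second_moment:
  "integrable lborel (\<lambda>u. u\<^sup>2 * bump p u)"
  "(LINT u|lborel. u\<^sup>2 * bump p u) = bump_mass p / real (2 * p + 3)"
proof -
  have eq: "(\<lambda>u. u\<^sup>2 * bump p u) = (\<lambda>u. bump p u - bump (Suc p) u)"
    by (auto simp: bump_def fun_eq_iff algebra_simps)
  show "integrable lborel (\<lambda>u. u\<^sup>2 * bump p u)" unfolding eq using bump_integrable by auto
  have "(LINT u|lborel. u\<^sup>2 * bump p u) = bump_mass p - bump_mass (Suc p)"
    unfolding eq using bump_integrable by (simp add: bump_mass_def)
  also have "bump_mass (Suc p) = real (2 * p + 2) * bump_mass p / real (2 * p + 3)"
    using bump_mass_Suc[of p] by (simp add: field_simps)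
  also have "bump_mass p - real (2 * p + 2) * bump_mass p / real (2 * p + 3) = bump_mass p / real (2 * p + 3)"
    by (simp add: field_simps)
  finally show "(LINT u|lborel. u\<^sup>2 * bump p u) = bump_mass p / real (2 * p + 3)" .
qed

text \<open>The Fisher information of the prior with exponent \<open>q + 2\<close>, see \<open>prior_info_integral\<close>. Exponents below
2 are avoided since there the derivative of the density does not vanish at the end points.\<close>

definition prior_info :: "nat \<Rightarrow> real" where
  "prior_info q = (real q + 2) * (2 * real q + 5) / (real q + 1)"

text \<open>The squared score \<open>(2 (q + 2) u / (1 - u\<^sup>2))\<^sup>2\<close> lowers the exponent from \<open>q + 2\<close> to \<open>q\<close>, which leaves a second
moment with exponent \<open>q\<close>.\<close>

lemma prior_info_integral:
  "(LINT u|lborel. (2 * (real q + 2))\<^sup>2 * (u\<^sup>2 * bump q u)) = prior_info q * bump_mass (q + 2)"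
proof -
  have 1: "real (2 * q + 3) * bump_mass (Suc q) = real (2 * q + 2) * bump_mass q" by (rule bump_mass_Suc)
  have 2: "real (2 * q + 5) * bump_mass (Suc (Suc q)) = real (2 * q + 4) * bump_mass (Suc q)"
    using bump_mass_Suc[of "Suc q"] by (simp add: algebra_simps)
  define Q where "Q = real q"
  define m where "m = bump_mass q"
  have Q: "Q \<ge> 0" by (simp add: Q_def)
  have "bump_mass (q + 2) = 2 * (Q + 2) / (2 * Q + 5) * bump_mass (Suc q)"
    using 2 Q by (simp add: divide_simps Q_def) (simp add: algebra_simps)
  also have "bump_mass (Suc q) = 2 * (Q + 1) / (2 * Q + 3) * m"
    using 1 Q by (simp add: divide_simps Q_def m_def) (simp add: algebra_simps)
  finally have "prior_info q * bump_mass (q + 2) = (Q + 2) * (2 * Q + 5) / (Q + 1) * (2 * (Q + 2) / (2 * Q + 5) * (2 * (Q + 1) / (2 * Q + 3) * m))"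
    by (simp add: prior_info_def Q_def)
  also have "\<dots> = (2 * (Q + 2))\<^sup>2 * (m / (2 * Q + 3))"
    using Q by (simp add: divide_simps power2_eq_square) (auto simp: algebra_simps)
  finally show ?thesis
    by (simp add: bump_second_moment Q_def m_def)
qed

section \<open>The van Trees inequality for linear families\<close>

text \<open>For a fixed sample the joint density \<open>F u = P u * (1 - u\<^sup>2) ^ (q + 2)\<close> is a polynomial in the parameter
that vanishes at \<open>1\<close> and \<open>-1\<close>. Integration by parts of \<open>(c - s u) F'\<close> yields \<open>s\<close> times the integral of \<open>F\<close>, and
with \<open>F' = Z F\<close> the inequality \<open>2 x z \<le> l x\<^sup>2 + z\<^sup>2 / l\<close> separates the estimation error from the score \<open>Z\<close>.
Using this inequality in place of Cauchy-Schwarz keeps everything nonnegative after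
integration over the sample, so the argument covers estimators of infinite risk.\<close>

lemma score_pointwise:
  fixes a b :: "'i \<Rightarrow> real" and q :: nat
  assumes I: "finite I" and ab: "\<And>i. i \<in> I \<Longrightarrow> 2 * \<bar>b i\<bar> \<le> a i" and l: "l > 0" and s: "s \<ge> 0"
  defines "P \<equiv> \<lambda>u. \<Prod>i\<in>I. a i + u * b i"
  defines "Z \<equiv> \<lambda>u. (\<Sum>i\<in>I. b i / (a i + u * b i)) + (- (2 * (real q + 2) * u) / (1 - u\<^sup>2))"
  shows "ennreal (2 * s) * (\<integral>\<^sup>+u. ennreal (P u * bump (q + 2) u) \<partial>lborel) \<le>
     (\<integral>\<^sup>+u. ennreal (l * (c - s * u)\<^sup>2 * (P u * bump (q + 2) u)) + ennreal (1 / l * ((Z u)\<^sup>2 * (P u * bump (q + 2) u))) \<partial>lborel)"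
proof -
  define P' where "P' = (\<lambda>u. \<Sum>i\<in>I. b i * (\<Prod>j\<in>I - {i}. a j + u * b j))"
  define W where "W = (\<lambda>u::real. (1 - u\<^sup>2) ^ (q + 2))"
  define W' where "W' = (\<lambda>u::real. real (q + 2) * (1 - u\<^sup>2) ^ (q + 1) * (- 2 * u))"
  define F' where "F' = (\<lambda>u. P' u * W u + P u * W' u)"
  have dP: "(P has_real_derivative P' u) (at u)" for u
    unfolding P_def P'_def by (rule has_field_derivative_prod) (auto intro!: derivative_eq_intros)
  have dW: "(W has_real_derivative W' u) (at u)" for u
    unfolding W_def W'_def by (auto intro!: derivative_eq_intros simp del: power_Suc)
  have cP: "continuous_on A P" and cP': "continuous_on A P'" and cW: "continuous_on A W" and cW': "continuous_on A W'" for A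
    unfolding P_def P'_def W_def W'_def by (auto intro!: continuous_intros)
  have cF': "continuous_on A F'" for A
    unfolding F'_def by (intro continuous_intros cP cP' cW cW')
  have "(LINT u|lborel. indicator {-1..1} u * (2 * (c - s * u) * F' u - 2 * s * (P u * W u))) = 2 * (c - s * 1) * (P 1 * W 1) - 2 * (c - s * (-1)) * (P (-1) * W (-1))"
    by (rule FTC_Icc[where F="\<lambda>u. 2 * (c - s * u) * (P u * W u)"])
       (auto intro!: derivative_eq_intros dP dW continuous_intros cP cW cF', auto simp: F'_def algebra_simps)
  also have "\<dots> = 0" by (simp add: W_def)
  also have "(LINT u|lborel. indicator {-1..1} u * (2 * (c - s * u) * F' u - 2 * s * (P u * W u))) =
     (LINT u|lborel. indicator {-1..1} u * (2 * (c - s * u) * F' u) - 2 * s * (indicator {-1..1} u * (P u * W u)))"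
    by (simp add: algebra_simps)
  also have "\<dots> = (LINT u|lborel. indicator {-1..1} u * (2 * (c - s * u) * F' u)) - 2 * s * (LINT u|lborel. indicator {-1..1} u * (P u * W u))"
    by (subst Bochner_Integration.integral_diff)
       (auto intro!: integrable_on_Icc Bochner_Integration.integrable_mult_right continuous_intros cF' cP cW)
  finally have parts: "2 * s * (LINT u|lborel. indicator {-1..1} u * (P u * W u)) = (LINT u|lborel. indicator {-1..1} u * (2 * (c - s * u) * F' u))"
    by simp
  have pos: "a i + u * b i \<ge> 0 \<and> (a i + u * b i = 0 \<longrightarrow> b i = 0)" if "i \<in> I" "\<bar>u\<bar> \<le> 1" for i u
  proof -
    have "\<bar>u * b i\<bar> \<le> \<bar>b i\<bar>" using that(2) by (simp add: abs_mult mult_left_le_one_le)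
    with ab[OF that(1)] show ?thesis by (auto simp: abs_le_iff)
  qed
  have P0: "P u \<ge> 0" if "\<bar>u\<bar> \<le> 1" for u
    unfolding P_def using pos that by (intro prod_nonneg) blast
  have P'_eq: "P' u = P u * (\<Sum>i\<in>I. b i / (a i + u * b i))" if u: "\<bar>u\<bar> \<le> 1" for u
  proof -
    have "b i * (\<Prod>j\<in>I - {i}. a j + u * b j) = P u * (b i / (a i + u * b i))" if i: "i \<in> I" for i
    proof -
      have "P u = (a i + u * b i) * (\<Prod>j\<in>I - {i}. a j + u * b j)"
        unfolding P_def using I i by (subst prod.remove[of _ i]) auto
      then show ?thesis using pos[OF i u] by (cases "a i + u * b i = 0") auto
    qed
    then show ?thesis unfolding P'_def sum_distrib_left by (intro sum.cong) auto
  qed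
  have le1: "u\<^sup>2 \<le> 1" if "\<bar>u\<bar> \<le> 1" for u :: real using that by (simp add: abs_square_le_1)
  have key: "2 * (c - s * u) * F' u \<le> l * (c - s * u)\<^sup>2 * (P u * W u) + 1 / l * ((Z u)\<^sup>2 * (P u * W u))" if u: "\<bar>u\<bar> \<le> 1" for u
  proof -
    have W0: "W u \<ge> 0" unfolding W_def using le1[OF u] by simp
    have F'_eq: "F' u = Z u * (P u * W u)"
    proof (cases "u\<^sup>2 = 1")
      case True then show ?thesis by (simp add: F'_def W_def W'_def)
    next
      case False
      have "W' u = (- (2 * (real q + 2) * u) / (1 - u\<^sup>2)) * W u"
        using False unfolding W_def W'_def by (simp add: field_simps)
      then show ?thesis unfolding F'_def P'_eq[OF u] Z_def by (simp add: algebra_simps)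
    qed
    define v where "v = sqrt l"
    have v: "v > 0" "l = v\<^sup>2" using l by (auto simp: v_def)
    have "0 \<le> (v * (c - s * u) - Z u / v)\<^sup>2" by simp
    also have "\<dots> = l * (c - s * u)\<^sup>2 - 2 * (c - s * u) * Z u + 1 / l * (Z u)\<^sup>2"
      using v by (simp add: power2_diff power_mult_distrib power_divide)
    finally have "2 * (c - s * u) * Z u \<le> l * (c - s * u)\<^sup>2 + 1 / l * (Z u)\<^sup>2" by simp
    from mult_right_mono[OF this, of "P u * W u"] P0[OF u] W0
    show ?thesis unfolding F'_eq by (simp add: algebra_simps)
  qed
  have bW: "bump (q + 2) u = indicator {-1..1} u * W u" for u by (simp add: bump_def W_def)
  have nn: "P u * bump (q + 2) u \<ge> 0" for u
    using P0[of u] bump_nonneg[of "q + 2" u] by (cases "\<bar>u\<bar> \<le> 1") (auto simp: bump_def indicator_def abs_le_iff)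
  have intPW: "integrable lborel (\<lambda>u. P u * bump (q + 2) u)"
    using integrable_on_Icc[of "-1" 1 "\<lambda>u. P u * W u"] unfolding bW by (simp add: mult_ac continuous_on_mult cP cW)
  have "ennreal (2 * s) * (\<integral>\<^sup>+u. ennreal (P u * bump (q + 2) u) \<partial>lborel) = ennreal (2 * s * (LINT u|lborel. P u * bump (q + 2) u))"
    using s nn by (subst nn_integral_eq_integral[OF intPW]) (auto simp: ennreal_mult)
  also have "(LINT u|lborel. P u * bump (q + 2) u) = (LINT u|lborel. indicator {-1..1} u * (P u * W u))"
    unfolding bW by (simp add: mult_ac)
  also have "ennreal (2 * s * \<dots>) = ennreal (LINT u|lborel. indicator {-1..1} u * (2 * (c - s * u) * F' u))"
    by (simp only: parts)
  also have "\<dots> \<le> (\<integral>\<^sup>+u. ennreal (indicator {-1..1} u * (2 * (c - s * u) * F' u)) \<partial>lborel)"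
    by (rule integral_le_nn_integral) (intro integrable_on_Icc continuous_intros cF')
  also have "\<dots> \<le> (\<integral>\<^sup>+u. ennreal (l * (c - s * u)\<^sup>2 * (P u * bump (q + 2) u)) + ennreal (1 / l * ((Z u)\<^sup>2 * (P u * bump (q + 2) u))) \<partial>lborel)"
  proof (intro nn_integral_mono)
    fix u
    show "ennreal (indicator {-1..1} u * (2 * (c - s * u) * F' u)) \<le> ennreal (l * (c - s * u)\<^sup>2 * (P u * bump (q + 2) u)) + ennreal (1 / l * ((Z u)\<^sup>2 * (P u * bump (q + 2) u)))"
    proof (cases "u \<in> {-1..1}")
      case True
      then have "\<bar>u\<bar> \<le> 1" by auto
      from key[OF this] True have "indicator {-1..1} u * (2 * (c - s * u) * F' u) \<le> l * (c - s * u)\<^sup>2 * (P u * bump (q + 2) u) + 1 / l * ((Z u)\<^sup>2 * (P u * bump (q + 2) u))"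
        unfolding bW by simp
      moreover have "0 \<le> l * (c - s * u)\<^sup>2 * (P u * bump (q + 2) u)" "0 \<le> 1 / l * ((Z u)\<^sup>2 * (P u * bump (q + 2) u))"
        using nn[of u] l by (auto intro!: mult_nonneg_nonneg[OF _ nn] divide_nonneg_pos simp del: One_nat_def add_2_eq_Suc')
      ultimately show ?thesis
        by (simp only: ennreal_plus[symmetric] ennreal_leI)
    qed simp
  qed
  finally show ?thesis .
qed

text \<open>The pointwise inequality is integrated over the sample and divided by the mass of the prior. The left side becomes \<open>2 s\<close>, the
squared score becomes \<open>n V + J\<close>, and the choice \<open>l = (n V + J) / s\<close> turns the inequality into the van Trees bound
for estimating \<open>g + s u\<close>.\<close>

lemma van_trees_linear:
  fixes a b :: "real \<Rightarrow> real" and T :: "(nat \<Rightarrow> real) \<Rightarrow> real"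
  assumes a: "prob_density a" and b_int: "integrable lborel b" and b_mean: "(LINT x|lborel. b x) = 0"
    and ab: "\<And>x. 2 * \<bar>b x\<bar> \<le> a x"
    and info: "\<And>u. \<bar>u\<bar> \<le> 1 \<Longrightarrow> (LINT x|lborel. (b x)\<^sup>2 / (a x + u * b x)) \<le> V" and V: "V \<ge> 0"
    and T [measurable]: "T \<in> borel_measurable (PiM {1..n} (\<lambda>_. borel))"
    and s: "s \<ge> 0"
  shows "ennreal (s\<^sup>2 / (real n * V + prior_info q)) \<le>
    (\<integral>\<^sup>+u. ennreal (bump (q + 2) u / bump_mass (q + 2)) *
       (\<integral>\<^sup>+X. ennreal ((T X - (g + s * u))\<^sup>2) \<partial>sample_law n (\<lambda>x. a x + u * b x)) \<partial>lborel)"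
proof (cases "s = 0")
  case False
  then have s: "s > 0" using s by simp
  define J where "J = real n * V + prior_info q"
  have J: "J > 0" unfolding J_def prior_info_def using V by (intro add_nonneg_pos) (auto intro!: divide_pos_pos mult_pos_pos)
  define l where "l = J / s"
  have l: "l > 0" using J s by (simp add: l_def)
  define p where "p = (\<lambda>u x. a x + u * b x)"
  define m where "m = bump_mass (q + 2)"
  have m: "m > 0" by (simp add: m_def bump_mass_pos)
  have [measurable]: "a \<in> borel_measurable borel" and a0: "\<And>x. a x \<ge> 0" and a_int: "integrable lborel a"
    and a1: "(LINT x|lborel. a x) = 1"
    using a by (auto simp: prob_density_def)
  have [measurable]: "b \<in> borel_measurable borel" using b_int by auto
  have pos: "p u x \<ge> 0 \<and> \<bar>b x\<bar> \<le> p u x \<and> (p u x = 0 \<longrightarrow> b x = 0)" if "\<bar>u\<bar> \<le> 1" for u x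
  proof -
    have "\<bar>u * b x\<bar> \<le> \<bar>b x\<bar>" using that by (simp add: abs_mult mult_left_le_one_le)
    with ab[of x] show ?thesis unfolding p_def by (auto simp: abs_le_iff)
  qed
  have pd: "prob_density (p u)" if u: "\<bar>u\<bar> \<le> 1" for u
    unfolding prob_density_def p_def using pos[OF u] a_int b_int b_mean a1 by (auto simp: p_def)
  define P where "P = (\<lambda>u (X::nat \<Rightarrow> real). \<Prod>i\<in>{1..n}. p u (X i))"
  define Z where "Z = (\<lambda>u (X::nat \<Rightarrow> real). (\<Sum>i\<in>{1..n}. b (X i) / p u (X i)) + (- (2 * (real q + 2) * u) / (1 - u\<^sup>2)))"
  define N where "N = PiM {1..n} (\<lambda>_. lborel::real measure)"
  define B where "B = bump (q + 2)"
  let ?F = "\<lambda>u X. (P u X * B u)"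
  let ?R2 = "\<lambda>u. (real n * V * B u + (2 * (real q + 2))\<^sup>2 * (u\<^sup>2 * bump q u))"
  have [measurable]: "B \<in> borel_measurable borel" by (simp add: B_def)
  have B0: "B u \<ge> 0" for u by (simp add: B_def bump_nonneg)
  have Bz: "B u = 0" if "\<not> \<bar>u\<bar> \<le> 1" for u using that by (auto simp: B_def bump_def indicator_def)
  interpret product_sigma_finite "\<lambda>_::nat. lborel::real measure"
    by (intro product_sigma_finite.intro sigma_finite_lborel)
  interpret N: sigma_finite_measure N unfolding N_def by (rule sigma_finite) simp
  interpret LN: pair_sigma_finite lborel N
    by (intro pair_sigma_finite.intro sigma_finite_lborel N.sigma_finite_measure_axioms)
  have sN [measurable_cong]: "sets N = sets (PiM {1..n} (\<lambda>_. borel))"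
    unfolding N_def by (intro sets_PiM_cong) auto
  have [measurable]: "(\<lambda>(u, x). p u x) \<in> borel_measurable (borel \<Otimes>\<^sub>M borel)"
    unfolding p_def by measurable
  have Xi [measurable]: "(\<lambda>z. snd z i) \<in> borel_measurable (borel \<Otimes>\<^sub>M N)" if "i \<in> {1..n}" for i
    using that by measurable
  have Pm [measurable]: "(\<lambda>(u, X). P u X) \<in> borel_measurable (borel \<Otimes>\<^sub>M N)"
    unfolding P_def p_def split_beta by measurable
  have Zm [measurable]: "(\<lambda>(u, X). Z u X) \<in> borel_measurable (borel \<Otimes>\<^sub>M N)"
    unfolding Z_def p_def split_beta by measurable
  have P0: "P u X \<ge> 0" if "\<bar>u\<bar> \<le> 1" for u X unfolding P_def using pos[OF that] by (intro prod_nonneg) auto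
  have PB0: "P u X * B u \<ge> 0" for u X
    using P0[of u X] B0[of u] Bz[of u] by (cases "\<bar>u\<bar> \<le> 1") auto
  have Pe: "ennreal (P u X) = (\<Prod>i\<in>{1..n}. ennreal (p u (X i)))" if "\<bar>u\<bar> \<le> 1" for u X
    unfolding P_def using pos[OF that] by (intro prod_ennreal[symmetric]) auto
  have law: "(\<integral>\<^sup>+X. ennreal (h X * (?F u X)) \<partial>N) = ennreal (B u) * (\<integral>\<^sup>+X. ennreal (h X) \<partial>sample_law n (p u))"
    if [measurable]: "h \<in> borel_measurable (PiM {1..n} (\<lambda>_. borel))" and h0: "\<And>X. h X \<ge> 0" for h u
  proof (cases "\<bar>u\<bar> \<le> 1")
    case True
    have "(\<integral>\<^sup>+X. ennreal (h X) \<partial>sample_law n (p u)) = (\<integral>\<^sup>+X. ennreal (P u X) * ennreal (h X) \<partial>N)"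
      unfolding N_def by (subst nn_integral_sample_law[OF pd[OF True]], measurable) (simp only: Pe[OF True])
    moreover have "(\<integral>\<^sup>+X. ennreal (h X * (?F u X)) \<partial>N) = (\<integral>\<^sup>+X. ennreal (B u) * (ennreal (P u X) * ennreal (h X)) \<partial>N)"
      using P0[OF True] B0 h0 by (simp add: ennreal_mult[symmetric] mult_ac)
    moreover have "\<dots> = ennreal (B u) * (\<integral>\<^sup>+X. ennreal (P u X) * ennreal (h X) \<partial>N)"
      by (rule nn_integral_cmult) (auto simp: P_def p_def)
    ultimately show ?thesis by simp
  qed (simp add: Bz)
  have pointwise: "ennreal (2 * s) * (\<integral>\<^sup>+u. ennreal (?F u X) \<partial>lborel) \<le>
     (\<integral>\<^sup>+u. ennreal (l * (T X - g - s * u)\<^sup>2 * (?F u X)) + ennreal (1 / l * ((Z u X)\<^sup>2 * (?F u X))) \<partial>lborel)" for X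
    using score_pointwise[of "{1..n}" "\<lambda>i. b (X i)" "\<lambda>i. a (X i)" l s q "T X - g"] ab l s
    unfolding P_def Z_def B_def p_def by simp
  have "ennreal (2 * s * m) = ennreal (2 * s) * (\<integral>\<^sup>+u. ennreal (B u) \<partial>lborel)"
    using s m unfolding m_def bump_mass_def B_def
    by (subst nn_integral_eq_integral) (auto simp: bump_nonneg bump_integrable ennreal_mult)
  also have "(\<integral>\<^sup>+u. ennreal (B u) \<partial>lborel) = (\<integral>\<^sup>+u. \<integral>\<^sup>+X. ennreal (?F u X) \<partial>N \<partial>lborel)"
  proof (intro nn_integral_cong)
    fix u
    show "ennreal (B u) = (\<integral>\<^sup>+X. ennreal (?F u X) \<partial>N)"
    proof (cases "\<bar>u\<bar> \<le> 1")
      case True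
      interpret S: prob_space "sample_law n (p u)" by (rule sample_law_prob_space[OF pd[OF True]])
      show ?thesis using law[of "\<lambda>_. 1" u] by (simp add: S.emeasure_space_1)
    qed (simp add: Bz)
  qed
  also have "\<dots> = (\<integral>\<^sup>+X. \<integral>\<^sup>+u. ennreal (?F u X) \<partial>lborel \<partial>N)"
    by (rule LN.Fubini'[symmetric]) measurable
  also have "ennreal (2 * s) * \<dots> = (\<integral>\<^sup>+X. ennreal (2 * s) * (\<integral>\<^sup>+u. ennreal (?F u X) \<partial>lborel) \<partial>N)"
    by (rule nn_integral_cmult[symmetric]) measurable
  also have "\<dots> \<le> (\<integral>\<^sup>+X. \<integral>\<^sup>+u. ennreal (l * (T X - g - s * u)\<^sup>2 * (?F u X)) + ennreal (1 / l * ((Z u X)\<^sup>2 * (?F u X))) \<partial>lborel \<partial>N)"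
    by (intro nn_integral_mono pointwise)
  also have "\<dots> = (\<integral>\<^sup>+u. \<integral>\<^sup>+X. ennreal (l * (T X - g - s * u)\<^sup>2 * (?F u X)) + ennreal (1 / l * ((Z u X)\<^sup>2 * (?F u X))) \<partial>N \<partial>lborel)"
    by (rule LN.Fubini') measurable
  also have "\<dots> = (\<integral>\<^sup>+u. (\<integral>\<^sup>+X. ennreal (l * (T X - g - s * u)\<^sup>2 * (?F u X)) \<partial>N) + (\<integral>\<^sup>+X. ennreal (1 / l * ((Z u X)\<^sup>2 * (?F u X))) \<partial>N) \<partial>lborel)"
    by (intro nn_integral_cong nn_integral_add) measurable
  also have "\<dots> = (\<integral>\<^sup>+u. \<integral>\<^sup>+X. ennreal (l * (T X - g - s * u)\<^sup>2 * (?F u X)) \<partial>N \<partial>lborel) + (\<integral>\<^sup>+u. \<integral>\<^sup>+X. ennreal (1 / l * ((Z u X)\<^sup>2 * (?F u X))) \<partial>N \<partial>lborel)"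
    by (rule nn_integral_add) measurable
  also have "(\<integral>\<^sup>+u. \<integral>\<^sup>+X. ennreal (l * (T X - g - s * u)\<^sup>2 * (?F u X)) \<partial>N \<partial>lborel) =
      ennreal (l * m) * (\<integral>\<^sup>+u. ennreal (B u / m) * (\<integral>\<^sup>+X. ennreal ((T X - (g + s * u))\<^sup>2) \<partial>sample_law n (p u)) \<partial>lborel)"
    (is "?A = ennreal (l * m) * ?R")
  proof -
    have "(\<integral>\<^sup>+X. ennreal (l * (T X - g - s * u)\<^sup>2 * (?F u X)) \<partial>N) = ennreal (l * m) * (ennreal (B u / m) * (\<integral>\<^sup>+X. ennreal ((T X - (g + s * u))\<^sup>2) \<partial>sample_law n (p u)))" for u
    proof -
      have "(\<integral>\<^sup>+X. ennreal (l * (T X - g - s * u)\<^sup>2 * (?F u X)) \<partial>N) = (\<integral>\<^sup>+X. ennreal l * ennreal ((T X - (g + s * u))\<^sup>2 * (?F u X)) \<partial>N)"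
        using l PB0 by (intro nn_integral_cong) (simp add: ennreal_mult[symmetric] diff_diff_eq mult.assoc)
      also have "\<dots> = ennreal l * (ennreal (B u) * (\<integral>\<^sup>+X. ennreal ((T X - (g + s * u))\<^sup>2) \<partial>sample_law n (p u)))"
      proof -
        have 1: "(\<integral>\<^sup>+X. ennreal ((T X - (g + s * u))\<^sup>2 * (?F u X)) \<partial>N) = ennreal (B u) * (\<integral>\<^sup>+X. ennreal ((T X - (g + s * u))\<^sup>2) \<partial>sample_law n (p u))"
        proof (rule law)
          show "(\<lambda>X. (T X - (g + s * u))\<^sup>2) \<in> borel_measurable (PiM {1..n} (\<lambda>_. borel))" by measurable
        qed simp
        have 2: "(\<lambda>X. ennreal ((T X - (g + s * u))\<^sup>2 * (?F u X))) \<in> borel_measurable N"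
          by (simp only: P_def p_def) measurable
        show ?thesis unfolding 1[symmetric] by (rule nn_integral_cmult[OF 2])
      qed
      also have "ennreal l * (ennreal (B u) * (\<integral>\<^sup>+X. ennreal ((T X - (g + s * u))\<^sup>2) \<partial>sample_law n (p u))) = ennreal (l * m) * (ennreal (B u / m) * (\<integral>\<^sup>+X. ennreal ((T X - (g + s * u))\<^sup>2) \<partial>sample_law n (p u)))"
        using l m B0[of u] by (simp add: mult.assoc[symmetric] ennreal_mult[symmetric])
      finally show ?thesis .
    qed
    moreover have "(\<lambda>u. ennreal (B u / m) * (\<integral>\<^sup>+X. ennreal ((T X - (g + s * u))\<^sup>2) \<partial>sample_law n (p u))) \<in> borel_measurable lborel"
    proof -
      have "ennreal (B u / m) * (\<integral>\<^sup>+X. ennreal ((T X - (g + s * u))\<^sup>2) \<partial>sample_law n (p u)) = ennreal (1 / m) * (\<integral>\<^sup>+X. ennreal ((T X - (g + s * u))\<^sup>2 * (?F u X)) \<partial>N)" for u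
        using m B0[of u] by (subst law, measurable, simp) (simp add: mult.assoc[symmetric] ennreal_mult[symmetric])
      then show ?thesis by simp
    qed
    ultimately show ?thesis by (simp add: nn_integral_cmult)
  qed
  also have "(\<integral>\<^sup>+u. \<integral>\<^sup>+X. ennreal (1 / l * ((Z u X)\<^sup>2 * (?F u X))) \<partial>N \<partial>lborel) \<le> ennreal (1 / l * (J * m))"
  proof -
    have "(\<integral>\<^sup>+X. ennreal (1 / l * ((Z u X)\<^sup>2 * (?F u X))) \<partial>N) \<le> ennreal (1 / l * (?R2 u))" for u
    proof (cases "\<bar>u\<bar> \<le> 1")
      case True
      let ?r = "- (2 * (real q + 2) * u) / (1 - u\<^sup>2)"
      have "(\<integral>\<^sup>+X. ennreal (1 / l * ((Z u X)\<^sup>2 * (?F u X))) \<partial>N) = (\<integral>\<^sup>+X. ennreal (1 / l) * ennreal ((Z u X)\<^sup>2 * (?F u X)) \<partial>N)"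
        using l PB0 by (intro nn_integral_cong) (simp add: ennreal_mult[symmetric])
      also have "\<dots> = ennreal (1 / l) * (ennreal (B u) * (\<integral>\<^sup>+X. ennreal ((Z u X)\<^sup>2) \<partial>sample_law n (p u)))"
        by (subst nn_integral_cmult, (simp add: P_def p_def Z_def; measurable))
           (subst law[of "\<lambda>X. (Z u X)\<^sup>2"], (simp add: p_def Z_def; measurable), simp_all)
      also have "(\<integral>\<^sup>+X. ennreal ((Z u X)\<^sup>2) \<partial>sample_law n (p u)) \<le> ennreal (real n * V + ?r\<^sup>2)"
        unfolding Z_def
      proof (rule sample_sum_second_moment[where C=1 and y="\<lambda>x. b x / p u x"])
        show "prob_density (p u)" by (rule pd[OF True])
        show "(\<lambda>x. b x / p u x) \<in> borel_measurable borel" unfolding p_def by measurable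
        show "\<bar>b x / p u x\<bar> \<le> 1" for x
          using pos[OF True, of x] by (auto simp: abs_divide divide_le_eq_1)
        have "p u x * (b x / p u x) = b x" for x using pos[OF True, of x] by auto
        then show "(LINT x|lborel. p u x * (b x / p u x)) = 0" using b_mean by simp
        have "p u x * (b x / p u x)\<^sup>2 = (b x)\<^sup>2 / p u x" for x using pos[OF True, of x] by (auto simp: power2_eq_square)
        then show "(LINT x|lborel. p u x * (b x / p u x)\<^sup>2) \<le> V" using info[OF True] by (simp add: p_def)
      qed
      also have "ennreal (1 / l) * (ennreal (B u) * ennreal (real n * V + ?r\<^sup>2)) = ennreal (1 / l * (B u * (real n * V + ?r\<^sup>2)))"
      proof -
        have mult: "ennreal x * (ennreal y * ennreal z) = ennreal (x * (y * z))" if "x \<ge> 0" "y \<ge> 0" "z \<ge> 0" for x y z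
          using that by (simp add: ennreal_mult)
        show ?thesis unfolding mult.assoc using l B0[of u] V by (intro mult) auto
      qed
      also have "B u * (real n * V + ?r\<^sup>2) \<le> real n * V * B u + (2 * (real q + 2))\<^sup>2 * (u\<^sup>2 * bump q u)"
      proof -
        have "B u * ?r\<^sup>2 \<le> (2 * (real q + 2))\<^sup>2 * (u\<^sup>2 * bump q u)"
        proof (cases "u\<^sup>2 = 1")
          case True then show ?thesis by (simp add: bump_nonneg)
        next
          case False
          then have "B u * ?r\<^sup>2 = (2 * (real q + 2))\<^sup>2 * (u\<^sup>2 * bump q u)"
          proof -
            define d where "d = 1 - u\<^sup>2"
            have d: "d \<noteq> 0" using False by (simp add: d_def)
            have "B u = bump q u * d\<^sup>2" by (simp add: B_def bump_def d_def power2_eq_square)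
            moreover have "?r\<^sup>2 = (2 * (real q + 2))\<^sup>2 * u\<^sup>2 / d\<^sup>2" by (simp add: d_def power_divide power_mult_distrib)
            ultimately show ?thesis using d by simp
          qed
          then show ?thesis by simp
        qed
        then show ?thesis by (simp add: algebra_simps)
      qed
      finally show ?thesis using l by (simp add: ennreal_leI mult_left_mono divide_right_mono)
    qed (simp add: Bz)
    then have "(\<integral>\<^sup>+u. \<integral>\<^sup>+X. ennreal (1 / l * ((Z u X)\<^sup>2 * (?F u X))) \<partial>N \<partial>lborel) \<le>
      (\<integral>\<^sup>+u. ennreal (1 / l * (?R2 u)) \<partial>lborel)"
      by (intro nn_integral_mono)
    also have "\<dots> = ennreal (LINT u|lborel. 1 / l * (?R2 u))"
      using l V B0 bump_nonneg[of q] unfolding B_def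
      by (intro nn_integral_eq_integral) (auto intro!: Bochner_Integration.integrable_mult_right Bochner_Integration.integrable_add bump_integrable bump_second_moment)
    also have "(LINT u|lborel. 1 / l * (?R2 u)) = 1 / l * (J * m)"
    proof -
      have "(LINT u|lborel. 1 / l * (?R2 u)) = 1 / l * ((LINT u|lborel. real n * V * B u) + (LINT u|lborel. (2 * (real q + 2))\<^sup>2 * (u\<^sup>2 * bump q u)))"
        unfolding integral_mult_right_zero B_def
        by (subst Bochner_Integration.integral_add) (auto intro!: Bochner_Integration.integrable_mult_right bump_integrable bump_second_moment)
      also have "\<dots> = 1 / l * (J * m)"
        unfolding prior_info_integral by (simp add: B_def J_def m_def bump_mass_def algebra_simps)
      finally show ?thesis .
    qed
    finally show ?thesis .
  qed
  finally have main: "ennreal (2 * s * m) \<le> ennreal (l * m) * ?R + ennreal (1 / l * (J * m))"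
    by (simp add: add_left_mono)
  have "1 / l * (J * m) = s * m" using J s by (simp add: l_def)
  moreover have "ennreal (2 * s * m) = ennreal (s * m) + ennreal (s * m)"
    using s m by (subst ennreal_plus[symmetric]) auto
  ultimately have main: "ennreal (s * m) + ennreal (s * m) \<le> ennreal (l * m) * ?R + ennreal (s * m)"
    using main by simp
  then have "ennreal (s * m) \<le> ennreal (l * m) * ?R"
    by (simp add: ennreal_add_left_cancel_le add.commute)
  then have "ennreal (1 / (l * m)) * ennreal (s * m) \<le> ennreal (1 / (l * m)) * (ennreal (l * m) * ?R)"
    by (intro mult_left_mono) auto
  also have "\<dots> = ?R" using l m by (simp add: mult.assoc[symmetric] ennreal_mult[symmetric])
  also have "ennreal (1 / (l * m)) * ennreal (s * m) = ennreal (s\<^sup>2 / J)"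
    using l m s J by (simp add: ennreal_mult[symmetric] l_def power2_eq_square)
  finally show ?thesis unfolding J_def B_def m_def p_def .
qed simp

section \<open>Product priors and concentration of the energy\<close>

definition bump_prior :: "nat \<Rightarrow> real measure" where
  "bump_prior p = density lborel (\<lambda>u. ennreal (bump p u / bump_mass p))"

lemma bump_prior_density_measurable: "(\<lambda>u. ennreal (bump p u / bump_mass p)) \<in> borel_measurable borel"
  by measurable

lemma sets_bump_prior [measurable_cong, simp]: "sets (bump_prior p) = sets borel"
  by (simp add: bump_prior_def)

lemma space_bump_prior [simp]: "space (bump_prior p) = UNIV"
  by (simp add: bump_prior_def)

lemma prob_space_bump_prior: "prob_space (bump_prior p)"
proof
  have "emeasure (bump_prior p) (space (bump_prior p)) = (\<integral>\<^sup>+u. ennreal (bump p u / bump_mass p) \<partial>lborel)"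
    unfolding bump_prior_def by (subst emeasure_density) auto
  also have "\<dots> = ennreal (LINT u|lborel. bump p u / bump_mass p)"
    using bump_mass_pos[of p]
    by (intro nn_integral_eq_integral) (auto intro!: Bochner_Integration.integrable_divide bump_integrable divide_nonneg_pos bump_nonneg)
  also have "\<dots> = 1"
    using bump_mass_pos[of p] by (simp add: bump_mass_def[symmetric])
  finally show "emeasure (bump_prior p) (space (bump_prior p)) = 1" .
qed

lemma AE_bump_prior: "AE u in bump_prior p. \<bar>u\<bar> \<le> 1"
  unfolding bump_prior_def by (subst AE_density) (auto simp: bump_def indicator_def)

lemma bump_prior_second_moment: "(LINT u|bump_prior p. u\<^sup>2) = 1 / real (2 * p + 3)"
proof -
  have "(LINT u|bump_prior p. u\<^sup>2) = (LINT u|lborel. (1 / bump_mass p) * (u\<^sup>2 * bump p u))"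
    unfolding bump_prior_def using bump_mass_pos[of p]
    by (subst integral_density) (auto intro!: divide_nonneg_pos bump_nonneg simp: mult_ac)
  also have "\<dots> = 1 / real (2 * p + 3)"
    unfolding integral_mult_right_zero bump_second_moment using bump_mass_pos[of p] by simp
  finally show ?thesis .
qed

lemma AE_PiM_bump_prior:
  assumes "finite K"
  shows "AE u in PiM K (\<lambda>_. bump_prior p). \<forall>k\<in>K. \<bar>u k\<bar> \<le> 1"
  using assms AE_bump_prior
  by (intro eventually_ball_finite ballI) (auto intro!: AE_PiM_component prob_space_bump_prior)

text \<open>The summands are independent and lie in \<open>[0, w k]\<close>, so this is Hoeffding's inequality; the mean of
each \<open>(u k)\<^sup>2\<close> is the second moment of the prior.\<close>

lemma energy_concentration:
  fixes w :: "nat \<Rightarrow> real"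
  assumes K: "finite K" and w: "\<And>k. k \<in> K \<Longrightarrow> w k \<ge> 0" and t: "t \<ge> 0" and pos: "(\<Sum>k\<in>K. (w k)\<^sup>2) > 0"
  shows "measure (PiM K (\<lambda>_. bump_prior p)) {u \<in> space (PiM K (\<lambda>_. bump_prior p)). (\<Sum>k\<in>K. w k * (u k)\<^sup>2) \<ge> (\<Sum>k\<in>K. w k) / real (2 * p + 3) + t}
     \<le> exp (- 2 * t\<^sup>2 / (\<Sum>k\<in>K. (w k)\<^sup>2))"
proof -
  define M where "M = PiM K (\<lambda>_. bump_prior p)"
  interpret B: prob_space "bump_prior p" by (rule prob_space_bump_prior)
  interpret prob_space M unfolding M_def by (intro prob_space_PiM prob_space_bump_prior)
  have Kne: "K \<noteq> {}" using pos by auto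
  have comp [measurable]: "(\<lambda>u. u k) \<in> measurable M borel" if "k \<in> K" for k
    using that unfolding M_def by measurable
  have distr: "distr M borel (\<lambda>u. u k) = bump_prior p" if k: "k \<in> K" for k
  proof -
    have "distr M (bump_prior p) (\<lambda>u. u k) = bump_prior p"
      unfolding M_def by (rule distr_PiM_component[OF prob_space_bump_prior k])
    moreover have "distr M (bump_prior p) (\<lambda>u. u k) = distr M borel (\<lambda>u. u k)" by (rule distr_cong) auto
    ultimately show ?thesis by simp
  qed
  have indep0: "indep_vars (\<lambda>_. borel) (\<lambda>k u. u k) K"
  proof (subst indep_vars_iff_distr_eq_PiM'[OF Kne])
    show "random_variable borel (\<lambda>u. u k)" if "k \<in> K" for k using comp[OF that] .
    have "distr M (PiM K (\<lambda>_. borel)) (\<lambda>x. \<lambda>k\<in>K. x k) = distr M M (\<lambda>x. x)"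
      unfolding M_def by (intro distr_cong sets_PiM_cong) (auto simp: space_PiM PiE_def extensional_restrict)
    also have "\<dots> = M" by simp
    also have "M = PiM K (\<lambda>k. distr M borel (\<lambda>u. u k))"
      unfolding M_def by (intro PiM_cong refl) (use distr in \<open>auto simp: M_def\<close>)
    finally show "distr M (PiM K (\<lambda>_. borel)) (\<lambda>x. \<lambda>k\<in>K. x k) = PiM K (\<lambda>k. distr M borel (\<lambda>u. u k))" .
  qed
  have indep: "indep_vars (\<lambda>_. borel) (\<lambda>k u. w k * (u k)\<^sup>2) K"
    by (rule indep_vars_compose2[OF indep0]) auto
  have E: "expectation (\<lambda>u. w k * (u k)\<^sup>2) = w k / real (2 * p + 3)" if k: "k \<in> K" for k
  proof -
    have "expectation (\<lambda>u. (u k)\<^sup>2) = (LINT y|distr M borel (\<lambda>u. u k). y\<^sup>2)"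
      using k by (subst integral_distr) auto
    then show ?thesis by (simp add: distr[OF k] bump_prior_second_moment)
  qed
  interpret H: Hoeffding_ineq M K "\<lambda>k u. w k * (u k)\<^sup>2" "\<lambda>_. 0" w "\<Sum>k\<in>K. expectation (\<lambda>u. w k * (u k)\<^sup>2)"
  proof unfold_locales
    fix k assume k: "k \<in> K"
    have "AE u in M. \<bar>u k\<bar> \<le> 1"
      unfolding M_def by (rule eventually_mono[OF AE_PiM_bump_prior[OF K, of p]]) (use k in auto)
    then show "AE u in M. w k * (u k)\<^sup>2 \<in> {0..w k}"
      by eventually_elim (use w[OF k] in \<open>auto simp: abs_square_le_1 mult_left_le\<close>)
  qed (use K indep in auto)
  have "(\<Sum>k\<in>K. expectation (\<lambda>u. w k * (u k)\<^sup>2)) = (\<Sum>k\<in>K. w k) / real (2 * p + 3)"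
    unfolding sum_divide_distrib by (intro sum.cong refl E)
  with H.Hoeffding_ineq_ge[OF t] pos show ?thesis by (simp add: M_def)
qed

section \<open>From Bayes risk to minimax risk\<close>

lemma L2_mult_integrable:
  fixes f g :: "real \<Rightarrow> real"
  assumes [measurable]: "f \<in> borel_measurable borel" "g \<in> borel_measurable borel"
    and f: "integrable lborel (\<lambda>x. (f x)\<^sup>2)" and g: "integrable lborel (\<lambda>x. (g x)\<^sup>2)"
  shows "integrable lborel (\<lambda>x. f x * g x)"
proof (rule Bochner_Integration.integrable_bound[OF Bochner_Integration.integrable_add[OF f g]])
  show "AE x in lborel. norm (f x * g x) \<le> norm ((f x)\<^sup>2 + (g x)\<^sup>2)"
  proof (rule AE_I2)
    fix x
    have "2 * (\<bar>f x\<bar> * \<bar>g x\<bar>) \<le> (f x)\<^sup>2 + (g x)\<^sup>2" using sum_squares_bound[of "\<bar>f x\<bar>" "\<bar>g x\<bar>"] by simp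
    moreover have "0 \<le> \<bar>f x\<bar> * \<bar>g x\<bar>" by simp
    ultimately have "\<bar>f x\<bar> * \<bar>g x\<bar> \<le> (f x)\<^sup>2 + (g x)\<^sup>2" by linarith
    then show "norm (f x * g x) \<le> norm ((f x)\<^sup>2 + (g x)\<^sup>2)" by (simp add: abs_mult)
  qed
qed simp

definition orthonormal_on_line :: "nat set \<Rightarrow> (nat \<Rightarrow> real \<Rightarrow> real) \<Rightarrow> bool" where
  "orthonormal_on_line K e \<longleftrightarrow> (\<forall>k\<in>K. e k \<in> borel_measurable borel \<and> integrable lborel (\<lambda>x. (e k x)\<^sup>2)) \<and>
     (\<forall>k\<in>K. \<forall>l\<in>K. (LINT x|lborel. e k x * e l x) = (if k = l then 1 else 0))"

lemma orthonormal_on_lineD: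
  assumes "orthonormal_on_line K e" "k \<in> K"
  shows "e k \<in> borel_measurable borel" "integrable lborel (\<lambda>x. (e k x)\<^sup>2)"
    "l \<in> K \<Longrightarrow> integrable lborel (\<lambda>x. e k x * e l x)"
    "l \<in> K \<Longrightarrow> (LINT x|lborel. e k x * e l x) = (if k = l then 1 else 0)"
  using assms by (auto simp: orthonormal_on_line_def intro!: L2_mult_integrable)

lemma orthonormal_sum_square:
  assumes on: "orthonormal_on_line K e" and K: "finite K"
  shows "integrable lborel (\<lambda>x. (\<Sum>k\<in>K. c k * e k x)\<^sup>2)"
    "(LINT x|lborel. (\<Sum>k\<in>K. c k * e k x)\<^sup>2) = (\<Sum>k\<in>K. (c k)\<^sup>2)"
proof -
  have eq: "(\<Sum>k\<in>K. c k * e k x)\<^sup>2 = (\<Sum>k\<in>K. \<Sum>l\<in>K. c k * c l * (e k x * e l x))" for x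
    by (simp add: power2_eq_square sum_product mult_ac)
  have i: "integrable lborel (\<lambda>x. c k * c l * (e k x * e l x))" if "k \<in> K" "l \<in> K" for k l
    by (intro L1_intros orthonormal_on_lineD(3)[OF on] that)
  show "integrable lborel (\<lambda>x. (\<Sum>k\<in>K. c k * e k x)\<^sup>2)"
    unfolding eq by (intro L1_intros i)
  have "(LINT x|lborel. (\<Sum>k\<in>K. c k * e k x)\<^sup>2) = (\<Sum>k\<in>K. LINT x|lborel. (\<Sum>l\<in>K. c k * c l * (e k x * e l x)))"
    unfolding eq by (rule Bochner_Integration.integral_sum) (intro L1_intros i)
  also have "\<dots> = (\<Sum>k\<in>K. \<Sum>l\<in>K. LINT x|lborel. c k * c l * (e k x * e l x))"
    by (intro sum.cong refl Bochner_Integration.integral_sum i)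
  also have "\<dots> = (\<Sum>k\<in>K. \<Sum>l\<in>K. if k = l then (c k)\<^sup>2 else 0)"
    by (intro sum.cong refl) (simp add: orthonormal_on_lineD(4)[OF on] power2_eq_square)
  also have "\<dots> = (\<Sum>k\<in>K. (c k)\<^sup>2)" using K by simp
  finally show "(LINT x|lborel. (\<Sum>k\<in>K. c k * e k x)\<^sup>2) = (\<Sum>k\<in>K. (c k)\<^sup>2)" .
qed

lemma bessel_inequality:
  assumes on: "orthonormal_on_line K e" and K: "finite K"
    and [measurable]: "h \<in> borel_measurable borel" and h: "integrable lborel (\<lambda>x. (h x)\<^sup>2)"
  shows "(\<Sum>k\<in>K. (LINT x|lborel. h x * e k x)\<^sup>2) \<le> (LINT x|lborel. (h x)\<^sup>2)"
proof -
  define c where "c = (\<lambda>k. LINT x|lborel. h x * e k x)"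
  have he: "integrable lborel (\<lambda>x. h x * e k x)" if "k \<in> K" for k
    using h orthonormal_on_lineD[OF on that] by (intro L2_mult_integrable) auto
  have i1: "integrable lborel (\<lambda>x. \<Sum>k\<in>K. 2 * c k * (h x * e k x))"
    by (intro L1_intros he)
  note i2 = orthonormal_sum_square[OF on K, of c]
  have "0 \<le> (LINT x|lborel. (h x - (\<Sum>k\<in>K. c k * e k x))\<^sup>2)" by simp
  also have "\<dots> = (LINT x|lborel. (h x)\<^sup>2 - (\<Sum>k\<in>K. 2 * c k * (h x * e k x)) + (\<Sum>k\<in>K. c k * e k x)\<^sup>2)"
    by (intro Bochner_Integration.integral_cong refl) (simp add: power2_diff sum_distrib_left sum_distrib_right mult_ac)
  also have "\<dots> = (LINT x|lborel. (h x)\<^sup>2) - (\<Sum>k\<in>K. 2 * c k * c k) + (\<Sum>k\<in>K. (c k)\<^sup>2)"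
  proof -
    have "(LINT x|lborel. (\<Sum>k\<in>K. 2 * c k * (h x * e k x))) = (\<Sum>k\<in>K. LINT x|lborel. 2 * c k * (h x * e k x))"
      by (intro Bochner_Integration.integral_sum L1_intros he)
    also have "\<dots> = (\<Sum>k\<in>K. 2 * c k * c k)" by (intro sum.cong refl) (simp add: c_def)
    finally show ?thesis
      by (simp only: Bochner_Integration.integral_add[OF Bochner_Integration.integrable_diff[OF h i1] i2(1)]
          Bochner_Integration.integral_diff[OF h i1] i2(2))
  qed
  also have "(\<Sum>k\<in>K. 2 * c k * c k) = (\<Sum>k\<in>K. (c k)\<^sup>2) + (\<Sum>k\<in>K. (c k)\<^sup>2)"
    by (simp add: sum.distrib[symmetric] power2_eq_square mult.assoc)
  finally show ?thesis unfolding c_def by simp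
qed

lemma L2_norm_sq_finite_imp_integrable:
  assumes [measurable]: "g \<in> borel_measurable borel" and "L2_norm_sq g < \<infinity>"
  shows "integrable lborel (\<lambda>x. (g x)\<^sup>2)" "L2_norm_sq g = ennreal (LINT x|lborel. (g x)\<^sup>2)"
proof -
  show i: "integrable lborel (\<lambda>x. (g x)\<^sup>2)"
    using assms(2) by (intro integrableI_bounded) (auto simp: L2_norm_sq_def)
  show "L2_norm_sq g = ennreal (LINT x|lborel. (g x)\<^sup>2)"
    unfolding L2_norm_sq_def by (rule nn_integral_eq_integral[OF i]) simp
qed

text \<open>The coordinates \<open>t X k\<close> of the estimator in the orthonormal system \<open>e\<close> are compared with the coordinates
\<open>g u k\<close> of the perturbed density. Replacing the vector \<open>t X\<close> by 0 when its squared norm exceeds \<open>4 * D2\<close> does not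
increase the loss, because the target has squared norm at most \<open>D2\<close>; afterwards the loss never exceeds
\<open>9 * D2\<close>. Thus the parameters outside \<open>G\<close>, whose densities may leave the class \<open>S\<close>, can be included in
the prior at a cost of \<open>9 * D2\<close> times their probability. The total loss over the full
product prior is a sum over the coordinates, and freezing all parameters but one reduces each summand
to the van Trees inequality.\<close>

lemma bayes_risk_lower_bound:
  fixes K :: "nat set" and b e :: "nat \<Rightarrow> real \<Rightarrow> real" and f0 :: "real \<Rightarrow> real"
  assumes K: "finite K"
    and f0: "prob_density f0"
    and b [measurable]: "\<And>k. k \<in> K \<Longrightarrow> b k \<in> borel_measurable borel"
    and b_sq: "\<And>k. k \<in> K \<Longrightarrow> integrable lborel (\<lambda>x. (b k x)\<^sup>2)"
    and b_mean: "\<And>k. k \<in> K \<Longrightarrow> (LINT x|lborel. b k x) = 0"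
    and b_small: "\<And>x. (\<Sum>k\<in>K. \<bar>b k x\<bar>) \<le> \<epsilon> * f0 x" and \<epsilon>: "0 \<le> \<epsilon>" "\<epsilon> \<le> 1/4"
    and b_info: "\<And>k. k \<in> K \<Longrightarrow> (LINT x|lborel. (b k x)\<^sup>2 / f0 x) \<le> v k" and v: "\<And>k. k \<in> K \<Longrightarrow> v k \<ge> 0"
    and e: "orthonormal_on_line K e"
    and slope: "\<And>k. k \<in> K \<Longrightarrow> 0 \<le> s k \<and> s k \<le> (LINT x|lborel. b k x * e k x)"
    and size: "\<And>u. (\<And>k. k \<in> K \<Longrightarrow> \<bar>u k\<bar> \<le> 1) \<Longrightarrow> (\<Sum>k\<in>K. (\<Sum>l\<in>K. u l * (LINT x|lborel. b l x * e k x))\<^sup>2) \<le> D2"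
    and G [measurable]: "G \<in> sets (PiM K (\<lambda>_. borel))"
    and good: "\<And>u. u \<in> G \<Longrightarrow> (\<And>k. k \<in> K \<Longrightarrow> \<bar>u k\<bar> \<le> 1) \<Longrightarrow> (\<lambda>x. f0 x + (\<Sum>k\<in>K. u k * b k x)) \<in> S"
    and T: "T \<in> estimators n"
  shows "ennreal (\<Sum>k\<in>K. (s k)\<^sup>2 / (real n * (v k / (1 - \<epsilon>)) + prior_info q)) \<le>
    (SUP f\<in>S. risk n T f) + ennreal (9 * D2) * emeasure (PiM K (\<lambda>_. bump_prior (q + 2))) (space (PiM K (\<lambda>_. bump_prior (q + 2))) - G)"
proof -
  define \<mu> where "\<mu> = PiM K (\<lambda>_. bump_prior (q + 2))"
  define N where "N = PiM {1..n} (\<lambda>_. lborel::real measure)"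
  define F where "F = (\<lambda>u x. f0 x + (\<Sum>k\<in>K. u k * b k x))"
  define cube where "cube = (\<lambda>u::nat \<Rightarrow> real. \<forall>k\<in>K. \<bar>u k\<bar> \<le> 1)"
  let ?bound = "\<lambda>k. ((s k)\<^sup>2 / (real n * (v k / (1 - \<epsilon>)) + prior_info q))"
  define ip where "ip = (\<lambda>l k. LINT x|lborel. b l x * e k x)"
  define g where "g = (\<lambda>u k. \<Sum>l\<in>K. u l * ip l k)"
  define t where "t = (\<lambda>X k. LINT x|lborel. (T X x - f0 x) * e k x)"
  define t' where "t' = (\<lambda>X k. if (\<Sum>j\<in>K. (t X j)\<^sup>2) \<le> 4 * D2 then t X k else 0)"
  \<comment> \<open>The risk of one coordinate, written with the density of the sample so that it is visibly measurable in \<open>u\<close>.\<close>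
  define H where "H = (\<lambda>k u. \<integral>\<^sup>+X. (\<Prod>i\<in>{1..n}. ennreal (F u (X i))) * ennreal ((t' X k - g u k)\<^sup>2) \<partial>N)"
  have [measurable]: "f0 \<in> borel_measurable borel" and f0_nonneg: "\<And>x. f0 x \<ge> 0" and f0_int: "integrable lborel f0"
    and f0_1: "(LINT x|lborel. f0 x) = 1" using f0 by (auto simp: prob_density_def)
  have [measurable]: "e k \<in> borel_measurable borel" if "k \<in> K" for k using orthonormal_on_lineD(1)[OF e that] .
  have T' [measurable]: "(\<lambda>(X, x). T X x) \<in> borel_measurable ((\<Pi>\<^sub>M i\<in>{1..n}. borel) \<Otimes>\<^sub>M borel)"
    using T by (simp add: estimators_def)
  interpret \<mu>: prob_space \<mu> unfolding \<mu>_def by (intro prob_space_PiM prob_space_bump_prior)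
  interpret L: product_sigma_finite "\<lambda>_::nat. lborel::real measure"
    by (intro product_sigma_finite.intro sigma_finite_lborel)
  interpret N: sigma_finite_measure N unfolding N_def by (rule L.sigma_finite) simp
  interpret BP: prob_space "bump_prior (q + 2)" by (rule prob_space_bump_prior)
  interpret B: product_sigma_finite "\<lambda>_::nat. bump_prior (q + 2)"
    by (intro product_sigma_finite.intro BP.sigma_finite_measure_axioms)
  have sN [measurable_cong]: "sets N = sets (PiM {1..n} (\<lambda>_. borel))"
    unfolding N_def by (intro sets_PiM_cong) auto
  have s\<mu> [measurable_cong]: "sets \<mu> = sets (PiM K (\<lambda>_. borel))"
    unfolding \<mu>_def by (intro sets_PiM_cong) auto
  have sp\<mu>: "space \<mu> = space (PiM K (\<lambda>_. borel))" by (rule sets_eq_imp_space_eq[OF s\<mu>])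
  have t_m [measurable]: "(\<lambda>X. t X k) \<in> borel_measurable (PiM {1..n} (\<lambda>_. borel))" if "k \<in> K" for k
    using that unfolding t_def by measurable
  have t'_m [measurable]: "(\<lambda>X. t' X k) \<in> borel_measurable (PiM {1..n} (\<lambda>_. borel))" if "k \<in> K" for k
    using that K unfolding t'_def by measurable
  have uk [measurable]: "(\<lambda>u. u k) \<in> borel_measurable (PiM K (\<lambda>_. borel))" if "k \<in> K" for k
    using that by measurable
  have F_m [measurable]: "(\<lambda>(u, x). F u x) \<in> borel_measurable (PiM K (\<lambda>_. borel) \<Otimes>\<^sub>M borel)"
    unfolding F_def split_beta by measurable
  have F1_m [measurable]: "F u \<in> borel_measurable borel" for u
    unfolding F_def by measurable
  have g_m [measurable]: "(\<lambda>u. g u k) \<in> borel_measurable (PiM K (\<lambda>_. borel))" for k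
    unfolding g_def by measurable
  have XF_m [measurable]: "(\<lambda>z. F (fst z) (snd z i)) \<in> borel_measurable (PiM K (\<lambda>_. borel) \<Otimes>\<^sub>M N)" if "i \<in> {1..n}" for i
  proof -
    have "(\<lambda>z. (fst z, snd z i)) \<in> measurable (PiM K (\<lambda>_. borel) \<Otimes>\<^sub>M N) (PiM K (\<lambda>_. borel) \<Otimes>\<^sub>M borel)"
      using that by measurable
    from measurable_compose[OF this F_m] show ?thesis by simp
  qed
  have H_m [measurable]: "H k \<in> borel_measurable (PiM K (\<lambda>_. borel))" if "k \<in> K" for k
    using that unfolding H_def split_beta by measurable
  have bk_le: "\<bar>b k x\<bar> \<le> \<epsilon> * f0 x" if "k \<in> K" for k x
    using member_le_sum[OF that, of "\<lambda>k. \<bar>b k x\<bar>"] K b_small[of x] by auto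
  have b_int: "integrable lborel (b k)" if "k \<in> K" for k
    by (rule Bochner_Integration.integrable_bound[OF Bochner_Integration.integrable_mult_right[OF f0_int, of \<epsilon>]])
       (use that bk_le[OF that] f0_nonneg \<epsilon> in \<open>auto intro!: AE_I2\<close>)
  have part_le: "\<bar>\<Sum>k\<in>J. u k * b k x\<bar> \<le> \<epsilon> * f0 x" if "cube u" "J \<subseteq> K" for u J x
  proof -
    have "\<bar>\<Sum>k\<in>J. u k * b k x\<bar> \<le> (\<Sum>k\<in>J. \<bar>u k * b k x\<bar>)" by (rule sum_abs)
    also have "\<dots> \<le> (\<Sum>k\<in>J. \<bar>b k x\<bar>)"
      using that by (intro sum_mono) (auto simp: cube_def abs_mult mult_left_le_one_le)
    also have "\<dots> \<le> (\<Sum>k\<in>K. \<bar>b k x\<bar>)" using that K by (intro sum_mono2) auto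
    finally show ?thesis using b_small[of x] by simp
  qed
  have part_density: "prob_density (\<lambda>x. f0 x + (\<Sum>k\<in>J. u k * b k x))" if "cube u" "J \<subseteq> K" for u J
  proof -
    have int: "integrable lborel (\<lambda>x. \<Sum>k\<in>J. u k * b k x)"
      using that b_int by (intro L1_intros) auto
    have "(LINT x|lborel. (\<Sum>k\<in>J. u k * b k x)) = (\<Sum>k\<in>J. LINT x|lborel. u k * b k x)"
      using that b_int by (intro Bochner_Integration.integral_sum L1_intros) auto
    also have "\<dots> = 0" using that b_mean by (intro sum.neutral) auto
    finally have "(LINT x|lborel. f0 x + (\<Sum>k\<in>J. u k * b k x)) = 1"
      using int f0_int f0_1 by simp
    moreover have "0 \<le> f0 x + (\<Sum>k\<in>J. u k * b k x)" for x
    proof -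
      have "\<epsilon> * f0 x \<le> 1 * f0 x" using \<epsilon> f0_nonneg[of x] by (intro mult_right_mono) auto
      with part_le[OF that, of x] show ?thesis by linarith
    qed
    moreover have "(\<lambda>x. f0 x + (\<Sum>k\<in>J. u k * b k x)) \<in> borel_measurable borel" using that by (intro borel_measurable_add borel_measurable_sum borel_measurable_times borel_measurable_const b) auto
    ultimately show ?thesis unfolding prob_density_def using int f0_int by auto
  qed
  have F_density: "prob_density (F u)" if "cube u" for u
    unfolding F_def by (rule part_density[OF that]) simp
  have H_eq: "H k u = (\<integral>\<^sup>+X. ennreal ((t' X k - g u k)\<^sup>2) \<partial>sample_law n (F u))" if "cube u" "k \<in> K" for k u
  proof -
    have "(\<lambda>X. ennreal ((t' X k - g u k)\<^sup>2)) \<in> borel_measurable (PiM {1..n} (\<lambda>_. borel))"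
      using t'_m[OF that(2)] by measurable
    from nn_integral_sample_law[OF F_density[OF that(1)] this] show ?thesis unfolding H_def N_def by simp
  qed
  have D20: "D2 \<ge> 0"
    using size[of "\<lambda>_. 0"] by simp
  have g_le: "(\<Sum>k\<in>K. (g u k)\<^sup>2) \<le> D2" if "cube u" for u
    unfolding g_def ip_def using that by (intro size) (auto simp: cube_def)
  have t'_le: "(\<Sum>k\<in>K. (t' X k)\<^sup>2) \<le> 4 * D2" for X
    unfolding t'_def using D20 by (cases "(\<Sum>j\<in>K. (t X j)\<^sup>2) \<le> 4 * D2") simp_all
  have diff_le: "(\<Sum>k\<in>K. (t' X k - g u k)\<^sup>2) \<le> 9 * D2" if "cube u" for X u
  proof -
    have "(x - y)\<^sup>2 \<le> 3 / 2 * x\<^sup>2 + 3 * y\<^sup>2" for x y :: real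
    proof -
      have "0 \<le> (x + 2 * y)\<^sup>2" by simp
      then show ?thesis by (simp add: power2_eq_square algebra_simps)
    qed
    then have "(\<Sum>k\<in>K. (t' X k - g u k)\<^sup>2) \<le> (\<Sum>k\<in>K. 3 / 2 * (t' X k)\<^sup>2 + 3 * (g u k)\<^sup>2)" by (intro sum_mono)
    also have "\<dots> = 3 / 2 * (\<Sum>k\<in>K. (t' X k)\<^sup>2) + 3 * (\<Sum>k\<in>K. (g u k)\<^sup>2)" by (simp add: sum.distrib sum_distrib_left)
    also have "\<dots> \<le> 9 * D2" using t'_le[of X] g_le[OF that] by simp
    finally show ?thesis .
  qed
  have clip: "(\<Sum>k\<in>K. (t' X k - g u k)\<^sup>2) \<le> (\<Sum>k\<in>K. (t X k - g u k)\<^sup>2)" if "cube u" for X u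
  proof (cases "(\<Sum>j\<in>K. (t X j)\<^sup>2) \<le> 4 * D2")
    case True then show ?thesis by (simp add: t'_def)
  next
    case False
    \<comment> \<open>If \<open>t X\<close> is large, its distance to the target already exceeds the norm of the target, which is the
distance of 0 to it.\<close>
    have "x\<^sup>2 / 2 \<le> (x - y)\<^sup>2 + y\<^sup>2" for x y :: real
    proof -
      have "0 \<le> (x - 2 * y)\<^sup>2" by simp
      then show ?thesis by (simp add: power2_eq_square algebra_simps)
    qed
    then have "(\<Sum>k\<in>K. (t X k)\<^sup>2 / 2) \<le> (\<Sum>k\<in>K. (t X k - g u k)\<^sup>2 + (g u k)\<^sup>2)" by (intro sum_mono)
    then have "(\<Sum>k\<in>K. (t X k)\<^sup>2) / 2 \<le> (\<Sum>k\<in>K. (t X k - g u k)\<^sup>2) + (\<Sum>k\<in>K. (g u k)\<^sup>2)"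
      by (simp add: sum.distrib sum_divide_distrib)
    with False g_le[OF that] show ?thesis by (simp add: t'_def)
  qed
  have bessel: "ennreal (\<Sum>k\<in>K. (t X k - g u k)\<^sup>2) \<le> L2_norm_sq (\<lambda>x. T X x - F u x)"
    if u: "cube u" and X: "X \<in> space (PiM {1..n} (\<lambda>_. borel :: real measure))" for u X
  proof (cases "L2_norm_sq (\<lambda>x. T X x - F u x) < \<infinity>")
    case False
    then have "L2_norm_sq (\<lambda>x. T X x - F u x) = top" by (simp add: less_top[symmetric])
    then show ?thesis by simp
  next
    case True
    have [measurable]: "T X \<in> borel_measurable borel"
      using measurable_compose_Pair1[OF X T'] by simp
    note fin = L2_norm_sq_finite_imp_integrable[OF _ True]
    have sq: "integrable lborel (\<lambda>x. (T X x - F u x)\<^sup>2)" by (rule fin) measurable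
    have "t X k - g u k = (LINT x|lborel. (T X x - F u x) * e k x)" if k: "k \<in> K" for k
    proof -
      have i1: "integrable lborel (\<lambda>x. (T X x - F u x) * e k x)"
        using orthonormal_on_lineD[OF e k] by (intro L2_mult_integrable sq) auto
      have i2: "integrable lborel (\<lambda>x. u l * (b l x * e k x))" if "l \<in> K" for l
        using orthonormal_on_lineD[OF e k] that
        by (intro L1_intros L2_mult_integrable b_sq) auto
      have "t X k = (LINT x|lborel. (T X x - F u x) * e k x + (\<Sum>l\<in>K. u l * (b l x * e k x)))"
        unfolding t_def F_def
        by (intro Bochner_Integration.integral_cong refl) (simp add: algebra_simps sum_distrib_right sum_distrib_left)
      also have "\<dots> = (LINT x|lborel. (T X x - F u x) * e k x) + (LINT x|lborel. (\<Sum>l\<in>K. u l * (b l x * e k x)))"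
        by (intro Bochner_Integration.integral_add i1 Bochner_Integration.integrable_sum i2)
      also have "(LINT x|lborel. (\<Sum>l\<in>K. u l * (b l x * e k x))) = (\<Sum>l\<in>K. LINT x|lborel. u l * (b l x * e k x))"
        by (intro Bochner_Integration.integral_sum i2)
      also have "\<dots> = g u k" by (simp add: g_def ip_def)
      finally show ?thesis by simp
    qed
    then have "(\<Sum>k\<in>K. (t X k - g u k)\<^sup>2) = (\<Sum>k\<in>K. (LINT x|lborel. (T X x - F u x) * e k x)\<^sup>2)" by simp
    also have "\<dots> \<le> (LINT x|lborel. (T X x - F u x)\<^sup>2)"
      by (rule bessel_inequality[OF e K _ sq]) measurable
    finally show ?thesis using fin(2) by (auto intro: ennreal_leI)
  qed
  have upper: "(\<Sum>k\<in>K. H k u) \<le> (SUP f\<in>S. risk n T f) + ennreal (9 * D2) * indicator (space \<mu> - G) u"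
    if u: "cube u" "u \<in> space \<mu>" for u
  proof -
    interpret SL: prob_space "sample_law n (F u)" by (rule sample_law_prob_space[OF F_density[OF u(1)]])
    have "(\<Sum>k\<in>K. H k u) = (\<Sum>k\<in>K. \<integral>\<^sup>+X. ennreal ((t' X k - g u k)\<^sup>2) \<partial>sample_law n (F u))"
      using H_eq[OF u(1)] by simp
    also have "\<dots> = (\<integral>\<^sup>+X. (\<Sum>k\<in>K. ennreal ((t' X k - g u k)\<^sup>2)) \<partial>sample_law n (F u))"
      by (rule nn_integral_sum[symmetric]) measurable
    also have "\<dots> = (\<integral>\<^sup>+X. ennreal (\<Sum>k\<in>K. (t' X k - g u k)\<^sup>2) \<partial>sample_law n (F u))"
      by (intro nn_integral_cong sum_ennreal) simp
    finally have eq: "(\<Sum>k\<in>K. H k u) = (\<integral>\<^sup>+X. ennreal (\<Sum>k\<in>K. (t' X k - g u k)\<^sup>2) \<partial>sample_law n (F u))" .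
    show ?thesis
    proof (cases "u \<in> G")
      case True
      have "(\<Sum>k\<in>K. H k u) \<le> risk n T (F u)"
        unfolding eq risk_def
      proof (intro nn_integral_mono)
        fix X assume "X \<in> space (sample_law n (F u))"
        then have X: "X \<in> space (PiM {1..n} (\<lambda>_. borel :: real measure))"
          using sets_eq_imp_space_eq[OF sets_sample_law] by blast
        have "ennreal (\<Sum>k\<in>K. (t' X k - g u k)\<^sup>2) \<le> ennreal (\<Sum>k\<in>K. (t X k - g u k)\<^sup>2)"
          by (intro ennreal_leI clip u)
        also note bessel[OF u(1) X]
        finally show "ennreal (\<Sum>k\<in>K. (t' X k - g u k)\<^sup>2) \<le> L2_norm_sq (\<lambda>x. T X x - F u x)" .
      qed
      also have "\<dots> \<le> (SUP f\<in>S. risk n T f)"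
        using good[OF True] u(1) by (intro SUP_upper) (auto simp: F_def cube_def)
      finally show ?thesis by (simp add: add_increasing2)
    next
      case False
      have "(\<Sum>k\<in>K. H k u) \<le> (\<integral>\<^sup>+X. ennreal (9 * D2) \<partial>sample_law n (F u))"
        unfolding eq by (intro nn_integral_mono ennreal_leI diff_le u)
      also have "\<dots> = ennreal (9 * D2)" by (simp add: SL.emeasure_space_1)
      finally show ?thesis using False u by (simp add: add_increasing)
    qed
  qed
  have cubeAE: "AE u in \<mu>. cube u"
    unfolding \<mu>_def cube_def by (rule AE_PiM_bump_prior[OF K])
  have lower: "ennreal (?bound k) \<le> (\<integral>\<^sup>+u. H k u \<partial>\<mu>)" if k: "k \<in> K" for k
  proof -
    \<comment> \<open>For fixed values of the other parameters the densities depend linearly on the \<open>k\<close>-th one.\<close>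
    define K' where "K' = K - {k}"
    have K': "finite K'" "k \<notin> K'" "insert k K' = K" "K' \<subseteq> K" using K k by (auto simp: K'_def)
    define \<mu>' where "\<mu>' = PiM K' (\<lambda>_. bump_prior (q + 2))"
    interpret \<mu>': prob_space \<mu>' unfolding \<mu>'_def by (intro prob_space_PiM prob_space_bump_prior)
    have Hm: "H k \<in> borel_measurable (PiM (insert k K') (\<lambda>_. bump_prior (q + 2)))"
      using H_m[OF k] unfolding K'(3) \<mu>_def[symmetric] by (simp add: measurable_cong_sets[OF s\<mu> refl])
    have "AE x in \<mu>'. ennreal (?bound k) \<le> (\<integral>\<^sup>+y. H k (x(k := y)) \<partial>bump_prior (q + 2))"
      using AE_PiM_bump_prior[OF K'(1), of "q + 2"] unfolding \<mu>'_def[symmetric]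
    proof eventually_elim
      fix x :: "nat \<Rightarrow> real" assume x: "\<forall>j\<in>K'. \<bar>x j\<bar> \<le> 1"
      define x0 where "x0 = x(k := 0)"
      have c0: "cube x0" using x by (auto simp: cube_def x0_def K'_def)
      have c: "cube (x(k := y))" if "\<bar>y\<bar> \<le> 1" for y using x that by (auto simp: cube_def K'_def)
      define a where "a = (\<lambda>z. f0 z + (\<Sum>j\<in>K'. x0 j * b j z))"
      have Fa: "F (x(k := y)) z = a z + y * b k z" for y z
      proof -
        have "(\<Sum>j\<in>K. (x(k := y)) j * b j z) = y * b k z + (\<Sum>j\<in>K'. (x(k := y)) j * b j z)"
          unfolding K'(3)[symmetric] using K'(1,2) by simp
        also have "(\<Sum>j\<in>K'. (x(k := y)) j * b j z) = (\<Sum>j\<in>K'. x0 j * b j z)"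
          using K'(2) by (intro sum.cong) (auto simp: x0_def)
        finally show ?thesis by (simp add: F_def a_def)
      qed
      define g0 where "g0 = (\<Sum>l\<in>K'. x0 l * ip l k)"
      have ga: "g (x(k := y)) k = g0 + ip k k * y" for y
      proof -
        have "g (x(k := y)) k = y * ip k k + (\<Sum>l\<in>K'. (x(k := y)) l * ip l k)"
          unfolding g_def K'(3)[symmetric] using K'(1,2) by simp
        also have "(\<Sum>l\<in>K'. (x(k := y)) l * ip l k) = g0"
          unfolding g0_def using K'(2) by (intro sum.cong) (auto simp: x0_def)
        finally show ?thesis by (simp only: add.commute mult.commute)
      qed
      have ad: "prob_density a" unfolding a_def by (rule part_density[OF c0 K'(4)])
      have a_ge: "a z \<ge> (1 - \<epsilon>) * f0 z" for z
        using part_le[OF c0 K'(4), of z] unfolding a_def by (simp add: algebra_simps)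
      have ab: "2 * \<bar>b k z\<bar> \<le> a z" for z
      proof -
        have "2 * \<bar>b k z\<bar> \<le> 2 * \<epsilon> * f0 z" using bk_le[OF k, of z] by simp
        also have "\<dots> \<le> (1 - \<epsilon>) * f0 z" using \<epsilon> f0_nonneg[of z] by (intro mult_right_mono) auto
        also have "\<dots> \<le> a z" by (rule a_ge)
        finally show ?thesis .
      qed
      have info: "(LINT z|lborel. (b k z)\<^sup>2 / (a z + y * b k z)) \<le> v k / (1 - \<epsilon>)" if y: "\<bar>y\<bar> \<le> 1" for y
      proof -
        have p_ge: "a z + y * b k z \<ge> (1 - \<epsilon>) * f0 z" for z
          using part_le[OF c[OF y], of K z] Fa[of y z] unfolding F_def by (auto simp: algebra_simps)
        have pw: "(b k z)\<^sup>2 / (a z + y * b k z) \<le> 1 / (1 - \<epsilon>) * ((b k z)\<^sup>2 / f0 z)" for z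
        proof (cases "f0 z = 0")
          case True
          then have "b k z = 0" using bk_le[OF k, of z] by simp
          then show ?thesis by simp
        next
          case False
          then have "0 < (1 - \<epsilon>) * f0 z" using f0_nonneg[of z] \<epsilon> by simp
          then have "(b k z)\<^sup>2 / (a z + y * b k z) \<le> (b k z)\<^sup>2 / ((1 - \<epsilon>) * f0 z)"
            using p_ge[of z] by (intro frac_le) auto
          then show ?thesis by simp
        qed
        have frac_int: "integrable lborel (\<lambda>z. (b k z)\<^sup>2 / f0 z)"
        proof (rule Bochner_Integration.integrable_bound[OF f0_int])
          show "AE z in lborel. norm ((b k z)\<^sup>2 / f0 z) \<le> norm (f0 z)"
          proof (rule AE_I2)
            fix z
            have "\<epsilon> * f0 z \<le> 1 * f0 z" using \<epsilon> f0_nonneg[of z] by (intro mult_right_mono) auto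
            then have "\<bar>b k z\<bar> \<le> \<bar>f0 z\<bar>" using bk_le[OF k, of z] f0_nonneg[of z] by simp
            then have "(b k z)\<^sup>2 \<le> (f0 z)\<^sup>2" by (simp add: abs_le_square_iff)
            then show "norm ((b k z)\<^sup>2 / f0 z) \<le> norm (f0 z)"
              using f0_nonneg[of z] by (cases "f0 z = 0") (auto simp: divide_le_eq power2_eq_square)
          qed
        qed (use b[OF k] in \<open>intro borel_measurable_divide borel_measurable_power; simp\<close>)
        have "(LINT z|lborel. (b k z)\<^sup>2 / (a z + y * b k z)) \<le> (LINT z|lborel. 1 / (1 - \<epsilon>) * ((b k z)\<^sup>2 / f0 z))"
        proof (rule integral_mono_AE')
          show "integrable lborel (\<lambda>z. 1 / (1 - \<epsilon>) * ((b k z)\<^sup>2 / f0 z))"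
            by (intro L1_intros frac_int)
          show "AE z in lborel. (b k z)\<^sup>2 / (a z + y * b k z) \<le> 1 / (1 - \<epsilon>) * ((b k z)\<^sup>2 / f0 z)"
            using pw by (intro AE_I2)
          show "AE z in lborel. 0 \<le> 1 / (1 - \<epsilon>) * ((b k z)\<^sup>2 / f0 z)"
            using \<epsilon> f0_nonneg by (intro AE_I2) auto
        qed
        also have "\<dots> = 1 / (1 - \<epsilon>) * (LINT z|lborel. (b k z)\<^sup>2 / f0 z)" by (rule integral_mult_right_zero)
        also have "\<dots> \<le> 1 / (1 - \<epsilon>) * v k" using \<epsilon> b_info[OF k] by (intro mult_left_mono) auto
        finally show ?thesis by simp
      qed
      have "(s k)\<^sup>2 \<le> (ip k k)\<^sup>2" using slope[OF k] unfolding ip_def by (intro power_mono) auto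
      moreover have V0: "0 \<le> v k / (1 - \<epsilon>)" using v[OF k] \<epsilon> by auto
      moreover have "prior_info q > 0" unfolding prior_info_def by (intro divide_pos_pos mult_pos_pos) auto
      ultimately have "(s k)\<^sup>2 / (real n * (v k / (1 - \<epsilon>)) + prior_info q) \<le> (ip k k)\<^sup>2 / (real n * (v k / (1 - \<epsilon>)) + prior_info q)"
        by (intro divide_right_mono add_nonneg_nonneg mult_nonneg_nonneg) auto
      then have "ennreal (?bound k) \<le> ennreal ((ip k k)\<^sup>2 / (real n * (v k / (1 - \<epsilon>)) + prior_info q))"
        by (rule ennreal_leI)
      also have "\<dots> \<le> (\<integral>\<^sup>+y. ennreal (bump (q + 2) y / bump_mass (q + 2)) *
           (\<integral>\<^sup>+X. ennreal ((t' X k - (g0 + ip k k * y))\<^sup>2) \<partial>sample_law n (\<lambda>z. a z + y * b k z)) \<partial>lborel)"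
        by (rule van_trees_linear[OF ad b_int[OF k] b_mean[OF k] ab info V0 t'_m[OF k]])
           (use slope[OF k] in \<open>auto simp: ip_def\<close>)
      also have "\<dots> = (\<integral>\<^sup>+y. ennreal (bump (q + 2) y / bump_mass (q + 2)) * H k (x(k := y)) \<partial>lborel)"
      proof (intro nn_integral_cong)
        fix y :: real
        show "ennreal (bump (q + 2) y / bump_mass (q + 2)) * (\<integral>\<^sup>+X. ennreal ((t' X k - (g0 + ip k k * y))\<^sup>2) \<partial>sample_law n (\<lambda>z. a z + y * b k z)) =
           ennreal (bump (q + 2) y / bump_mass (q + 2)) * H k (x(k := y))"
        proof (cases "\<bar>y\<bar> \<le> 1")
          case True
          have "F (x(k := y)) = (\<lambda>z. a z + y * b k z)" using Fa by auto
          then show ?thesis unfolding H_eq[OF c[OF True] k] ga by simp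
        next
          case False
          then have "bump (q + 2) y = 0" by (auto simp: bump_def indicator_def)
          then show ?thesis by simp
        qed
      qed
      also have "\<dots> = (\<integral>\<^sup>+y. H k (x(k := y)) \<partial>bump_prior (q + 2))"
        unfolding bump_prior_def
      proof (rule nn_integral_density[symmetric])
        have [measurable]: "a \<in> borel_measurable borel" "b k \<in> borel_measurable borel"
            "(\<lambda>X. t' X k) \<in> borel_measurable (PiM {1..n} (\<lambda>_. borel))"
          using ad b[OF k] t'_m[OF k] by (auto simp: prob_density_def)
        show "(\<lambda>y. H k (x(k := y))) \<in> borel_measurable lborel"
          unfolding H_def Fa ga by measurable
      qed (simp add: bump_prior_density_measurable)
      finally show "ennreal (?bound k) \<le> (\<integral>\<^sup>+y. H k (x(k := y)) \<partial>bump_prior (q + 2))" .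
    qed
    then have "(\<integral>\<^sup>+x. ennreal (?bound k) \<partial>\<mu>') \<le> (\<integral>\<^sup>+x. \<integral>\<^sup>+y. H k (x(k := y)) \<partial>bump_prior (q + 2) \<partial>\<mu>')"
      by (rule nn_integral_mono_AE)
    also have "\<dots> = (\<integral>\<^sup>+u. H k u \<partial>PiM (insert k K') (\<lambda>_. bump_prior (q + 2)))"
      unfolding \<mu>'_def by (rule B.product_nn_integral_insert[OF K'(1,2) Hm, symmetric])
    finally show ?thesis unfolding K'(3) \<mu>_def by (simp add: \<mu>'.emeasure_space_1)
  qed
  have "ennreal (\<Sum>k\<in>K. (s k)\<^sup>2 / (real n * (v k / (1 - \<epsilon>)) + prior_info q)) = (\<Sum>k\<in>K. ennreal (?bound k))"
    using v \<epsilon> unfolding prior_info_def by (intro sum_ennreal[symmetric] divide_nonneg_nonneg add_nonneg_nonneg mult_nonneg_nonneg) auto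
  also have "\<dots> \<le> (\<Sum>k\<in>K. \<integral>\<^sup>+u. H k u \<partial>\<mu>)" by (intro sum_mono lower)
  also have "\<dots> = (\<integral>\<^sup>+u. (\<Sum>k\<in>K. H k u) \<partial>\<mu>)" by (rule nn_integral_sum[symmetric]) measurable
  also have "\<dots> \<le> (\<integral>\<^sup>+u. (SUP f\<in>S. risk n T f) + ennreal (9 * D2) * indicator (space \<mu> - G) u \<partial>\<mu>)"
  proof (rule nn_integral_mono_AE)
    from cubeAE AE_space
    show "AE u in \<mu>. (\<Sum>k\<in>K. H k u) \<le> (SUP f\<in>S. risk n T f) + ennreal (9 * D2) * indicator (space \<mu> - G) u"
      by eventually_elim (rule upper)
  qed
  also have "\<dots> = (SUP f\<in>S. risk n T f) + ennreal (9 * D2) * emeasure \<mu> (space \<mu> - G)"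
    by (subst nn_integral_add, simp, measurable, simp add: nn_integral_cmult_indicator \<mu>.emeasure_space_1)
  finally show ?thesis unfolding \<mu>_def .
qed

section \<open>The cosine basis of an interval\<close>

lemma cos_integral_zero:
  fixes H :: real and j :: int
  assumes H: "H > 0" and j: "j \<noteq> 0"
  shows "(LINT x|lborel. indicator {-H..H} x * cos (pi * real_of_int j / (2 * H) * (x + H))) = 0"
proof -
  define w where "w = pi * real_of_int j / (2 * H)"
  have w: "w \<noteq> 0" using H j by (simp add: w_def)
  have "(LINT x|lborel. indicator {-H..H} x * cos (w * (x + H))) = sin (w * (H + H)) / w - sin (w * (- H + H)) / w"
    by (rule FTC_Icc[where F="\<lambda>x. sin (w * (x + H)) / w"])
       (use H w in \<open>auto intro!: derivative_eq_intros continuous_intros\<close>)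
  also have "w * (H + H) = pi * real_of_int j" using H by (simp add: w_def field_simps)
  also have "sin (pi * real_of_int j) = 0" by (simp add: sin_zero_iff_int2)
  finally show ?thesis by (simp add: w_def)
qed

text \<open>The multiples of \<open>\<pi> / (2 H)\<close> belong to the Neumann eigenfunctions of \<open>[-H, H]\<close>, a single
orthogonal family that replaces the sines and cosines of the periodic problem. All of them except the
constant have mean zero.\<close>

definition freq :: "real \<Rightarrow> nat \<Rightarrow> real" where
  "freq H k = pi * real k / (2 * H)"

definition cosine_mode :: "real \<Rightarrow> nat \<Rightarrow> real \<Rightarrow> real" where
  "cosine_mode H k x = indicator {-H..H} x * (cos (freq H k * (x + H)) / sqrt H)"

lemma cosine_mode_measurable [measurable]: "cosine_mode H k \<in> borel_measurable borel"
  unfolding cosine_mode_def[abs_def] by measurable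

lemma cosine_mode_bound: "H > 0 \<Longrightarrow> \<bar>cosine_mode H k x\<bar> \<le> 1 / sqrt H"
  by (auto simp: cosine_mode_def indicator_def divide_right_mono)

lemma cosine_mode_outside: "\<bar>x\<bar> > H \<Longrightarrow> cosine_mode H k x = 0"
  by (auto simp: cosine_mode_def indicator_def)

lemma cosine_mode_mean:
  assumes "H > 0" "k \<ge> 1"
  shows "(LINT x|lborel. cosine_mode H k x) = 0"
proof -
  have "(LINT x|lborel. cosine_mode H k x) = (LINT x|lborel. (1 / sqrt H) * (indicator {-H..H} x * cos (pi * real_of_int (int k) / (2 * H) * (x + H))))"
    by (simp add: cosine_mode_def freq_def)
  also have "\<dots> = 0" unfolding integral_mult_right_zero using cos_integral_zero[of H "int k"] assms by simp
  finally show ?thesis .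
qed

lemma cosine_mode_orthonormal:
  assumes H: "H > 0" and K: "\<And>k. k \<in> K \<Longrightarrow> k \<ge> 1"
  shows "orthonormal_on_line K (cosine_mode H)"
  unfolding orthonormal_on_line_def
proof (intro conjI ballI)
  fix k
  show "cosine_mode H k \<in> borel_measurable borel" by measurable
  have "\<bar>(cosine_mode H k x)\<^sup>2\<bar> \<le> (1 / sqrt H)\<^sup>2" for x
    using power_mono[OF cosine_mode_bound[OF H, of k x], of 2] by simp
  then show "integrable lborel (\<lambda>x. (cosine_mode H k x)\<^sup>2)"
    by (intro integrable_compact_support[where R=H]) (auto simp: cosine_mode_outside)
next
  fix k l assume k: "k \<in> K" and l: "l \<in> K"
  have int: "integrable lborel (\<lambda>x. indicator {-H..H} x * cos (c * (x + H)))" for c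
    by (intro integrable_on_Icc continuous_intros)
  define I where "I = (\<lambda>j::int. LINT x|lborel. indicator {-H..H} x * cos (pi * real_of_int j / (2 * H) * (x + H)))"
  have "cosine_mode H k x * cosine_mode H l x = 1 / (2 * H) * (indicator {-H..H} x * cos (pi * real_of_int (int k - int l) / (2 * H) * (x + H)) + indicator {-H..H} x * cos (pi * real_of_int (int k + int l) / (2 * H) * (x + H)))" for x
  proof -
    have "cos (freq H k * (x + H)) * cos (freq H l * (x + H)) = (cos (freq H k * (x + H) - freq H l * (x + H)) + cos (freq H k * (x + H) + freq H l * (x + H))) / 2"
      by (rule cos_times_cos)
    also have "freq H k * (x + H) - freq H l * (x + H) = pi * real_of_int (int k - int l) / (2 * H) * (x + H)"
      by (simp add: freq_def diff_divide_distrib algebra_simps)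
    also have "freq H k * (x + H) + freq H l * (x + H) = pi * real_of_int (int k + int l) / (2 * H) * (x + H)"
      by (simp add: freq_def add_divide_distrib algebra_simps)
    finally have E: "cos (freq H k * (x + H)) * cos (freq H l * (x + H)) = (cos (pi * real_of_int (int k - int l) / (2 * H) * (x + H)) + cos (pi * real_of_int (int k + int l) / (2 * H) * (x + H))) / 2" .
    have "cosine_mode H k x * cosine_mode H l x = indicator {-H..H} x * (cos (freq H k * (x + H)) * cos (freq H l * (x + H))) / H"
      using H by (simp add: cosine_mode_def indicator_def)
    then show ?thesis unfolding E by (simp add: indicator_def)
  qed
  then have "(LINT x|lborel. cosine_mode H k x * cosine_mode H l x) = 1 / (2 * H) * (I (int k - int l) + I (int k + int l))"
    unfolding I_def by (simp only: integral_mult_right_zero) (subst Bochner_Integration.integral_add[OF int int], simp)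
  moreover have "I (int k + int l) = 0" unfolding I_def using K[OF k] by (intro cos_integral_zero[OF H]) auto
  moreover have "I (int k - int l) = (if k = l then 2 * H else 0)"
    unfolding I_def using cos_integral_zero[OF H, of "int k - int l"] H by auto
  ultimately show "(LINT x|lborel. cosine_mode H k x * cosine_mode H l x) = (if k = l then 1 else 0)"
    using H by simp
qed

text \<open>The exponent of \<open>B\<close> is what makes the commutator error in \<open>perturbation_energy\<close> negligible: it is smaller than \<open>\<beta>\<close> by
\<open>min 1 \<beta>\<close>, which exceeds 1/2 as soon as \<open>\<beta>\<close> does. For \<open>\<beta> \<le> 1\<close> the bound is the subadditivity of the power function; for \<open>\<beta> > 1\<close> it is the
mean value theorem, with the factor \<open>max x y powr (\<beta> - 1)\<close> split into \<open>B\<close> and the distance.\<close>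

lemma powr_diff_bound:
  fixes \<beta> \<rho> x y B :: real
  assumes b: "\<beta> > 0" and r: "\<rho> = min 1 \<beta>" and x: "x \<ge> 0" and y: "0 \<le> y" "y \<le> B" and B: "B \<ge> 1"
  shows "\<bar>x powr \<beta> - y powr \<beta>\<bar> \<le> (\<beta> + 1) * 2 powr \<beta> * B powr (\<beta> - \<rho>) * (1 + \<bar>x - y\<bar>) powr \<beta>"
proof (cases "\<beta> \<le> 1")
  case True
  have sub: "u powr \<beta> - v powr \<beta> \<le> (u - v) powr \<beta>" if "0 \<le> v" "v \<le> u" for u v :: real
  proof (cases "u = 0")
    case False
    then have u: "u > 0" using that by auto
    \<comment> \<open>Subadditivity, normalised to \<open>u = 1\<close>: the two parts of 1 only grow when raised to a power of at most 1.\<close>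
    have a: "t \<le> t powr \<beta>" if "0 \<le> t" "t \<le> 1" for t :: real
      using powr_mono'[of \<beta> 1 t] that True by (cases "t = 0") auto
    have "1 = v / u + (u - v) / u" using u by (simp add: field_simps)
    also have "\<dots> \<le> (v / u) powr \<beta> + ((u - v) / u) powr \<beta>"
      using that u by (intro add_mono a) auto
    also have "\<dots> = (v powr \<beta> + (u - v) powr \<beta>) / u powr \<beta>"
      using that u by (simp add: powr_divide add_divide_distrib)
    finally show ?thesis using u by (simp add: pos_le_divide_eq)
  qed (use that in simp)
  have "\<bar>x powr \<beta> - y powr \<beta>\<bar> \<le> \<bar>x - y\<bar> powr \<beta>"
  proof (cases "x \<ge> y")
    case True then show ?thesis using sub[of y x] y x powr_mono2[of \<beta> y x] b by simp
  next
    case False then show ?thesis using sub[of x y] y x powr_mono2[of \<beta> x y] b by simp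
  qed
  also have "\<dots> \<le> (1 + \<bar>x - y\<bar>) powr \<beta>" using b by (intro powr_mono2) auto
  also have "\<dots> \<le> ((\<beta> + 1) * 2 powr \<beta>) * (1 + \<bar>x - y\<bar>) powr \<beta>"
  proof -
    have "1 * 1 \<le> (\<beta> + 1) * 2 powr \<beta>" using b by (intro mult_mono) (auto simp: ge_one_powr_ge_zero)
    then show ?thesis using mult_right_mono[of 1 "(\<beta> + 1) * 2 powr \<beta>" "(1 + \<bar>x - y\<bar>) powr \<beta>"] by simp
  qed
  finally show ?thesis using True r B by simp
next
  case False
  have r1: "\<rho> = 1" using False r by simp
  define m where "m = max x y"
  have m0: "m \<ge> 0" using x by (simp add: m_def)
  have mvt: "u powr \<beta> - v powr \<beta> \<le> \<beta> * u powr (\<beta> - 1) * (u - v)" if "0 \<le> v" "v < u" for u v :: real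
  proof -
    have "\<exists>l z. v < z \<and> z < u \<and> ((\<lambda>z. z powr \<beta>) has_real_derivative l) (at z) \<and> u powr \<beta> - v powr \<beta> = (u - v) * l"
    proof (rule MVT[OF that(2)])
      show "continuous_on {v..u} (\<lambda>z. z powr \<beta>)"
        using that b by (intro continuous_on_powr' continuous_intros) auto
      show "(\<lambda>z. z powr \<beta>) differentiable (at z)" if "v < z" "z < u" for z
        using has_real_derivative_powr[of z \<beta>] that \<open>0 \<le> v\<close> by (auto simp: real_differentiable_def)
    qed
    then obtain l z where lz: "v < z" "z < u" "((\<lambda>z. z powr \<beta>) has_real_derivative l) (at z)" "u powr \<beta> - v powr \<beta> = (u - v) * l" by blast
    have "l = \<beta> * z powr (\<beta> - 1)"
      using DERIV_unique[OF lz(3)] has_real_derivative_powr[of z \<beta>] lz(1) that by auto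
    then have "\<exists>z. v < z \<and> z < u \<and> u powr \<beta> - v powr \<beta> = (u - v) * (\<beta> * z powr (\<beta> - 1))" using lz by auto
    then obtain z where z: "v < z" "z < u" "u powr \<beta> - v powr \<beta> = (u - v) * (\<beta> * z powr (\<beta> - 1))" by blast
    have "z powr (\<beta> - 1) \<le> u powr (\<beta> - 1)" using z that False by (intro powr_mono2) auto
    then show ?thesis unfolding z(3) using b that by (simp add: mult_ac mult_left_mono)
  qed
  have "\<bar>x powr \<beta> - y powr \<beta>\<bar> \<le> \<beta> * m powr (\<beta> - 1) * \<bar>x - y\<bar>"
  proof (cases x y rule: linorder_cases)
    case less then show ?thesis using mvt[of x y] x y powr_mono2[of \<beta> x y] b by (simp add: m_def max_def)
  next
    case equal then show ?thesis by simp
  next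
    case greater then show ?thesis using mvt[of y x] x y powr_mono2[of \<beta> y x] b by (simp add: m_def max_def)
  qed
  also have "m powr (\<beta> - 1) \<le> (2 * B * (1 + \<bar>x - y\<bar>)) powr (\<beta> - 1)"
  proof (rule powr_mono2)
    have "m \<le> B + \<bar>x - y\<bar>" using y by (auto simp: m_def)
    also have "\<dots> \<le> B * (1 + \<bar>x - y\<bar>)" using mult_right_mono[OF B, of "\<bar>x - y\<bar>"] by (simp add: algebra_simps)
    also have "\<dots> \<le> 2 * B * (1 + \<bar>x - y\<bar>)" using B by simp
    finally show "m \<le> 2 * B * (1 + \<bar>x - y\<bar>)" .
  qed (use False m0 in auto)
  also have "(2 * B * (1 + \<bar>x - y\<bar>)) powr (\<beta> - 1) = 2 powr (\<beta> - 1) * B powr (\<beta> - 1) * (1 + \<bar>x - y\<bar>) powr (\<beta> - 1)"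
    using B by (simp add: powr_mult)
  finally have "\<bar>x powr \<beta> - y powr \<beta>\<bar> \<le> \<beta> * (2 powr (\<beta> - 1) * B powr (\<beta> - 1) * (1 + \<bar>x - y\<bar>) powr (\<beta> - 1)) * \<bar>x - y\<bar>"
    using b by (simp add: mult_left_mono mult_right_mono)
  also have "\<dots> \<le> (\<beta> + 1) * (2 powr \<beta> * B powr (\<beta> - 1) * (1 + \<bar>x - y\<bar>) powr (\<beta> - 1)) * (1 + \<bar>x - y\<bar>)"
    using b B by (intro mult_mono powr_mono) auto
  also have "\<dots> = (\<beta> + 1) * 2 powr \<beta> * B powr (\<beta> - 1) * ((1 + \<bar>x - y\<bar>) powr (\<beta> - 1) * (1 + \<bar>x - y\<bar>) powr 1)"
    by simp
  also have "(1 + \<bar>x - y\<bar>) powr (\<beta> - 1) * (1 + \<bar>x - y\<bar>) powr 1 = (1 + \<bar>x - y\<bar>) powr \<beta>"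
    by (simp only: powr_add[symmetric]) simp
  finally show ?thesis unfolding r1 .
qed

section \<open>Sobolev energy of windowed cosine sums\<close>

text \<open>This is \<open>2 \<pi>\<close> times the functional that defines the Sobolev class.\<close>

definition fourier_energy :: "real \<Rightarrow> (real \<Rightarrow> real) \<Rightarrow> ennreal" where
  "fourier_energy \<beta> f = (\<integral>\<^sup>+\<omega>. ennreal (\<bar>\<omega>\<bar> powr (2 * \<beta>) * (cmod (fourier f \<omega>))\<^sup>2) \<partial>lborel)"

lemma fourier_add:
  assumes "integrable lborel f" "integrable lborel g"
  shows "fourier (\<lambda>x. f x + g x) \<omega> = fourier f \<omega> + fourier g \<omega>"
  unfolding fourier_def
  using Bochner_Integration.integral_add[OF fourier_integrable[OF assms(1)] fourier_integrable[OF assms(2)], of \<omega> \<omega>]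
  by (simp add: distrib_right)

lemma fourier_cmult: "fourier (\<lambda>x. c * f x) \<omega> = complex_of_real c * fourier f \<omega>"
  unfolding fourier_def integral_mult_right_zero[symmetric] by (simp add: mult.assoc)

lemma fourier_sum:
  assumes "\<And>k. k \<in> K \<Longrightarrow> integrable lborel (f k)"
  shows "fourier (\<lambda>x. \<Sum>k\<in>K. c k * f k x) \<omega> = (\<Sum>k\<in>K. complex_of_real (c k) * fourier (f k) \<omega>)"
proof -
  have "fourier (\<lambda>x. \<Sum>k\<in>K. c k * f k x) \<omega> = (CLINT x|lborel. (\<Sum>k\<in>K. complex_of_real (c k) * (complex_of_real (f k x) * iexp (\<omega> * x))))"
    unfolding fourier_def by (simp add: sum_distrib_right mult.assoc)
  also have "\<dots> = (\<Sum>k\<in>K. CLINT x|lborel. complex_of_real (c k) * (complex_of_real (f k x) * iexp (\<omega> * x)))"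
    using fourier_integrable[OF assms]
    by (intro Bochner_Integration.integral_sum L1_intros) auto
  also have "\<dots> = (\<Sum>k\<in>K. complex_of_real (c k) * fourier (f k) \<omega>)"
    unfolding fourier_def by (simp only: integral_mult_right_zero)
  finally show ?thesis .
qed

lemma ennreal_lincomb:
  assumes "0 \<le> a" "0 \<le> b" "0 \<le> x" "0 \<le> y"
  shows "ennreal a * ennreal x + ennreal b * ennreal y = ennreal (a * x + b * y)"
  using assms by (simp add: ennreal_mult)

lemma ennreal_lincomb1:
  assumes "0 \<le> a" "0 \<le> x" "0 \<le> y"
  shows "ennreal a * ennreal x + ennreal y = ennreal (a * x + y)"
  using assms by (simp add: ennreal_mult)

lemma young_square:
  fixes a b \<eta> :: real assumes "\<eta> > 0"
  shows "(a + b)\<^sup>2 \<le> (1 + \<eta>) * a\<^sup>2 + (1 + 1 / \<eta>) * b\<^sup>2"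
proof -
  have "0 \<le> (\<eta> * a - b)\<^sup>2 / \<eta>" using assms by simp
  also have "\<dots> = \<eta> * a\<^sup>2 - 2 * a * b + 1 / \<eta> * b\<^sup>2"
    using assms by (simp add: power2_eq_square field_simps)
  finally show ?thesis by (simp add: power2_sum algebra_simps)
qed

text \<open>For small \<open>\<eta>\<close> the energy of the first summand is increased only slightly, provided that the energy of the
second one is small compared with \<open>\<eta>\<close>.\<close>

lemma fourier_energy_add_le:
  assumes f: "integrable lborel f" and g: "integrable lborel g" and \<eta>: "\<eta> > 0"
  shows "fourier_energy \<beta> (\<lambda>x. f x + g x) \<le> ennreal (1 + \<eta>) * fourier_energy \<beta> f + ennreal (1 + 1 / \<eta>) * fourier_energy \<beta> g"
proof -
  have [measurable]: "f \<in> borel_measurable borel" "g \<in> borel_measurable borel" using f g by auto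
  have "fourier_energy \<beta> (\<lambda>x. f x + g x) \<le> (\<integral>\<^sup>+\<omega>. ennreal (1 + \<eta>) * ennreal (\<bar>\<omega>\<bar> powr (2 * \<beta>) * (cmod (fourier f \<omega>))\<^sup>2) + ennreal (1 + 1 / \<eta>) * ennreal (\<bar>\<omega>\<bar> powr (2 * \<beta>) * (cmod (fourier g \<omega>))\<^sup>2) \<partial>lborel)"
    unfolding fourier_energy_def
  proof (intro nn_integral_mono)
    fix \<omega> :: real
    have "(cmod (fourier (\<lambda>x. f x + g x) \<omega>))\<^sup>2 \<le> (cmod (fourier f \<omega>) + cmod (fourier g \<omega>))\<^sup>2"
      unfolding fourier_add[OF f g] by (intro power_mono norm_triangle_ineq) simp
    also have "\<dots> \<le> (1 + \<eta>) * (cmod (fourier f \<omega>))\<^sup>2 + (1 + 1 / \<eta>) * (cmod (fourier g \<omega>))\<^sup>2"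
      by (rule young_square[OF \<eta>])
    finally have "\<bar>\<omega>\<bar> powr (2 * \<beta>) * (cmod (fourier (\<lambda>x. f x + g x) \<omega>))\<^sup>2 \<le> \<bar>\<omega>\<bar> powr (2 * \<beta>) * ((1 + \<eta>) * (cmod (fourier f \<omega>))\<^sup>2 + (1 + 1 / \<eta>) * (cmod (fourier g \<omega>))\<^sup>2)"
      by (intro mult_left_mono) auto
    also have "\<dots> = (1 + \<eta>) * (\<bar>\<omega>\<bar> powr (2 * \<beta>) * (cmod (fourier f \<omega>))\<^sup>2) + (1 + 1 / \<eta>) * (\<bar>\<omega>\<bar> powr (2 * \<beta>) * (cmod (fourier g \<omega>))\<^sup>2)"
      by (simp add: algebra_simps)
    finally show "ennreal (\<bar>\<omega>\<bar> powr (2 * \<beta>) * (cmod (fourier (\<lambda>x. f x + g x) \<omega>))\<^sup>2) \<le> ennreal (1 + \<eta>) * ennreal (\<bar>\<omega>\<bar> powr (2 * \<beta>) * (cmod (fourier f \<omega>))\<^sup>2) + ennreal (1 + 1 / \<eta>) * ennreal (\<bar>\<omega>\<bar> powr (2 * \<beta>) * (cmod (fourier g \<omega>))\<^sup>2)"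
      using \<eta> by (simp add: ennreal_mult[symmetric] ennreal_plus[symmetric] ennreal_leI del: ennreal_plus)
  qed
  also have "\<dots> = ennreal (1 + \<eta>) * fourier_energy \<beta> f + ennreal (1 + 1 / \<eta>) * fourier_energy \<beta> g"
    unfolding fourier_energy_def by (subst nn_integral_add, measurable) (simp add: nn_integral_cmult)
  finally show ?thesis .
qed

lemma fourier_energy_cmult:
  assumes [measurable]: "f \<in> borel_measurable borel"
  shows "fourier_energy \<beta> (\<lambda>x. c * f x) = ennreal (c\<^sup>2) * fourier_energy \<beta> f"
proof -
  have "fourier_energy \<beta> (\<lambda>x. c * f x) = (\<integral>\<^sup>+\<omega>. ennreal (c\<^sup>2) * ennreal (\<bar>\<omega>\<bar> powr (2 * \<beta>) * (cmod (fourier f \<omega>))\<^sup>2) \<partial>lborel)"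
    unfolding fourier_energy_def fourier_cmult
    by (intro nn_integral_cong) (simp add: norm_mult power_mult_distrib ennreal_mult[symmetric] mult_ac)
  also have "\<dots> = ennreal (c\<^sup>2) * fourier_energy \<beta> f"
    unfolding fourier_energy_def by (rule nn_integral_cmult) measurable
  finally show ?thesis .
qed

lemma fourier_energy_scaled:
  assumes [measurable]: "f \<in> borel_measurable borel" and c: "c > 0"
  shows "fourier_energy \<beta> (\<lambda>x. f (x / c)) = ennreal (c powr (1 - 2 * \<beta>)) * fourier_energy \<beta> f"
proof -
  have "fourier_energy \<beta> f = ennreal \<bar>c\<bar> * (\<integral>\<^sup>+\<omega>. ennreal (\<bar>0 + c * \<omega>\<bar> powr (2 * \<beta>) * (cmod (fourier f (0 + c * \<omega>)))\<^sup>2) \<partial>lborel)"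
    unfolding fourier_energy_def using c by (intro nn_integral_real_affine) auto
  also have "\<dots> = ennreal c * (\<integral>\<^sup>+\<omega>. ennreal (c powr (2 * \<beta>) / c\<^sup>2) * ennreal (\<bar>\<omega>\<bar> powr (2 * \<beta>) * (cmod (fourier (\<lambda>x. f (x / c)) \<omega>))\<^sup>2) \<partial>lborel)"
    using c by (intro arg_cong2[where f="(*)"] nn_integral_cong)
      (auto simp: fourier_scaled[OF c] norm_mult power_mult_distrib abs_mult powr_mult ennreal_mult[symmetric])
  also have "\<dots> = ennreal c * (ennreal (c powr (2 * \<beta>) / c\<^sup>2) * fourier_energy \<beta> (\<lambda>x. f (x / c)))"
    unfolding fourier_energy_def by (subst nn_integral_cmult) auto
  finally have "ennreal (c powr (1 - 2 * \<beta>)) * fourier_energy \<beta> f = (ennreal (c powr (1 - 2 * \<beta>)) * ennreal c * ennreal (c powr (2 * \<beta>) / c\<^sup>2)) * fourier_energy \<beta> (\<lambda>x. f (x / c))"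
    by (simp add: mult.assoc)
  also have "ennreal (c powr (1 - 2 * \<beta>)) * ennreal c * ennreal (c powr (2 * \<beta>) / c\<^sup>2) = 1"
    using c by (simp add: ennreal_mult[symmetric] powr_diff power2_eq_square)
  finally show ?thesis by simp
qed

definition windowed_mode :: "(real \<Rightarrow> real) \<Rightarrow> real \<Rightarrow> nat \<Rightarrow> real \<Rightarrow> real" where
  "windowed_mode q H k x = q (x / H) * cosine_mode H k x"

text \<open>A smooth version of the indicator of \<open>[-1, 1]\<close>, flat up to the relative distance \<open>e\<close> from the end points.
Its rescalings serve both as the cut-off of the cosines and, normalised, as the unperturbed density.\<close>

locale window =
  fixes q :: "real \<Rightarrow> real" and e \<beta> :: real
  assumes q_meas [measurable]: "q \<in> borel_measurable borel"
    and q_range: "\<And>x. 0 \<le> q x \<and> q x \<le> 1"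
    and q_support: "\<And>x. \<bar>x\<bar> > 1 \<Longrightarrow> q x = 0"
    and q_flat: "\<And>x. \<bar>x\<bar> \<le> 1 - e \<Longrightarrow> q x = 1"
    and q_energy: "(\<integral>\<^sup>+\<omega>. ennreal ((1 + \<bar>\<omega>\<bar>) powr (2 * \<beta>) * (cmod (fourier q \<omega>))\<^sup>2) \<partial>lborel) < \<infinity>"
    and e: "0 < e" "e < 1"
    and beta: "\<beta> > 1/2"
begin

lemma q_integrable: "integrable lborel q"
  by (rule integrable_compact_support[where C=1 and R=1]) (use q_range q_support in auto)

lemma windowed_mode_measurable [measurable]: "windowed_mode q H k \<in> borel_measurable borel"
  unfolding windowed_mode_def[abs_def] by measurable

lemma windowed_mode_bound:
  assumes "H > 0" shows "\<bar>windowed_mode q H k x\<bar> \<le> 1 / sqrt H"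
proof -
  have "\<bar>windowed_mode q H k x\<bar> \<le> 1 * (1 / sqrt H)"
    unfolding windowed_mode_def abs_mult
    using q_range[of "x / H"] cosine_mode_bound[OF assms, of k x] assms by (intro mult_mono) auto
  then show ?thesis by simp
qed

lemma windowed_mode_outside: "\<bar>x\<bar> > H \<Longrightarrow> windowed_mode q H k x = 0"
  by (simp add: windowed_mode_def cosine_mode_outside)

lemma windowed_mode_integrable: "H > 0 \<Longrightarrow> integrable lborel (windowed_mode q H k)"
  by (rule integrable_compact_support[OF _ windowed_mode_bound windowed_mode_outside]) auto

text \<open>Multiplying by a cosine shifts the transform of the window to both frequencies \<open>freq H k\<close> and
\<open>- freq H k\<close>.\<close>

lemma fourier_windowed_mode:
  assumes H: "H > 0"
  shows "cmod (fourier (windowed_mode q H k) \<omega>) \<le>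
     1 / (2 * sqrt H) * (cmod (fourier (\<lambda>x. q (x / H)) (\<omega> + freq H k)) + cmod (fourier (\<lambda>x. q (x / H)) (\<omega> - freq H k)))"
proof -
  define w where "w = (\<lambda>x. q (x / H))"
  have [measurable]: "w \<in> borel_measurable borel" unfolding w_def by measurable
  have wi: "integrable lborel w"
    by (rule integrable_compact_support[where C=1 and R=H]) (use q_range q_support H in \<open>auto simp: w_def abs_divide\<close>)
  let ?E = iexp
  define c1 c2 where "c1 = ?E (freq H k * H) / complex_of_real (2 * sqrt H)" and "c2 = ?E (- (freq H k * H)) / complex_of_real (2 * sqrt H)"
  have eq: "complex_of_real (windowed_mode q H k x) * ?E (\<omega> * x) = c1 * (complex_of_real (w x) * ?E ((\<omega> + freq H k) * x)) + c2 * (complex_of_real (w x) * ?E ((\<omega> - freq H k) * x))" for x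
  proof (cases "\<bar>x\<bar> \<le> H")
    case True
    have c: "complex_of_real (cos t) = (?E t + ?E (- t)) / 2" for t
      by (simp add: cos_of_real[symmetric] cos_exp_eq)
    have split: "?E a / complex_of_real (2 * sqrt H) * (complex_of_real (w x) * ?E b) = complex_of_real (w x / sqrt H) * (?E s / 2) * ?E (\<omega> * x)"
      if "a + b = s + \<omega> * x" for a b s
    proof -
      have "?E a * ?E b = ?E s * ?E (\<omega> * x)"
        unfolding exp_add[symmetric] distrib_left[symmetric] of_real_add[symmetric] that ..
      then have "?E a * ?E b * complex_of_real (w x) / complex_of_real (2 * sqrt H) = ?E s * ?E (\<omega> * x) * complex_of_real (w x) / complex_of_real (2 * sqrt H)"
        by simp
      then show ?thesis by (simp del: of_real_minus add: mult.commute mult.left_commute)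
    qed
    have "c1 * (complex_of_real (w x) * ?E ((\<omega> + freq H k) * x)) = complex_of_real (w x / sqrt H) * (?E (freq H k * (x + H)) / 2) * ?E (\<omega> * x)"
      unfolding c1_def by (rule split) (simp add: algebra_simps)
    moreover have "c2 * (complex_of_real (w x) * ?E ((\<omega> - freq H k) * x)) = complex_of_real (w x / sqrt H) * (?E (- (freq H k * (x + H))) / 2) * ?E (\<omega> * x)"
      unfolding c2_def by (rule split) (simp add: algebra_simps)
    moreover have "complex_of_real (windowed_mode q H k x) = complex_of_real (w x / sqrt H) * complex_of_real (cos (freq H k * (x + H)))"
      using True by (auto simp: windowed_mode_def cosine_mode_def w_def indicator_def abs_le_iff)
    ultimately show ?thesis unfolding c by (simp only: add_divide_distrib distrib_left distrib_right)
  next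
    case False
    then have "w x = 0" using q_support[of "x / H"] H by (simp add: w_def abs_divide)
    then show ?thesis by (simp add: windowed_mode_def w_def)
  qed
  have "fourier (windowed_mode q H k) \<omega> = c1 * fourier w (\<omega> + freq H k) + c2 * fourier w (\<omega> - freq H k)"
    unfolding fourier_def eq
    by (subst Bochner_Integration.integral_add[OF Bochner_Integration.integrable_mult_right[OF fourier_integrable[OF wi]] Bochner_Integration.integrable_mult_right[OF fourier_integrable[OF wi]]])
       (simp only: integral_mult_right_zero)
  also have "cmod \<dots> \<le> cmod (c1 * fourier w (\<omega> + freq H k)) + cmod (c2 * fourier w (\<omega> - freq H k))"
    by (rule norm_triangle_ineq)
  also have "\<dots> = 1 / (2 * sqrt H) * (cmod (fourier w (\<omega> + freq H k)) + cmod (fourier w (\<omega> - freq H k)))"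
    using H unfolding c1_def c2_def
    by (simp add: norm_mult norm_divide distrib_left del: of_real_mult)
  finally show ?thesis unfolding w_def .
qed

lemma scaled_window_energy_finite:
  assumes H: "H \<ge> 1"
  shows "(\<integral>\<^sup>+\<omega>. ennreal (((1 + \<bar>\<omega>\<bar>) powr \<beta> * cmod (fourier (\<lambda>x. q (x / H)) \<omega>))\<^sup>2) \<partial>lborel) < \<infinity>"
proof -
  have sq: "((1 + \<bar>\<omega>\<bar>) powr \<beta>)\<^sup>2 = (1 + \<bar>\<omega>\<bar>) powr (2 * \<beta>)" for \<omega> :: real
    by (simp add: power2_eq_square powr_add[symmetric])
  have "(\<integral>\<^sup>+\<omega>. ennreal (((1 + \<bar>\<omega>\<bar>) powr \<beta> * cmod (fourier (\<lambda>x. q (x / H)) \<omega>))\<^sup>2) \<partial>lborel)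
     \<le> (\<integral>\<^sup>+\<omega>. ennreal (H\<^sup>2) * ennreal ((1 + \<bar>0 + H * \<omega>\<bar>) powr (2 * \<beta>) * (cmod (fourier q (0 + H * \<omega>)))\<^sup>2) \<partial>lborel)"
  proof (intro nn_integral_mono)
    fix \<omega> :: real
    have "\<bar>\<omega>\<bar> \<le> \<bar>0 + H * \<omega>\<bar>" using mult_right_mono[OF H, of "\<bar>\<omega>\<bar>"] H by (simp add: abs_mult)
    then have "(1 + \<bar>\<omega>\<bar>) powr (2 * \<beta>) \<le> (1 + \<bar>0 + H * \<omega>\<bar>) powr (2 * \<beta>)" using beta by (intro powr_mono2) auto
    then have "(1 + \<bar>\<omega>\<bar>) powr (2 * \<beta>) * (H\<^sup>2 * (cmod (fourier q (0 + H * \<omega>)))\<^sup>2) \<le> (1 + \<bar>0 + H * \<omega>\<bar>) powr (2 * \<beta>) * (H\<^sup>2 * (cmod (fourier q (0 + H * \<omega>)))\<^sup>2)"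
      by (intro mult_right_mono) auto
    then show "ennreal (((1 + \<bar>\<omega>\<bar>) powr \<beta> * cmod (fourier (\<lambda>x. q (x / H)) \<omega>))\<^sup>2) \<le> ennreal (H\<^sup>2) * ennreal ((1 + \<bar>0 + H * \<omega>\<bar>) powr (2 * \<beta>) * (cmod (fourier q (0 + H * \<omega>)))\<^sup>2)"
      using H by (simp add: ennreal_mult[symmetric] power_mult_distrib sq fourier_scaled norm_mult mult_ac ennreal_leI)
  qed
  also have "\<dots> = ennreal (H\<^sup>2) * (\<integral>\<^sup>+\<omega>. ennreal ((1 + \<bar>0 + H * \<omega>\<bar>) powr (2 * \<beta>) * (cmod (fourier q (0 + H * \<omega>)))\<^sup>2) \<partial>lborel)"
    by (rule nn_integral_cmult) measurable
  also have "\<dots> < \<infinity>"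
  proof -
    have "ennreal \<bar>H\<bar> * (\<integral>\<^sup>+\<omega>. ennreal ((1 + \<bar>0 + H * \<omega>\<bar>) powr (2 * \<beta>) * (cmod (fourier q (0 + H * \<omega>)))\<^sup>2) \<partial>lborel) < \<infinity>"
      using q_energy H by (subst nn_integral_real_affine[symmetric]) auto
    then show ?thesis using H by (auto simp: ennreal_mult_less_top)
  qed
  finally show ?thesis .
qed

text \<open>The weight \<open>(1 + \<bar>\<omega>\<bar>) powr \<beta>\<close> absorbs the distance to the nominal frequency that \<open>powr_diff_bound\<close> produces.\<close>

definition mode_tail :: "real \<Rightarrow> real" where
  "mode_tail H = enn2real (\<integral>\<^sup>+\<omega>. ennreal (((1 + \<bar>\<omega>\<bar>) powr \<beta> * cmod (fourier (\<lambda>x. q (x / H)) \<omega>))\<^sup>2) \<partial>lborel)"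

text \<open>Write \<open>\<bar>\<omega>\<bar> powr \<beta> = freq H k powr \<beta> + (\<bar>\<omega>\<bar> powr \<beta> - freq H k powr \<beta>)\<close> in each summand. The first parts add
up to the transform of a windowed cosine sum, whose norm is at most the norm of the sum itself on \<open>[-H, H]\<close> because
the window is bounded by 1; there the cosines are orthonormal. The second parts are small because the transform of
each windowed cosine concentrates near its frequencies, and a crude Cauchy-Schwarz estimate over the \<open>N\<close> frequencies
is enough for them.\<close>

lemma perturbation_energy:
  fixes \<theta> :: "nat \<Rightarrow> real"
  assumes H: "H \<ge> 1" and K: "K \<subseteq> {1..N}" and \<theta>: "\<And>k. k \<in> K \<Longrightarrow> \<bar>\<theta> k\<bar> \<le> \<Theta>" and \<eta>: "\<eta> > 0"
    and B: "B \<ge> 1" "freq H N \<le> B"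
  shows "fourier_energy \<beta> (\<lambda>x. \<Sum>k\<in>K. \<theta> k * windowed_mode q H k x) \<le>
     ennreal ((1 + \<eta>) * (2 * pi * (\<Sum>k\<in>K. freq H k powr (2 * \<beta>) * (\<theta> k)\<^sup>2)) +
       (1 + 1 / \<eta>) * ((2 * ((\<beta> + 1) * 2 powr \<beta> * B powr (\<beta> - min 1 \<beta>)) * (real N * \<Theta>))\<^sup>2 * mode_tail H))"
proof -
  have H0: "H > 0" using H by simp
  have fin: "finite K" using K finite_subset by blast
  define c where "c = (\<beta> + 1) * 2 powr \<beta> * B powr (\<beta> - min 1 \<beta>)"
  let ?h = "(\<lambda>x. \<Sum>k\<in>K. \<theta> k * windowed_mode q H k x)"
  let ?D = "\<lambda>k \<omega>. \<bar>\<bar>\<omega>\<bar> powr \<beta> - freq H k powr \<beta>\<bar>"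
  let ?E = "(\<Sum>k\<in>K. freq H k powr (2 * \<beta>) * (\<theta> k)\<^sup>2)"
  have c0: "c \<ge> 0" unfolding c_def using beta by auto
  have Th0: "\<Theta> \<ge> 0" if "K \<noteq> {}" using that \<theta> by (metis abs_ge_zero ex_in_conv order_trans)
  define v where "v = (\<lambda>d. (1 + \<bar>d\<bar>) powr \<beta> * cmod (fourier (\<lambda>x. q (x / H)) d))"
  let ?V2 = "\<lambda>\<omega>. (\<Sum>k\<in>K. (v (\<omega> + freq H k))\<^sup>2 + (v (\<omega> - freq H k))\<^sup>2)"
  let ?V3 = "\<lambda>\<omega>. (\<Sum>k\<in>K. ennreal ((v (\<omega> + freq H k))\<^sup>2) + ennreal ((v (\<omega> - freq H k))\<^sup>2))"
  have [measurable]: "v \<in> borel_measurable borel" unfolding v_def by measurable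
  have v0: "v d \<ge> 0" for d by (simp add: v_def)
  define V where "V = (\<lambda>\<omega> k. v (\<omega> + freq H k) + v (\<omega> - freq H k))"
  have V0: "V \<omega> k \<ge> 0" for \<omega> k using v0 by (simp add: V_def)
  have tail: "(\<integral>\<^sup>+\<omega>. ennreal ((v (\<omega> + a))\<^sup>2) \<partial>lborel) = ennreal (mode_tail H)" for a
  proof -
    have "(\<integral>\<^sup>+\<omega>. ennreal ((v (\<omega> + a))\<^sup>2) \<partial>lborel) = (\<integral>\<^sup>+\<omega>. ennreal ((v \<omega>)\<^sup>2) \<partial>lborel)"
      using nn_integral_real_affine[of "\<lambda>\<omega>. ennreal ((v \<omega>)\<^sup>2)" 1 a] by (simp add: add.commute)
    also have "\<dots> = ennreal (mode_tail H)"
      unfolding mode_tail_def v_def using scaled_window_energy_finite[OF H] by (simp add: ennreal_enn2real_if)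
    finally show ?thesis .
  qed
  have mt0: "mode_tail H \<ge> 0" by (simp add: mode_tail_def)
  define St where "St = (\<lambda>x. \<Sum>k\<in>K. (\<theta> k * freq H k powr \<beta>) * windowed_mode q H k x)"
  have wmi: "integrable lborel (windowed_mode q H k)" for k by (rule windowed_mode_integrable[OF H0])
  have Sti: "integrable lborel St"
    unfolding St_def by (intro L1_intros wmi)
  have mult: "(?D k \<omega>) * cmod (fourier (windowed_mode q H k) \<omega>) \<le> c * V \<omega> k" if k: "k \<in> K" for \<omega> k
  proof -
    have f0: "0 \<le> freq H k" "freq H k \<le> B"
    proof -
      show "0 \<le> freq H k" using H0 by (simp add: freq_def)
      have "k \<le> N" using K k by auto
      then have "freq H k \<le> freq H N" using H0 by (simp add: freq_def divide_right_mono)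
      then show "freq H k \<le> B" using B by simp
    qed
    have d: "(?D k \<omega>) \<le> c * (1 + \<bar>\<omega> + a\<bar>) powr \<beta>" if "a = freq H k \<or> a = - freq H k" for a
    proof -
      have "(?D k \<omega>) \<le> c * (1 + \<bar>\<bar>\<omega>\<bar> - freq H k\<bar>) powr \<beta>"
        unfolding c_def using beta f0 B by (intro powr_diff_bound) auto
      also have "\<dots> \<le> c * (1 + \<bar>\<omega> + a\<bar>) powr \<beta>"
        using c0 beta f0 that by (intro mult_left_mono powr_mono2) auto
      finally show ?thesis .
    qed
    let ?D = "(?D k \<omega>)"
    have half: "1 / (2 * sqrt H) \<le> 1"
    proof (subst divide_le_eq_1_pos)
      show "0 < 2 * sqrt H" using H0 by simp
      show "1 \<le> 2 * sqrt H" using real_sqrt_ge_one[OF H] by linarith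
    qed
    have "?D * cmod (fourier (windowed_mode q H k) \<omega>) \<le> ?D * (1 / (2 * sqrt H) * (cmod (fourier (\<lambda>x. q (x / H)) (\<omega> + freq H k)) + cmod (fourier (\<lambda>x. q (x / H)) (\<omega> - freq H k))))"
      by (intro mult_left_mono fourier_windowed_mode[OF H0]) simp
    also have "\<dots> \<le> ?D * (1 * (cmod (fourier (\<lambda>x. q (x / H)) (\<omega> + freq H k)) + cmod (fourier (\<lambda>x. q (x / H)) (\<omega> - freq H k))))"
      by (intro mult_left_mono mult_right_mono half) auto
    also have "\<dots> = ?D * cmod (fourier (\<lambda>x. q (x / H)) (\<omega> + freq H k)) + ?D * cmod (fourier (\<lambda>x. q (x / H)) (\<omega> - freq H k))"
      by (simp add: distrib_left)
    also have "\<dots> \<le> (c * (1 + \<bar>\<omega> + freq H k\<bar>) powr \<beta>) * cmod (fourier (\<lambda>x. q (x / H)) (\<omega> + freq H k)) + (c * (1 + \<bar>\<omega> - freq H k\<bar>) powr \<beta>) * cmod (fourier (\<lambda>x. q (x / H)) (\<omega> - freq H k))"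
      using d[of "freq H k"] d[of "- freq H k"] by (intro add_mono mult_right_mono) auto
    also have "\<dots> = c * V \<omega> k" by (simp add: V_def v_def algebra_simps)
    finally show ?thesis .
  qed
  have pw: "\<bar>\<omega>\<bar> powr (2 * \<beta>) * (cmod (fourier ?h \<omega>))\<^sup>2 \<le>
     (1 + \<eta>) * (cmod (fourier St \<omega>))\<^sup>2 + (1 + 1 / \<eta>) * (2 * (c * \<Theta>)\<^sup>2 * real N * (?V2 \<omega>))" for \<omega>
  proof -
    define r where "r = (\<Sum>k\<in>K. complex_of_real (\<theta> k * (\<bar>\<omega>\<bar> powr \<beta> - freq H k powr \<beta>)) * fourier (windowed_mode q H k) \<omega>)"
    have "complex_of_real (\<bar>\<omega>\<bar> powr \<beta>) * fourier ?h \<omega> = fourier St \<omega> + r"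
      unfolding St_def r_def fourier_sum[OF wmi] sum.distrib[symmetric] sum_distrib_left
      by (intro sum.cong refl) (simp add: algebra_simps)
    then have "\<bar>\<omega>\<bar> powr \<beta> * cmod (fourier ?h \<omega>) = cmod (fourier St \<omega> + r)"
      by (metis abs_of_nonneg norm_mult norm_of_real powr_ge_zero)
    then have "(\<bar>\<omega>\<bar> powr \<beta> * cmod (fourier ?h \<omega>))\<^sup>2 \<le> (cmod (fourier St \<omega>) + cmod r)\<^sup>2"
      using norm_triangle_ineq by (simp add: power_mono)
    also have "\<dots> \<le> (1 + \<eta>) * (cmod (fourier St \<omega>))\<^sup>2 + (1 + 1 / \<eta>) * (cmod r)\<^sup>2"
      by (rule young_square[OF \<eta>])
    also have "(cmod r)\<^sup>2 \<le> 2 * (c * \<Theta>)\<^sup>2 * real N * (?V2 \<omega>)"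
    proof -
      have "cmod r \<le> (\<Sum>k\<in>K. cmod (complex_of_real (\<theta> k * (\<bar>\<omega>\<bar> powr \<beta> - freq H k powr \<beta>)) * fourier (windowed_mode q H k) \<omega>))"
        unfolding r_def by (rule norm_sum)
      also have "\<dots> \<le> (\<Sum>k\<in>K. c * \<Theta> * V \<omega> k)"
      proof (intro sum_mono)
        fix k assume k: "k \<in> K"
        have "cmod (complex_of_real (\<theta> k * (\<bar>\<omega>\<bar> powr \<beta> - freq H k powr \<beta>)) * fourier (windowed_mode q H k) \<omega>) = \<bar>\<theta> k\<bar> * ((?D k \<omega>) * cmod (fourier (windowed_mode q H k) \<omega>))"
          by (simp only: norm_mult norm_of_real abs_mult mult.assoc)
        also have "\<dots> \<le> \<Theta> * (c * V \<omega> k)"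
          by (rule mult_mono[OF \<theta>[OF k] mult[OF k, of \<omega>]]) (use Th0 k in auto)
        finally show "cmod (complex_of_real (\<theta> k * (\<bar>\<omega>\<bar> powr \<beta> - freq H k powr \<beta>)) * fourier (windowed_mode q H k) \<omega>) \<le> c * \<Theta> * V \<omega> k"
          by (simp add: mult_ac)
      qed
      finally have "(cmod r)\<^sup>2 \<le> (\<Sum>k\<in>K. c * \<Theta> * V \<omega> k)\<^sup>2" by (intro power_mono) auto
      also have "\<dots> = (c * \<Theta>)\<^sup>2 * (\<Sum>k\<in>K. V \<omega> k)\<^sup>2" by (simp add: sum_distrib_left[symmetric] power_mult_distrib)
      finally have r1: "(cmod r)\<^sup>2 \<le> (c * \<Theta>)\<^sup>2 * (\<Sum>k\<in>K. V \<omega> k)\<^sup>2" .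
      have r2: "(\<Sum>k\<in>K. V \<omega> k)\<^sup>2 \<le> real N * (\<Sum>k\<in>K. (V \<omega> k)\<^sup>2)"
      proof -
        have "(\<Sum>k\<in>K. V \<omega> k)\<^sup>2 \<le> (\<Sum>k\<in>K. (1::real)\<^sup>2) * (\<Sum>k\<in>K. (V \<omega> k)\<^sup>2)"
          using Cauchy_Schwarz_ineq_sum[of "\<lambda>_. 1" "V \<omega>" K] by simp
        also have "(\<Sum>k\<in>K. (1::real)\<^sup>2) = real (card K)" by simp
        also have "\<dots> * (\<Sum>k\<in>K. (V \<omega> k)\<^sup>2) \<le> real N * (\<Sum>k\<in>K. (V \<omega> k)\<^sup>2)"
          using card_mono[OF _ K] by (intro mult_right_mono sum_nonneg) auto
        finally show ?thesis .
      qed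
      have r3: "(\<Sum>k\<in>K. (V \<omega> k)\<^sup>2) \<le> (\<Sum>k\<in>K. 2 * ((v (\<omega> + freq H k))\<^sup>2 + (v (\<omega> - freq H k))\<^sup>2))"
        unfolding V_def using young_square[of 1] by (intro sum_mono) simp
      have "(c * \<Theta>)\<^sup>2 * (\<Sum>k\<in>K. V \<omega> k)\<^sup>2 \<le> (c * \<Theta>)\<^sup>2 * (real N * (\<Sum>k\<in>K. 2 * ((v (\<omega> + freq H k))\<^sup>2 + (v (\<omega> - freq H k))\<^sup>2)))"
        by (intro mult_left_mono order_trans[OF r2] r3) auto
      also have "\<dots> = 2 * (c * \<Theta>)\<^sup>2 * real N * (?V2 \<omega>)"
        by (simp only: sum_distrib_left[symmetric] mult_ac)
      finally show ?thesis using r1 by linarith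
    qed
    finally show ?thesis using \<eta> by (simp add: power_mult_distrib power2_eq_square[of "_ powr _"] powr_add[symmetric] mult_left_mono)
  qed
  have "fourier_energy \<beta> ?h \<le> (\<integral>\<^sup>+\<omega>. ennreal (1 + \<eta>) * ennreal ((cmod (fourier St \<omega>))\<^sup>2) + ennreal ((1 + 1 / \<eta>) * (2 * (c * \<Theta>)\<^sup>2 * real N)) * (?V3 \<omega>) \<partial>lborel)"
    unfolding fourier_energy_def
  proof (intro nn_integral_mono)
    fix \<omega>
    have "ennreal (1 + \<eta>) * ennreal ((cmod (fourier St \<omega>))\<^sup>2) + ennreal ((1 + 1 / \<eta>) * (2 * (c * \<Theta>)\<^sup>2 * real N)) * (?V3 \<omega>)
      = ennreal ((1 + \<eta>) * (cmod (fourier St \<omega>))\<^sup>2 + (1 + 1 / \<eta>) * (2 * (c * \<Theta>)\<^sup>2 * real N * (?V2 \<omega>)))"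
    proof -
      have "(?V3 \<omega>) = ennreal (?V2 \<omega>)"
        by (subst sum_ennreal[symmetric]) (auto intro!: sum.cong)
      moreover have "ennreal (1 + \<eta>) * ennreal ((cmod (fourier St \<omega>))\<^sup>2) + ennreal ((1 + 1 / \<eta>) * (2 * (c * \<Theta>)\<^sup>2 * real N)) * ennreal (?V2 \<omega>) = ennreal ((1 + \<eta>) * (cmod (fourier St \<omega>))\<^sup>2 + (1 + 1 / \<eta>) * (2 * (c * \<Theta>)\<^sup>2 * real N) * (?V2 \<omega>))"
        using \<eta> by (intro ennreal_lincomb mult_nonneg_nonneg sum_nonneg) auto
      ultimately show ?thesis by (simp only: mult.assoc)
    qed
    then show "ennreal (\<bar>\<omega>\<bar> powr (2 * \<beta>) * (cmod (fourier ?h \<omega>))\<^sup>2) \<le> ennreal (1 + \<eta>) * ennreal ((cmod (fourier St \<omega>))\<^sup>2) + ennreal ((1 + 1 / \<eta>) * (2 * (c * \<Theta>)\<^sup>2 * real N)) * (?V3 \<omega>)"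
      using ennreal_leI[OF pw[of \<omega>]] by simp
  qed
  also have "\<dots> = ennreal (1 + \<eta>) * (\<integral>\<^sup>+\<omega>. ennreal ((cmod (fourier St \<omega>))\<^sup>2) \<partial>lborel) + ennreal ((1 + 1 / \<eta>) * (2 * (c * \<Theta>)\<^sup>2 * real N)) * (\<Sum>k\<in>K. (\<integral>\<^sup>+\<omega>. ennreal ((v (\<omega> + freq H k))\<^sup>2) \<partial>lborel) + (\<integral>\<^sup>+\<omega>. ennreal ((v (\<omega> + - freq H k))\<^sup>2) \<partial>lborel))"
    using Sti by (subst nn_integral_add, measurable) (simp add: nn_integral_cmult nn_integral_sum nn_integral_add)
  also have "(\<Sum>k\<in>K. (\<integral>\<^sup>+\<omega>. ennreal ((v (\<omega> + freq H k))\<^sup>2) \<partial>lborel) + (\<integral>\<^sup>+\<omega>. ennreal ((v (\<omega> + - freq H k))\<^sup>2) \<partial>lborel)) = ennreal (real (card K) * (2 * mode_tail H))"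
    unfolding tail using mt0 by (simp add: ennreal_plus[symmetric] ennreal_of_nat_eq_real_of_nat ennreal_mult[symmetric] del: ennreal_plus)
  also have "ennreal ((1 + 1 / \<eta>) * (2 * (c * \<Theta>)\<^sup>2 * real N)) * ennreal (real (card K) * (2 * mode_tail H)) \<le> ennreal ((1 + 1 / \<eta>) * ((2 * c * (real N * \<Theta>))\<^sup>2 * mode_tail H))"
  proof -
    have "real (card K) \<le> real N" using card_mono[OF _ K] by simp
    then have "(1 + 1 / \<eta>) * (2 * (c * \<Theta>)\<^sup>2 * real N) * (real (card K) * (2 * mode_tail H)) \<le> (1 + 1 / \<eta>) * (2 * (c * \<Theta>)\<^sup>2 * real N) * (real N * (2 * mode_tail H))"
      using \<eta> mt0 by (intro mult_left_mono mult_right_mono) auto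
    also have "\<dots> = (1 + 1 / \<eta>) * ((2 * c * (real N * \<Theta>))\<^sup>2 * mode_tail H)" by (simp add: power2_eq_square mult_ac)
    finally show ?thesis using \<eta> mt0 by (subst ennreal_mult[symmetric]) (auto intro!: ennreal_leI)
  qed
  also have "(\<integral>\<^sup>+\<omega>. ennreal ((cmod (fourier St \<omega>))\<^sup>2) \<partial>lborel) \<le> ennreal (2 * pi * ?E)"
  proof -
    have on: "orthonormal_on_line K (cosine_mode H)" by (rule cosine_mode_orthonormal[OF H0]) (use K in auto)
    define S where "S = (\<lambda>x. \<Sum>k\<in>K. (\<theta> k * freq H k powr \<beta>) * cosine_mode H k x)"
    have St_S: "(St x)\<^sup>2 \<le> (S x)\<^sup>2" for x
    proof -
      have "St x = q (x / H) * S x" by (simp add: St_def S_def windowed_mode_def sum_distrib_left mult_ac)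
      then have "\<bar>St x\<bar> \<le> \<bar>S x\<bar>" using q_range[of "x / H"] by (simp add: abs_mult mult_left_le_one_le)
      then show ?thesis by (simp add: abs_le_square_iff)
    qed
    have "(\<integral>\<^sup>+\<omega>. ennreal ((cmod (fourier St \<omega>))\<^sup>2) \<partial>lborel) \<le> ennreal (2 * pi) * (\<integral>\<^sup>+x. ennreal ((St x)\<^sup>2) \<partial>lborel)"
      by (rule plancherel_le[OF Sti])
    also have "\<dots> \<le> ennreal (2 * pi) * (\<integral>\<^sup>+x. ennreal ((S x)\<^sup>2) \<partial>lborel)"
      by (intro mult_left_mono nn_integral_mono ennreal_leI St_S) simp
    also have "(\<integral>\<^sup>+x. ennreal ((S x)\<^sup>2) \<partial>lborel) = ennreal (LINT x|lborel. (S x)\<^sup>2)"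
      unfolding S_def by (intro nn_integral_eq_integral orthonormal_sum_square[OF on fin]) auto
    also have "(LINT x|lborel. (S x)\<^sup>2) = (\<Sum>k\<in>K. (\<theta> k * freq H k powr \<beta>)\<^sup>2)"
      unfolding S_def by (rule orthonormal_sum_square[OF on fin])
    also have "\<dots> = ?E"
      by (intro sum.cong refl) (simp add: power_mult_distrib power2_eq_square[of "_ powr _"] powr_add[symmetric])
    finally show ?thesis by (simp add: ennreal_mult[symmetric] sum_nonneg)
  qed
  finally have "fourier_energy \<beta> ?h \<le> ennreal (1 + \<eta>) * ennreal (2 * pi * ?E) + ennreal ((1 + 1 / \<eta>) * ((2 * c * (real N * \<Theta>))\<^sup>2 * mode_tail H))"
    by (simp add: add_left_mono add_right_mono mult_left_mono)
  also have "\<dots> = ennreal ((1 + \<eta>) * (2 * pi * ?E) + (1 + 1 / \<eta>) * ((2 * c * (real N * \<Theta>))\<^sup>2 * mode_tail H))"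
    using \<eta> mt0 by (intro ennreal_lincomb1 mult_nonneg_nonneg sum_nonneg) auto
  finally show ?thesis unfolding c_def .
qed

end

section \<open>The perturbed densities\<close>

context window
begin

definition mass :: real where "mass = (LINT x|lborel. q x)"

text \<open>The scale \<open>B\<close> spreads the density out: its energy decays like \<open>B powr (- 1 - 2 * \<beta>)\<close>, while it stays
constant on an interval of nearly the length of its support.\<close>

definition base_density :: "real \<Rightarrow> real \<Rightarrow> real" where
  "base_density B x = 1 / (B * mass) * q (x / B)"

lemma mass_bounds: "0 < mass" "mass \<le> 2"
proof -
  have "(LINT x|lborel. indicator {-(1 - e)..1 - e} x) \<le> mass"
    unfolding mass_def using q_range q_flat
    by (intro integral_mono integrable_indicator_Icc q_integrable) (auto simp: indicator_def abs_le_iff)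
  then show "0 < mass" using e by simp
  have "mass \<le> (LINT x|lborel. indicator {-1..1::real} x)"
    unfolding mass_def
  proof (intro integral_mono integrable_indicator_Icc q_integrable)
    fix x show "q x \<le> indicator {-1..1} x"
      using q_range[of x] q_support[of x] by (cases "\<bar>x\<bar> \<le> 1") (auto simp: indicator_def abs_le_iff)
  qed
  then show "mass \<le> 2" by simp
qed

lemma base_density_measurable [measurable]: "base_density B \<in> borel_measurable borel"
  unfolding base_density_def[abs_def] by measurable

lemma base_density_prob_density:
  assumes B: "B > 0" shows "prob_density (base_density B)"
proof -
  have int: "integrable lborel (\<lambda>x. q (x / B))"
    by (rule integrable_compact_support[where C=1 and R=B]) (use q_range q_support B in \<open>auto simp: abs_divide\<close>)
  have "(LINT x|lborel. q (x / B)) = \<bar>B\<bar> *\<^sub>R (LINT x|lborel. q ((0 + B * x) / B))"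
    using B by (intro lborel_integral_real_affine) auto
  also have "\<dots> = B * mass" using B by (simp add: mass_def)
  finally have "(LINT x|lborel. base_density B x) = 1"
    unfolding base_density_def[abs_def] integral_mult_right_zero using B mass_bounds by simp
  moreover have "integrable lborel (base_density B)"
    unfolding base_density_def[abs_def] by (intro L1_intros int)
  moreover have "0 \<le> base_density B x" for x
    unfolding base_density_def using B mass_bounds q_range[of "x / B"] by auto
  ultimately show ?thesis
    unfolding prob_density_def by auto
qed

lemma base_density_flat:
  assumes B: "B > 0" and x: "\<bar>x\<bar> \<le> (1 - e) * B"
  shows "base_density B x = 1 / (B * mass)" "1 \<le> 2 * B * base_density B x"
proof -
  have "\<bar>x / B\<bar> \<le> 1 - e" using x B by (simp add: abs_divide pos_divide_le_eq)
  then show 1: "base_density B x = 1 / (B * mass)" by (simp add: base_density_def q_flat)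
  show "1 \<le> 2 * B * base_density B x" unfolding 1 using B mass_bounds by simp
qed

lemma base_density_sq_integrable:
  assumes B: "B > 0" shows "integrable lborel (\<lambda>x. (base_density B x)\<^sup>2)"
proof (rule integrable_compact_support[where C="(1 / (B * mass))\<^sup>2" and R=B])
  show "\<bar>(base_density B x)\<^sup>2\<bar> \<le> (1 / (B * mass))\<^sup>2" for x
  proof -
    have "base_density B x \<le> 1 / (B * mass) * 1" "0 \<le> base_density B x"
      unfolding base_density_def using B mass_bounds q_range[of "x / B"] by (intro mult_left_mono, auto)
    then show ?thesis by (auto intro!: power_mono)
  qed
qed (use B q_support in \<open>auto simp: base_density_def abs_divide\<close>)

lemma q_fourier_energy_finite: "fourier_energy \<beta> q < \<infinity>"
proof -
  have "fourier_energy \<beta> q \<le> (\<integral>\<^sup>+\<omega>. ennreal ((1 + \<bar>\<omega>\<bar>) powr (2 * \<beta>) * (cmod (fourier q \<omega>))\<^sup>2) \<partial>lborel)"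
    unfolding fourier_energy_def using beta by (intro nn_integral_mono ennreal_leI mult_right_mono powr_mono2) auto
  then show ?thesis using q_energy by (rule le_less_trans)
qed

lemma base_density_energy:
  assumes B: "B > 0"
  shows "fourier_energy \<beta> (base_density B) = ennreal (B powr (- 1 - 2 * \<beta>) / mass\<^sup>2 * enn2real (fourier_energy \<beta> q))"
proof -
  have "fourier_energy \<beta> (base_density B) = ennreal ((1 / (B * mass))\<^sup>2) * (ennreal (B powr (1 - 2 * \<beta>)) * fourier_energy \<beta> q)"
    unfolding base_density_def[abs_def]
    by (subst fourier_energy_cmult, measurable) (simp add: fourier_energy_scaled[OF q_meas B])
  also have "fourier_energy \<beta> q = ennreal (enn2real (fourier_energy \<beta> q))"
    using q_fourier_energy_finite by (simp add: ennreal_enn2real_if)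
  also have "ennreal ((1 / (B * mass))\<^sup>2) * (ennreal (B powr (1 - 2 * \<beta>)) * ennreal (enn2real (fourier_energy \<beta> q))) =
      ennreal ((1 / (B * mass))\<^sup>2 * B powr (1 - 2 * \<beta>) * enn2real (fourier_energy \<beta> q))"
    by (simp add: ennreal_mult[symmetric] mult.assoc)
  also have "(1 / (B * mass))\<^sup>2 * B powr (1 - 2 * \<beta>) = B powr (- 1 - 2 * \<beta>) / mass\<^sup>2"
  proof -
    have "B powr (1 - 2 * \<beta>) = B powr (2 + (- 1 - 2 * \<beta>))" by simp
    also have "\<dots> = B\<^sup>2 * B powr (- 1 - 2 * \<beta>)" using B by (simp only: powr_add) (simp add: powr_numeral)
    finally show ?thesis using B by (simp add: power_mult_distrib power_divide)
  qed
  finally show ?thesis .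
qed

definition mode_mean :: "real \<Rightarrow> nat \<Rightarrow> real" where
  "mode_mean H k = (LINT x|lborel. windowed_mode q H k x)"

text \<open>A perturbation of a density must have integral zero. Subtracting a multiple of the base density achieves this and leaves
the coordinates with respect to the cosines unchanged, since the base density is constant on
\<open>[-H, H]\<close> and the cosines have mean zero there (\<open>base_density_orthogonal\<close>).\<close>

definition direction :: "real \<Rightarrow> nat \<Rightarrow> real \<Rightarrow> real" where
  "direction B k x = windowed_mode q ((1 - e) * B) k x - mode_mean ((1 - e) * B) k * base_density B x"

lemma direction_measurable [measurable]: "direction B k \<in> borel_measurable borel"
  unfolding direction_def[abs_def] by measurable

lemma windowed_mode_sq:
  assumes H: "H > 0" and k: "k \<ge> 1"
  shows "integrable lborel (\<lambda>x. (windowed_mode q H k x)\<^sup>2)" "(LINT x|lborel. (windowed_mode q H k x)\<^sup>2) \<le> 1"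
proof -
  have bd: "(windowed_mode q H k x)\<^sup>2 \<le> (cosine_mode H k x)\<^sup>2" for x
  proof -
    have "\<bar>windowed_mode q H k x\<bar> \<le> \<bar>cosine_mode H k x\<bar>"
      unfolding windowed_mode_def using q_range[of "x / H"] by (simp add: abs_mult mult_left_le_one_le)
    then show ?thesis by (simp add: abs_le_square_iff)
  qed
  note on = orthonormal_on_lineD[OF cosine_mode_orthonormal[OF H, of "{k}"], of k]
  have c: "integrable lborel (\<lambda>x. (cosine_mode H k x)\<^sup>2)" using on(2) k by simp
  show i: "integrable lborel (\<lambda>x. (windowed_mode q H k x)\<^sup>2)"
    by (rule Bochner_Integration.integrable_bound[OF c]) (use bd in auto)
  have "(LINT x|lborel. (windowed_mode q H k x)\<^sup>2) \<le> (LINT x|lborel. (cosine_mode H k x)\<^sup>2)"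
    using bd by (intro integral_mono i c) auto
  also have "\<dots> = 1" using on(4)[of k] k by (simp add: power2_eq_square)
  finally show "(LINT x|lborel. (windowed_mode q H k x)\<^sup>2) \<le> 1" .
qed

lemma mode_mean_bound:
  assumes H: "H > 0" shows "\<bar>mode_mean H k\<bar> \<le> 2 * sqrt H"
proof -
  have "\<bar>mode_mean H k\<bar> \<le> (LINT x|lborel. \<bar>windowed_mode q H k x\<bar>)"
    unfolding mode_mean_def by (rule integral_abs_bound)
  also have "\<dots> \<le> (LINT x|lborel. 1 / sqrt H * indicator {-H..H} x)"
  proof (intro integral_mono Bochner_Integration.integrable_mult_right integrable_indicator_Icc)
    show "integrable lborel (\<lambda>x. \<bar>windowed_mode q H k x\<bar>)" using windowed_mode_integrable[OF H, of k] by auto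
    show "\<bar>windowed_mode q H k x\<bar> \<le> 1 / sqrt H * indicator {-H..H} x" for x
      using windowed_mode_bound[OF H, of k x] windowed_mode_outside[of H x k]
      by (cases "\<bar>x\<bar> \<le> H") (auto simp: indicator_def abs_le_iff)
  qed
  also have "\<dots> = 2 * (H / sqrt H)" using H by simp
  also have "H / sqrt H = sqrt H" using H by (simp add: real_div_sqrt)
  finally show ?thesis .
qed

lemma direction_mean:
  assumes B: "B > 0" shows "integrable lborel (direction B k)" "(LINT x|lborel. direction B k x) = 0"
proof -
  have H: "(1 - e) * B > 0" using B e by simp
  note bd = base_density_prob_density[OF B, unfolded prob_density_def]
  have i1: "integrable lborel (windowed_mode q ((1 - e) * B) k)" by (rule windowed_mode_integrable[OF H])
  have i2: "integrable lborel (\<lambda>x. mode_mean ((1 - e) * B) k * base_density B x)" using bd by auto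
  show "integrable lborel (direction B k)" unfolding direction_def[abs_def] by (intro L1_intros i1 i2)
  show "(LINT x|lborel. direction B k x) = 0"
    unfolding direction_def Bochner_Integration.integral_diff[OF i1 i2] integral_mult_right_zero
    using bd by (simp add: mode_mean_def)
qed

lemma windowed_mode_le_base:
  assumes B: "B > 0"
  shows "\<bar>windowed_mode q ((1 - e) * B) k x\<bar> \<le> 2 * B / sqrt ((1 - e) * B) * base_density B x"
proof (cases "\<bar>x\<bar> \<le> (1 - e) * B")
  case True
  have H: "(1 - e) * B > 0" using B e by simp
  have "\<bar>windowed_mode q ((1 - e) * B) k x\<bar> \<le> 1 / sqrt ((1 - e) * B) * 1" using windowed_mode_bound[OF H] by simp
  also have "\<dots> \<le> 1 / sqrt ((1 - e) * B) * (2 * B * base_density B x)"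
    using H by (intro mult_left_mono base_density_flat(2)[OF B True]) auto
  finally show ?thesis by simp
next
  case False
  have "0 \<le> base_density B x" using base_density_prob_density[OF B] by (simp add: prob_density_def)
  then show ?thesis using False B e by (simp add: windowed_mode_outside)
qed

text \<open>A bound for the direction relative to the base density: the first summand comes from the windowed cosine,
which is bounded by \<open>1 / sqrt H\<close> where the base density is at least \<open>1 / (2 B)\<close>, the second from its mean.\<close>

definition relative_size :: "real \<Rightarrow> real" where
  "relative_size B = 2 * B / sqrt ((1 - e) * B) + 2 * sqrt ((1 - e) * B)"

lemma relative_size_nonneg: "B > 0 \<Longrightarrow> relative_size B \<ge> 0"
  unfolding relative_size_def using e by (intro add_nonneg_nonneg) auto

lemma direction_le_base:
  assumes B: "B > 0"
  shows "\<bar>direction B k x\<bar> \<le> relative_size B * base_density B x"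
proof -
  have H: "(1 - e) * B > 0" using B e by simp
  have f0: "0 \<le> base_density B x" using base_density_prob_density[OF B] by (simp add: prob_density_def)
  have "\<bar>direction B k x\<bar> \<le> \<bar>windowed_mode q ((1 - e) * B) k x\<bar> + \<bar>mode_mean ((1 - e) * B) k\<bar> * base_density B x"
    unfolding direction_def using f0 by (metis abs_mult abs_of_nonneg abs_triangle_ineq4)
  also have "\<dots> \<le> 2 * B / sqrt ((1 - e) * B) * base_density B x + 2 * sqrt ((1 - e) * B) * base_density B x"
    by (intro add_mono windowed_mode_le_base[OF B] mult_right_mono mode_mean_bound[OF H] f0)
  finally show ?thesis by (simp add: relative_size_def distrib_right)
qed

lemma direction_sq_integrable:
  assumes B: "B > 0" shows "integrable lborel (\<lambda>x. (direction B k x)\<^sup>2)"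
proof (rule Bochner_Integration.integrable_bound)
  show "integrable lborel (\<lambda>x. (relative_size B)\<^sup>2 * (base_density B x)\<^sup>2)"
    by (intro L1_intros base_density_sq_integrable[OF B])
  show "AE x in lborel. norm ((direction B k x)\<^sup>2) \<le> norm ((relative_size B)\<^sup>2 * (base_density B x)\<^sup>2)"
    using power_mono[OF direction_le_base[OF B], of _ _ 2] by (intro AE_I2) (simp add: power_mult_distrib)
qed measurable

text \<open>Expanding the square, the cross term and the last term combine to \<open>- m\<^sup>2\<close>, so recentring only lowers the
information.\<close>

lemma direction_info:
  assumes B: "B > 0" and k: "k \<ge> 1"
  shows "(LINT x|lborel. (direction B k x)\<^sup>2 / base_density B x) \<le> 2 * B"
proof -
  define H where "H = (1 - e) * B"
  have H: "H > 0" using B e by (simp add: H_def)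
  define m where "m = mode_mean H k"
  have f0: "0 \<le> base_density B x" and f0_int: "integrable lborel (base_density B)" and f01: "(LINT x|lborel. base_density B x) = 1" for x
    using base_density_prob_density[OF B] by (auto simp: prob_density_def)
  have pw: "(direction B k x)\<^sup>2 / base_density B x \<le> 2 * B * (windowed_mode q H k x)\<^sup>2 - 2 * m * windowed_mode q H k x + m\<^sup>2 * base_density B x" for x
  proof (cases "base_density B x = 0")
    case True
    then have "windowed_mode q H k x = 0" using windowed_mode_le_base[OF B, of k x] by (simp add: H_def)
    then show ?thesis using True by simp
  next
    case False
    then have pos: "base_density B x > 0" using f0[of x] by simp
    have "(direction B k x)\<^sup>2 / base_density B x = (windowed_mode q H k x)\<^sup>2 / base_density B x - 2 * m * windowed_mode q H k x + m\<^sup>2 * base_density B x"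
      using pos unfolding direction_def H_def[symmetric] m_def[symmetric] by (simp add: power2_diff field_simps power2_eq_square)
    also have "(windowed_mode q H k x)\<^sup>2 / base_density B x \<le> 2 * B * (windowed_mode q H k x)\<^sup>2"
    proof (cases "\<bar>x\<bar> \<le> H")
      case True
      then have "1 \<le> 2 * B * base_density B x" using base_density_flat(2)[OF B, of x] by (simp add: H_def)
      from mult_right_mono[OF this, of "(windowed_mode q H k x)\<^sup>2"] show ?thesis
        using pos by (simp add: pos_divide_le_eq mult_ac)
    qed (simp add: windowed_mode_outside)
    finally show ?thesis by simp
  qed
  have i1: "integrable lborel (\<lambda>x. 2 * B * (windowed_mode q H k x)\<^sup>2)" by (intro L1_intros windowed_mode_sq[OF H k])
  have i2: "integrable lborel (\<lambda>x. 2 * m * windowed_mode q H k x)" by (intro L1_intros windowed_mode_integrable[OF H])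
  have i3: "integrable lborel (\<lambda>x. m\<^sup>2 * base_density B x)" by (intro L1_intros f0_int)
  have "(LINT x|lborel. (direction B k x)\<^sup>2 / base_density B x) \<le> (LINT x|lborel. 2 * B * (windowed_mode q H k x)\<^sup>2 - 2 * m * windowed_mode q H k x + m\<^sup>2 * base_density B x)"
  proof (rule integral_mono_AE')
    show "integrable lborel (\<lambda>x. 2 * B * (windowed_mode q H k x)\<^sup>2 - 2 * m * windowed_mode q H k x + m\<^sup>2 * base_density B x)"
      by (intro L1_intros i1 i2 i3)
    show "AE x in lborel. (direction B k x)\<^sup>2 / base_density B x \<le> 2 * B * (windowed_mode q H k x)\<^sup>2 - 2 * m * windowed_mode q H k x + m\<^sup>2 * base_density B x"
      using pw by (intro AE_I2)
    have "0 \<le> 2 * B * (windowed_mode q H k x)\<^sup>2 - 2 * m * windowed_mode q H k x + m\<^sup>2 * base_density B x" for x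
      by (rule order_trans[OF _ pw[of x]]) (simp add: f0)
    then show "AE x in lborel. 0 \<le> 2 * B * (windowed_mode q H k x)\<^sup>2 - 2 * m * windowed_mode q H k x + m\<^sup>2 * base_density B x"
      by (intro AE_I2)
  qed
  also have "\<dots> = 2 * B * (LINT x|lborel. (windowed_mode q H k x)\<^sup>2) - 2 * m * m + m\<^sup>2 * 1"
    unfolding Bochner_Integration.integral_add[OF Bochner_Integration.integrable_diff[OF i1 i2] i3] Bochner_Integration.integral_diff[OF i1 i2] integral_mult_right_zero f01
    by (simp add: m_def mode_mean_def)
  also have "\<dots> \<le> 2 * B * (LINT x|lborel. (windowed_mode q H k x)\<^sup>2)" by (simp add: power2_eq_square)
  also have "\<dots> \<le> 2 * B * 1" using B by (intro mult_left_mono windowed_mode_sq[OF H k]) auto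
  finally show ?thesis by simp
qed

lemma base_density_orthogonal:
  assumes B: "B > 0" and k: "k \<ge> 1"
  shows "(LINT x|lborel. base_density B x * cosine_mode ((1 - e) * B) k x) = 0"
proof -
  have H: "(1 - e) * B > 0" using B e by simp
  have "base_density B x * cosine_mode ((1 - e) * B) k x = 1 / (B * mass) * cosine_mode ((1 - e) * B) k x" for x
    using base_density_flat(1)[OF B, of x] by (cases "\<bar>x\<bar> \<le> (1 - e) * B") (simp_all add: cosine_mode_outside)
  then show ?thesis using cosine_mode_mean[OF H k] by simp
qed

lemma inner_direction:
  assumes B: "B > 0" and k: "k \<ge> 1"
  shows "(LINT x|lborel. direction B l x * cosine_mode ((1 - e) * B) k x) = (LINT x|lborel. windowed_mode q ((1 - e) * B) l x * cosine_mode ((1 - e) * B) k x)"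
    "integrable lborel (\<lambda>x. windowed_mode q ((1 - e) * B) l x * cosine_mode ((1 - e) * B) k x)"
proof -
  define H where "H = (1 - e) * B"
  have H: "H > 0" using B e by (simp add: H_def)
  note on = orthonormal_on_lineD[OF cosine_mode_orthonormal[OF H, of "{k}"], of k]
  have c: "integrable lborel (\<lambda>x. (cosine_mode H k x)\<^sup>2)" using on(2) k by simp
  have wsq: "integrable lborel (\<lambda>x. (windowed_mode q H l x)\<^sup>2)"
  proof (rule integrable_compact_support[where R=H and C="(1 / sqrt H)\<^sup>2"])
    show "\<bar>(windowed_mode q H l x)\<^sup>2\<bar> \<le> (1 / sqrt H)\<^sup>2" for x
      using power_mono[OF windowed_mode_bound[OF H, of l x], of 2] by simp
  qed (auto simp: windowed_mode_outside)
  have i1: "integrable lborel (\<lambda>x. windowed_mode q H l x * cosine_mode H k x)"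
    by (intro L2_mult_integrable wsq c) auto
  have i2: "integrable lborel (\<lambda>x. mode_mean H l * (base_density B x * cosine_mode H k x))"
    by (intro L1_intros L2_mult_integrable base_density_sq_integrable[OF B] c) auto
  show "integrable lborel (\<lambda>x. windowed_mode q ((1 - e) * B) l x * cosine_mode ((1 - e) * B) k x)"
    using i1 by (simp add: H_def)
  have "(LINT x|lborel. direction B l x * cosine_mode H k x) = (LINT x|lborel. windowed_mode q H l x * cosine_mode H k x - mode_mean H l * (base_density B x * cosine_mode H k x))"
    by (intro Bochner_Integration.integral_cong refl) (simp add: direction_def H_def algebra_simps)
  also have "\<dots> = (LINT x|lborel. windowed_mode q H l x * cosine_mode H k x)"
    unfolding Bochner_Integration.integral_diff[OF i1 i2] integral_mult_right_zero
    using base_density_orthogonal[OF B k] by (simp add: H_def)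
  finally show "(LINT x|lborel. direction B l x * cosine_mode ((1 - e) * B) k x) = (LINT x|lborel. windowed_mode q ((1 - e) * B) l x * cosine_mode ((1 - e) * B) k x)"
    by (simp add: H_def)
qed

text \<open>The window differs from 1 only on a set of length \<open>2 e H\<close> in \<open>[-H, H]\<close>, where the squared cosine is at
most \<open>1 / H\<close>.\<close>

lemma direction_slope:
  assumes B: "B > 0" and k: "k \<ge> 1"
  shows "1 - 2 * e \<le> (LINT x|lborel. direction B k x * cosine_mode ((1 - e) * B) k x)"
proof -
  define H where "H = (1 - e) * B"
  have H: "H > 0" using B e by (simp add: H_def)
  note on = orthonormal_on_lineD[OF cosine_mode_orthonormal[OF H, of "{k}"], of k]
  have c: "integrable lborel (\<lambda>x. (cosine_mode H k x)\<^sup>2)" using on(2) k by simp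
  have c1: "(LINT x|lborel. (cosine_mode H k x)\<^sup>2) = 1" using on(4)[of k] k by (simp add: power2_eq_square)
  define r where "r = (1 - e) * H"
  have r: "0 \<le> r" "r \<le> H" using H e by (auto simp: r_def mult_left_le_one_le)
  have cut: "integrable lborel (\<lambda>x. 1 / H * (indicator {-H..H} x - indicator {-r..r} x :: real))"
    by (intro L1_intros integrable_indicator_Icc)
  have pw: "(cosine_mode H k x)\<^sup>2 - 1 / H * (indicator {-H..H} x - indicator {-r..r} x) \<le> windowed_mode q H k x * cosine_mode H k x" for x
  proof -
    have sq: "(cosine_mode H k x)\<^sup>2 \<le> 1 / H"
      using power_mono[OF cosine_mode_bound[OF H, of k x], of 2] H by (simp add: power_divide)
    have eq: "windowed_mode q H k x * cosine_mode H k x = q (x / H) * (cosine_mode H k x)\<^sup>2"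
      by (simp add: windowed_mode_def power2_eq_square)
    consider "\<bar>x\<bar> \<le> r" | "r < \<bar>x\<bar>" "\<bar>x\<bar> \<le> H" | "H < \<bar>x\<bar>" by linarith
    then show ?thesis
    proof cases
      case 1
      then have "q (x / H) = 1" using H by (intro q_flat) (simp add: abs_divide pos_divide_le_eq r_def)
      then show ?thesis unfolding eq using 1 r by (simp add: indicator_def abs_le_iff)
    next
      case 2
      have "0 \<le> q (x / H) * (cosine_mode H k x)\<^sup>2" using q_range by simp
      then show ?thesis unfolding eq using 2 sq by (auto simp: indicator_def abs_le_iff)
    next
      case 3
      then show ?thesis using r by (auto simp: cosine_mode_outside indicator_def)
    qed
  qed
  have "1 - 2 * e = 1 - 1 / H * ((LINT x|lborel. indicator {-H..H} x) - (LINT x|lborel. indicator {-r..r} x))"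
    using H r by (simp add: r_def field_simps)
  also have "\<dots> = (LINT x|lborel. (cosine_mode H k x)\<^sup>2 - 1 / H * (indicator {-H..H} x - indicator {-r..r} x))"
    unfolding Bochner_Integration.integral_diff[OF c cut] c1 integral_mult_right_zero
    by (subst Bochner_Integration.integral_diff[OF integrable_indicator_Icc integrable_indicator_Icc]) simp
  also have "\<dots> \<le> (LINT x|lborel. windowed_mode q H k x * cosine_mode H k x)"
    using pw inner_direction(2)[OF B k, of k] by (intro integral_mono Bochner_Integration.integrable_diff c cut) (auto simp: H_def)
  also have "\<dots> = (LINT x|lborel. direction B k x * cosine_mode H k x)"
    using inner_direction(1)[OF B k, of k] by (simp add: H_def)
  finally show ?thesis by (simp add: H_def)
qed

text \<open>The coordinates of the perturbation are those of a windowed cosine sum, and the window does not increase the norm.\<close>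

lemma direction_coordinates:
  assumes B: "B > 0" and fin: "finite K" and K: "\<And>k. k \<in> K \<Longrightarrow> k \<ge> 1"
  shows "(\<Sum>k\<in>K. (\<Sum>l\<in>K. c l * (LINT x|lborel. direction B l x * cosine_mode ((1 - e) * B) k x))\<^sup>2) \<le> (\<Sum>k\<in>K. (c k)\<^sup>2)"
proof -
  define H where "H = (1 - e) * B"
  have H: "H > 0" using B e by (simp add: H_def)
  have on: "orthonormal_on_line K (cosine_mode H)" by (rule cosine_mode_orthonormal[OF H K])
  define h where "h = (\<lambda>x. \<Sum>l\<in>K. c l * windowed_mode q H l x)"
  have [measurable]: "h \<in> borel_measurable borel" unfolding h_def by measurable
  have h_eq: "h x = q (x / H) * (\<Sum>l\<in>K. c l * cosine_mode H l x)" for x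
    by (simp add: h_def windowed_mode_def sum_distrib_left mult_ac)
  have h_le: "(h x)\<^sup>2 \<le> (\<Sum>l\<in>K. c l * cosine_mode H l x)\<^sup>2" for x
  proof -
    have "\<bar>h x\<bar> \<le> \<bar>\<Sum>l\<in>K. c l * cosine_mode H l x\<bar>"
      unfolding h_eq using q_range[of "x / H"] by (simp add: abs_mult mult_left_le_one_le)
    then show ?thesis by (simp add: abs_le_square_iff)
  qed
  note os = orthonormal_sum_square[OF on fin, of c]
  have hi: "integrable lborel (\<lambda>x. (h x)\<^sup>2)"
    by (rule Bochner_Integration.integrable_bound[OF os(1)]) (use h_le in auto)
  have "(\<Sum>l\<in>K. c l * (LINT x|lborel. direction B l x * cosine_mode H k x)) = (LINT x|lborel. h x * cosine_mode H k x)" if k: "k \<in> K" for k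
  proof -
    have "(LINT x|lborel. h x * cosine_mode H k x) = (LINT x|lborel. (\<Sum>l\<in>K. c l * (windowed_mode q H l x * cosine_mode H k x)))"
      unfolding h_def by (simp add: sum_distrib_right mult.assoc)
    also have "\<dots> = (\<Sum>l\<in>K. LINT x|lborel. c l * (windowed_mode q H l x * cosine_mode H k x))"
      using inner_direction(2)[OF B K[OF k]] by (intro Bochner_Integration.integral_sum L1_intros) (simp add: H_def)
    finally show ?thesis using inner_direction(1)[OF B K[OF k]] by (simp add: H_def)
  qed
  then have "(\<Sum>k\<in>K. (\<Sum>l\<in>K. c l * (LINT x|lborel. direction B l x * cosine_mode H k x))\<^sup>2) = (\<Sum>k\<in>K. (LINT x|lborel. h x * cosine_mode H k x)\<^sup>2)" by simp
  also have "\<dots> \<le> (LINT x|lborel. (h x)\<^sup>2)" by (rule bessel_inequality[OF on fin _ hi]) measurable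
  also have "\<dots> \<le> (LINT x|lborel. (\<Sum>l\<in>K. c l * cosine_mode H l x)\<^sup>2)" by (intro integral_mono hi os(1) h_le)
  also have "\<dots> = (\<Sum>k\<in>K. (c k)\<^sup>2)" by (rule os(2))
  finally show ?thesis by (simp add: H_def)
qed

text \<open>Recentring only changes the factor of the base density to \<open>1 - M\<close> with a number \<open>M\<close> of absolute value at most 1.\<close>

lemma perturbed_energy_le:
  fixes c :: "nat \<Rightarrow> real"
  assumes B: "B > 0" and H: "(1 - e) * B \<ge> 1" and K: "K \<subseteq> {1..N}"
    and c: "\<And>k. k \<in> K \<Longrightarrow> \<bar>c k\<bar> \<le> \<Theta>" and small: "real N * \<Theta> * (2 * sqrt ((1 - e) * B)) \<le> 1" and \<Theta>: "\<Theta> \<ge> 0" and \<eta>: "\<eta> > 0"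
    and b: "b \<ge> 1" "freq ((1 - e) * B) N \<le> b"
  shows "fourier_energy \<beta> (\<lambda>x. base_density B x + (\<Sum>k\<in>K. c k * direction B k x)) \<le>
    ennreal ((1 + \<eta>) * ((1 + \<eta>) * (2 * pi * (\<Sum>k\<in>K. freq ((1 - e) * B) k powr (2 * \<beta>) * (c k)\<^sup>2)) +
       (1 + 1 / \<eta>) * ((2 * ((\<beta> + 1) * 2 powr \<beta> * b powr (\<beta> - min 1 \<beta>)) * (real N * \<Theta>))\<^sup>2 * mode_tail ((1 - e) * B))) +
     (1 + 1 / \<eta>) * (4 * (B powr (- 1 - 2 * \<beta>) / mass\<^sup>2 * enn2real (fourier_energy \<beta> q))))"
proof -
  define H where "H = (1 - e) * B"
  have H0: "H > 0" and H1: "H \<ge> 1" using assms(2) by (auto simp: H_def)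
  have fin: "finite K" using K finite_subset by blast
  define M where "M = (\<Sum>k\<in>K. c k * mode_mean H k)"
  define h where "h = (\<lambda>x. \<Sum>k\<in>K. c k * windowed_mode q H k x)"
  have f0i: "integrable lborel (base_density B)" using base_density_prob_density[OF B] by (simp add: prob_density_def)
  have hi: "integrable lborel h"
    unfolding h_def by (intro L1_intros windowed_mode_integrable[OF H0])
  have split: "(\<lambda>x. base_density B x + (\<Sum>k\<in>K. c k * direction B k x)) = (\<lambda>x. h x + (1 - M) * base_density B x)"
    unfolding h_def M_def direction_def H_def[symmetric] by (simp add: fun_eq_iff algebra_simps sum_subtractf sum_distrib_left)
  have "\<bar>M\<bar> \<le> (\<Sum>k\<in>K. \<bar>c k * mode_mean H k\<bar>)" unfolding M_def by (rule sum_abs)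
  also have "\<dots> \<le> (\<Sum>k\<in>K. \<Theta> * (2 * sqrt H))"
    unfolding abs_mult using c mode_mean_bound[OF H0] \<Theta> by (intro sum_mono mult_mono) auto
  also have "\<dots> = real (card K) * (\<Theta> * (2 * sqrt H))" by simp
  also have "\<dots> \<le> real N * (\<Theta> * (2 * sqrt H))"
    using card_mono[OF _ K] \<Theta> H0 by (intro mult_right_mono) auto
  also have "\<dots> \<le> 1" using small by (simp add: H_def mult_ac)
  finally have "\<bar>1 - M\<bar> \<le> 2" by linarith
  then have M2: "(1 - M)\<^sup>2 \<le> 4" using power_mono[of "\<bar>1 - M\<bar>" 2 2] by simp
  define E0 where "E0 = B powr (- 1 - 2 * \<beta>) / mass\<^sup>2 * enn2real (fourier_energy \<beta> q)"
  have E0: "E0 \<ge> 0" by (simp add: E0_def)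
  define R where "R = (1 + \<eta>) * (2 * pi * (\<Sum>k\<in>K. freq H k powr (2 * \<beta>) * (c k)\<^sup>2)) + (1 + 1 / \<eta>) * ((2 * ((\<beta> + 1) * 2 powr \<beta> * b powr (\<beta> - min 1 \<beta>)) * (real N * \<Theta>))\<^sup>2 * mode_tail H)"
  have R: "R \<ge> 0" unfolding R_def using \<eta> by (intro add_nonneg_nonneg mult_nonneg_nonneg sum_nonneg) (auto simp: mode_tail_def)
  have "fourier_energy \<beta> (\<lambda>x. base_density B x + (\<Sum>k\<in>K. c k * direction B k x)) \<le> ennreal (1 + \<eta>) * fourier_energy \<beta> h + ennreal (1 + 1 / \<eta>) * fourier_energy \<beta> (\<lambda>x. (1 - M) * base_density B x)"
    unfolding split using f0i by (intro fourier_energy_add_le[OF hi _ \<eta>]) auto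
  also have "fourier_energy \<beta> h \<le> ennreal R"
    unfolding h_def R_def using b by (intro perturbation_energy[OF H1 K c \<eta>]) (auto simp: H_def)
  also have "fourier_energy \<beta> (\<lambda>x. (1 - M) * base_density B x) = ennreal ((1 - M)\<^sup>2) * ennreal E0"
    by (simp add: fourier_energy_cmult base_density_energy[OF B] E0_def)
  also have "\<dots> \<le> ennreal (4 * E0)"
    using M2 E0 by (simp add: ennreal_mult[symmetric] ennreal_leI mult_right_mono)
  finally have "fourier_energy \<beta> (\<lambda>x. base_density B x + (\<Sum>k\<in>K. c k * direction B k x)) \<le> ennreal (1 + \<eta>) * ennreal R + ennreal (1 + 1 / \<eta>) * ennreal (4 * E0)"
    by (simp add: add_mono mult_left_mono del: ennreal_plus)
  also have "\<dots> = ennreal ((1 + \<eta>) * R + (1 + 1 / \<eta>) * (4 * E0))"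
    using \<eta> R E0 by (intro ennreal_lincomb) auto
  finally show ?thesis unfolding R_def E0_def H_def .
qed

text \<open>The set \<open>G\<close> of parameters with energy below its mean plus \<open>t\<close> satisfies the budget \<open>L\<close> and thus
parametrises members of the class; Hoeffding's inequality bounds the prior probability of its complement.\<close>

lemma family_lower_bound:
  fixes \<tau> :: "nat \<Rightarrow> real"
  assumes B: "B > 0" and H: "(1 - e) * B \<ge> 1" and e4: "e \<le> 1/4"
    and K: "K \<subseteq> {1..N}"
    and \<tau>: "\<And>k. k \<in> K \<Longrightarrow> 0 \<le> \<tau> k \<and> \<tau> k \<le> \<Theta>" and \<Theta>: "\<Theta> \<ge> 0"
    and small: "real N * \<Theta> * relative_size B \<le> e" and small': "real N * \<Theta> * (2 * sqrt ((1 - e) * B)) \<le> 1"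
    and \<eta>: "\<eta> > 0" and b: "b \<ge> 1" "freq ((1 - e) * B) N \<le> b" and t: "t \<ge> 0"
  defines "w \<equiv> \<lambda>k. freq ((1 - e) * B) k powr (2 * \<beta>) * (\<tau> k)\<^sup>2"
  assumes nontriv: "(\<Sum>k\<in>K. (w k)\<^sup>2) > 0"
    and budget: "(1 + \<eta>) * ((1 + \<eta>) * (2 * pi * ((\<Sum>k\<in>K. w k) / (2 * real q' + 7) + t)) +
       (1 + 1 / \<eta>) * ((2 * ((\<beta> + 1) * 2 powr \<beta> * b powr (\<beta> - min 1 \<beta>)) * (real N * \<Theta>))\<^sup>2 * mode_tail ((1 - e) * B))) +
     (1 + 1 / \<eta>) * (4 * (B powr (- 1 - 2 * \<beta>) / mass\<^sup>2 * enn2real (fourier_energy \<beta> q))) \<le> 2 * pi * L"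
    and T: "T \<in> estimators n"
  shows "ennreal (\<Sum>k\<in>K. ((1 - 2 * e) * \<tau> k)\<^sup>2 / (real n * ((\<tau> k)\<^sup>2 * (2 * B) / (1 - e)) + prior_info q')) \<le>
    (SUP f\<in>sobolev_class \<beta> L. risk n T f) + ennreal (9 * (\<Sum>k\<in>K. (\<tau> k)\<^sup>2) * exp (- 2 * t\<^sup>2 / (\<Sum>k\<in>K. (w k)\<^sup>2)))"
proof -
  have H0: "(1 - e) * B > 0" using H by simp
  have fin: "finite K" using K finite_subset by blast
  have K1: "k \<ge> 1" if "k \<in> K" for k using K that by auto
  define \<mu> where "\<mu> = PiM K (\<lambda>_. bump_prior (q' + 2))"
  interpret \<mu>: prob_space \<mu> unfolding \<mu>_def by (intro prob_space_PiM prob_space_bump_prior)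
  have s\<mu>: "sets \<mu> = sets (PiM K (\<lambda>_. borel))" unfolding \<mu>_def by (intro sets_PiM_cong) auto
  have sp\<mu>: "space \<mu> = space (PiM K (\<lambda>_. borel :: real measure))" by (rule sets_eq_imp_space_eq[OF s\<mu>])
  define L1 where "L1 = (\<Sum>k\<in>K. w k) / (2 * real q' + 7) + t"
  define G where "G = {u \<in> space (PiM K (\<lambda>_. borel :: real measure)). (\<Sum>k\<in>K. w k * (u k)\<^sup>2) < L1}"
  have Gm: "G \<in> sets (PiM K (\<lambda>_. borel))" unfolding G_def by measurable
  have f0: "prob_density (base_density B)" by (rule base_density_prob_density[OF B])
  have f0_nonneg: "0 \<le> base_density B x" for x using f0 by (simp add: prob_density_def)
  have w0: "w k \<ge> 0" for k by (simp add: w_def)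
  have small_sum: "(\<Sum>k\<in>K. \<bar>\<tau> k * direction B k x\<bar>) \<le> e * base_density B x" for x
  proof -
    have "(\<Sum>k\<in>K. \<bar>\<tau> k * direction B k x\<bar>) \<le> (\<Sum>k\<in>K. \<Theta> * (relative_size B * base_density B x))"
      unfolding abs_mult using \<tau> \<Theta> direction_le_base[OF B] by (intro sum_mono mult_mono) auto
    also have "\<dots> = real (card K) * (\<Theta> * (relative_size B * base_density B x))" by simp
    also have "\<dots> \<le> real N * (\<Theta> * (relative_size B * base_density B x))"
      using card_mono[OF _ K] \<Theta> relative_size_nonneg[OF B] f0_nonneg by (intro mult_right_mono mult_nonneg_nonneg) auto
    also have "\<dots> = (real N * \<Theta> * relative_size B) * base_density B x" by (simp add: mult_ac)
    also have "\<dots> \<le> e * base_density B x" by (intro mult_right_mono small f0_nonneg)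
    finally show ?thesis .
  qed
  have good: "(\<lambda>x. base_density B x + (\<Sum>k\<in>K. u k * (\<tau> k * direction B k x))) \<in> sobolev_class \<beta> L"
    if u: "u \<in> G" and cube: "\<And>k. k \<in> K \<Longrightarrow> \<bar>u k\<bar> \<le> 1" for u
  proof -
    define f where "f = (\<lambda>x. base_density B x + (\<Sum>k\<in>K. (u k * \<tau> k) * direction B k x))"
    have [measurable]: "f \<in> borel_measurable borel" unfolding f_def by measurable
    have pert: "\<bar>\<Sum>k\<in>K. (u k * \<tau> k) * direction B k x\<bar> \<le> e * base_density B x" for x
    proof -
      have "\<bar>\<Sum>k\<in>K. (u k * \<tau> k) * direction B k x\<bar> \<le> (\<Sum>k\<in>K. \<bar>(u k * \<tau> k) * direction B k x\<bar>)" by (rule sum_abs)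
      also have "\<dots> \<le> (\<Sum>k\<in>K. \<bar>\<tau> k * direction B k x\<bar>)"
        using cube by (intro sum_mono) (simp add: abs_mult mult.assoc mult_left_le_one_le)
      finally show ?thesis using small_sum[of x] by linarith
    qed
    have f_bd: "0 \<le> f x \<and> f x \<le> 2 * base_density B x" for x
    proof -
      have "e * base_density B x \<le> 1 * base_density B x" using e f0_nonneg by (intro mult_right_mono) auto
      with pert[of x] show ?thesis unfolding f_def by linarith
    qed
    have di: "integrable lborel (\<lambda>x. \<Sum>k\<in>K. (u k * \<tau> k) * direction B k x)"
      by (intro L1_intros direction_mean[OF B])
    have "(LINT x|lborel. (\<Sum>k\<in>K. (u k * \<tau> k) * direction B k x)) = (\<Sum>k\<in>K. LINT x|lborel. (u k * \<tau> k) * direction B k x)"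
      by (intro Bochner_Integration.integral_sum L1_intros direction_mean[OF B])
    also have "\<dots> = 0" by (simp add: direction_mean[OF B])
    finally have "(LINT x|lborel. f x) = 1"
      unfolding f_def using di f0 by (simp add: prob_density_def)
    then have pd: "prob_density f"
      unfolding prob_density_def using f_bd di f0 by (auto simp: f_def prob_density_def)
    have sq: "integrable lborel (\<lambda>x. (f x)\<^sup>2)"
    proof (rule Bochner_Integration.integrable_bound)
      show "integrable lborel (\<lambda>x. 4 * (base_density B x)\<^sup>2)"
        by (intro L1_intros base_density_sq_integrable[OF B])
      show "AE x in lborel. norm ((f x)\<^sup>2) \<le> norm (4 * (base_density B x)\<^sup>2)"
      proof (rule AE_I2)
        fix x show "norm ((f x)\<^sup>2) \<le> norm (4 * (base_density B x)\<^sup>2)"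
          using power_mono[of "f x" "2 * base_density B x" 2] f_bd[of x] by (simp add: power_mult_distrib)
      qed
    qed measurable
    have cl: "\<bar>u k * \<tau> k\<bar> \<le> \<Theta>" if "k \<in> K" for k
    proof -
      have "\<bar>u k\<bar> * \<bar>\<tau> k\<bar> \<le> 1 * \<Theta>" using cube[OF that] \<tau>[OF that] by (intro mult_mono) auto
      then show ?thesis by (simp add: abs_mult)
    qed
    have "(\<Sum>k\<in>K. freq ((1 - e) * B) k powr (2 * \<beta>) * (u k * \<tau> k)\<^sup>2) = (\<Sum>k\<in>K. w k * (u k)\<^sup>2)"
      by (intro sum.cong refl) (simp add: w_def power_mult_distrib mult_ac)
    also have "\<dots> \<le> L1" using u by (simp add: G_def)
    finally have Q: "(\<Sum>k\<in>K. freq ((1 - e) * B) k powr (2 * \<beta>) * (u k * \<tau> k)\<^sup>2) \<le> L1" .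
    have "fourier_energy \<beta> f \<le> ennreal (2 * pi * L)"
      unfolding f_def
      apply (rule order_trans[OF perturbed_energy_le[OF B H K cl small' \<Theta> \<eta> b]])
       apply assumption
      apply (rule ennreal_leI)
      apply (rule order_trans[OF _ budget])
      using Q \<eta> unfolding L1_def[symmetric]
      by (intro add_mono mult_left_mono order_refl) auto
    then have "ennreal (1 / (2 * pi)) * fourier_energy \<beta> f \<le> ennreal (1 / (2 * pi)) * ennreal (2 * pi * L)"
      by (intro mult_left_mono) auto
    also have "\<dots> = ennreal L" by (subst ennreal_mult'[symmetric]) auto
    finally have "f \<in> sobolev_class \<beta> L"
      using pd sq by (simp add: sobolev_class_def fourier_energy_def)
    then show ?thesis by (simp add: f_def mult.assoc)
  qed
  have eb: "0 \<le> e" "e \<le> 1/4" using e e4 by auto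
  have "ennreal (\<Sum>k\<in>K. ((1 - 2 * e) * \<tau> k)\<^sup>2 / (real n * ((\<tau> k)\<^sup>2 * (2 * B) / (1 - e)) + prior_info q')) \<le>
    (SUP f\<in>sobolev_class \<beta> L. risk n T f) + ennreal (9 * (\<Sum>k\<in>K. (\<tau> k)\<^sup>2)) * emeasure \<mu> (space \<mu> - G)"
    unfolding \<mu>_def
  proof (rule bayes_risk_lower_bound[OF fin f0, where e="cosine_mode ((1 - e) * B)" and b="\<lambda>k x. \<tau> k * direction B k x" and \<epsilon>=e])
    fix k assume k: "k \<in> K"
    show "(\<lambda>x. \<tau> k * direction B k x) \<in> borel_measurable borel" by measurable
    show "integrable lborel (\<lambda>x. (\<tau> k * direction B k x)\<^sup>2)"
      unfolding power_mult_distrib by (intro L1_intros direction_sq_integrable[OF B])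
    show "(LINT x|lborel. \<tau> k * direction B k x) = 0" by (simp add: direction_mean[OF B])
    have "(LINT x|lborel. (\<tau> k * direction B k x)\<^sup>2 / base_density B x) = (\<tau> k)\<^sup>2 * (LINT x|lborel. (direction B k x)\<^sup>2 / base_density B x)"
      by (simp only: power_mult_distrib times_divide_eq_right[symmetric] integral_mult_right_zero)
    also have "\<dots> \<le> (\<tau> k)\<^sup>2 * (2 * B)" by (intro mult_left_mono direction_info[OF B K1[OF k]]) simp
    finally show "(LINT x|lborel. (\<tau> k * direction B k x)\<^sup>2 / base_density B x) \<le> (\<tau> k)\<^sup>2 * (2 * B)" .
    show "0 \<le> (\<tau> k)\<^sup>2 * (2 * B)" using B by simp
    have "(LINT x|lborel. \<tau> k * direction B k x * cosine_mode ((1 - e) * B) k x) = \<tau> k * (LINT x|lborel. direction B k x * cosine_mode ((1 - e) * B) k x)"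
      by (simp only: mult.assoc integral_mult_right_zero)
    then show "0 \<le> (1 - 2 * e) * \<tau> k \<and> (1 - 2 * e) * \<tau> k \<le> (LINT x|lborel. \<tau> k * direction B k x * cosine_mode ((1 - e) * B) k x)"
      using mult_left_mono[OF direction_slope[OF B K1[OF k]], of "\<tau> k"] \<tau>[OF k] e4 by (simp add: mult.commute)
  next
    fix u :: "nat \<Rightarrow> real" assume cube: "\<And>k. k \<in> K \<Longrightarrow> \<bar>u k\<bar> \<le> 1"
    have "(\<Sum>k\<in>K. (\<Sum>l\<in>K. u l * (LINT x|lborel. \<tau> l * direction B l x * cosine_mode ((1 - e) * B) k x))\<^sup>2) =
      (\<Sum>k\<in>K. (\<Sum>l\<in>K. (u l * \<tau> l) * (LINT x|lborel. direction B l x * cosine_mode ((1 - e) * B) k x))\<^sup>2)"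
      by (simp only: mult.assoc integral_mult_right_zero)
    also have "\<dots> \<le> (\<Sum>k\<in>K. (u k * \<tau> k)\<^sup>2)" by (rule direction_coordinates[OF B fin K1])
    also have "\<dots> \<le> (\<Sum>k\<in>K. (\<tau> k)\<^sup>2)"
      using cube by (intro sum_mono) (simp add: power_mult_distrib mult_left_le_one_le abs_square_le_1)
    finally show "(\<Sum>k\<in>K. (\<Sum>l\<in>K. u l * (LINT x|lborel. \<tau> l * direction B l x * cosine_mode ((1 - e) * B) k x))\<^sup>2) \<le> (\<Sum>k\<in>K. (\<tau> k)\<^sup>2)" .
  qed (use small_sum eb cosine_mode_orthonormal[OF H0 K1] Gm good T in auto)
  also have "emeasure \<mu> (space \<mu> - G) \<le> ennreal (exp (- 2 * t\<^sup>2 / (\<Sum>k\<in>K. (w k)\<^sup>2)))"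
  proof -
    have "space \<mu> - G = {u \<in> space \<mu>. (\<Sum>k\<in>K. w k * (u k)\<^sup>2) \<ge> (\<Sum>k\<in>K. w k) / real (2 * (q' + 2) + 3) + t}"
      unfolding G_def sp\<mu> L1_def by (auto simp: not_less algebra_simps)
    then show ?thesis
      using energy_concentration[OF fin w0 t nontriv, of "q' + 2"] unfolding \<mu>_def[symmetric]
      by (simp add: \<mu>.emeasure_eq_measure ennreal_leI)
  qed
  finally show ?thesis
    by (simp add: ennreal_mult[symmetric] sum_nonneg add_left_mono mult_left_mono)
qed

end

section \<open>Large samples\<close>

text \<open>By the mean value theorem; telescoping these increments compares sums of powers with the integral.\<close>

lemma powr_increment_bounds:
  fixes a x y :: real
  assumes a: "a > 0" and x: "0 \<le> x" "x < y"
  shows "(a + 1) * x powr a * (y - x) \<le> y powr (a + 1) - x powr (a + 1)"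
    "y powr (a + 1) - x powr (a + 1) \<le> (a + 1) * y powr a * (y - x)"
proof -
  have "\<exists>l z. x < z \<and> z < y \<and> ((\<lambda>z. z powr (a + 1)) has_real_derivative l) (at z) \<and> y powr (a + 1) - x powr (a + 1) = (y - x) * l"
  proof (rule MVT[OF x(2)])
    show "continuous_on {x..y} (\<lambda>z. z powr (a + 1))"
      using x a by (intro continuous_on_powr' continuous_intros) auto
    show "(\<lambda>z. z powr (a + 1)) differentiable (at z)" if "x < z" "z < y" for z
      using has_real_derivative_powr[of z "a + 1"] that x by (auto simp: real_differentiable_def)
  qed
  then obtain l z where z: "x < z" "z < y" "((\<lambda>z. z powr (a + 1)) has_real_derivative l) (at z)"
      "y powr (a + 1) - x powr (a + 1) = (y - x) * l" by blast
  have l: "l = (a + 1) * z powr a"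
    using DERIV_unique[OF z(3)] has_real_derivative_powr[of z "a + 1"] z(1) x by auto
  have "x powr a \<le> z powr a" "z powr a \<le> y powr a" using z x a by (auto intro!: powr_mono2)
  then show "(a + 1) * x powr a * (y - x) \<le> y powr (a + 1) - x powr (a + 1)"
    "y powr (a + 1) - x powr (a + 1) \<le> (a + 1) * y powr a * (y - x)"
    unfolding z(4) l using x a by (auto simp: mult_ac intro!: mult_left_mono)
qed

lemma sum_powr_bounds:
  fixes a :: real assumes a: "a > 0"
  shows "real N powr (a + 1) \<le> (a + 1) * (\<Sum>k\<in>{1..N}. real k powr a)"
    "(a + 1) * (\<Sum>k\<in>{1..N}. real k powr a) \<le> real (Suc N) powr (a + 1)"
proof -
  show "real N powr (a + 1) \<le> (a + 1) * (\<Sum>k\<in>{1..N}. real k powr a)"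
  proof (induction N)
    case (Suc N)
    have "real (Suc N) powr (a + 1) \<le> real N powr (a + 1) + (a + 1) * real (Suc N) powr a"
      using powr_increment_bounds(2)[OF a, of "real N" "real (Suc N)"] by simp
    with Suc show ?case by (simp add: distrib_left)
  qed simp
  show "(a + 1) * (\<Sum>k\<in>{1..N}. real k powr a) \<le> real (Suc N) powr (a + 1)"
  proof (induction N)
    case (Suc N)
    have "real (Suc N) powr (a + 1) + (a + 1) * real (Suc N) powr a \<le> real (Suc (Suc N)) powr (a + 1)"
      using powr_increment_bounds(1)[OF a, of "real (Suc N)" "real (Suc (Suc N))"] by simp
    with Suc show ?case by (simp add: distrib_left)
  qed simp
qed

lemma riemann_sum_powr:
  fixes a :: real assumes a: "a > 0"
  shows "(\<lambda>N. (\<Sum>k\<in>{1..N}. (real k / real N) powr a) / real N) \<longlonglongrightarrow> 1 / (a + 1)"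
proof (rule tendsto_sandwich)
  have eq: "(\<Sum>k\<in>{1..N}. (real k / real N) powr a) / real N = (\<Sum>k\<in>{1..N}. real k powr a) / real N powr (a + 1)" if "N \<ge> 1" for N
  proof -
    have "(\<Sum>k\<in>{1..N}. (real k / real N) powr a) = (\<Sum>k\<in>{1..N}. real k powr a) / real N powr a"
      unfolding sum_divide_distrib by (intro sum.cong refl) (simp add: powr_divide)
    then show ?thesis using that by (simp add: powr_add)
  qed
  show "\<forall>\<^sub>F N in sequentially. 1 / (a + 1) \<le> (\<Sum>k\<in>{1..N}. (real k / real N) powr a) / real N"
    using eventually_ge_at_top[of 1]
  proof eventually_elim
    case (elim N)
    show ?case unfolding eq[OF elim] using sum_powr_bounds(1)[OF a, of N] elim a by (simp add: field_simps)
  qed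
  show "\<forall>\<^sub>F N in sequentially. (\<Sum>k\<in>{1..N}. (real k / real N) powr a) / real N \<le> 1 / (a + 1) * (1 + 1 / real N) powr (a + 1)"
    using eventually_ge_at_top[of 1]
  proof eventually_elim
    case (elim N)
    have "(1 + 1 / real N) powr (a + 1) = (real (Suc N) / real N) powr (a + 1)" using elim by (simp add: field_simps)
    also have "\<dots> = real (Suc N) powr (a + 1) / real N powr (a + 1)" by (simp add: powr_divide)
    finally have p: "(1 + 1 / real N) powr (a + 1) = real (Suc N) powr (a + 1) / real N powr (a + 1)" .
    have "(\<Sum>k\<in>{1..N}. real k powr a) \<le> 1 / (a + 1) * real (Suc N) powr (a + 1)"
      using sum_powr_bounds(2)[OF a, of N] a by (simp add: field_simps)
    then have "(\<Sum>k\<in>{1..N}. real k powr a) / real N powr (a + 1) \<le> 1 / (a + 1) * real (Suc N) powr (a + 1) / real N powr (a + 1)"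
      by (intro divide_right_mono) auto
    then show ?case unfolding eq[OF elim] p by simp
  qed
  have "(\<lambda>N. 1 / (a + 1) * (1 + 1 / real N) powr (a + 1)) \<longlonglongrightarrow> 1 / (a + 1) * (1 + 0) powr (a + 1)"
    by (intro tendsto_intros lim_1_over_n) auto
  then show "(\<lambda>N. 1 / (a + 1) * (1 + 1 / real N) powr (a + 1)) \<longlonglongrightarrow> 1 / (a + 1)" by simp
qed simp

context window
begin

text \<open>The number of frequencies is \<open>N = \<Lambda> n powr (1 / (2 \<beta> + 1))\<close>, and the squared amplitudes
are \<open>J \<nu> ((N / k) powr \<beta> - 1)\<close> with \<open>\<nu> = 1 / (n I)\<close> the noise level. Then the van Trees bound of the \<open>k\<close>-th coordinate is
exactly \<open>\<nu> (1 - (k / N) powr \<beta>)\<close> up to the slope, and both risk and mean energy are Riemann sums. Frequencies below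
\<open>\<delta> N\<close> are left out: their amplitudes would not be \<open>O(n powr (-1/2))\<close>, while they contribute at most
the fraction \<open>\<delta>\<close> to the risk.
The parameter \<open>\<rho>\<close> is the cut-off frequency in units of \<open>n powr (1 / (2 \<beta> + 1))\<close>; with it both limits are
independent of the length of the interval.\<close>

lemma asymptotic_lower_bound:
  fixes B \<rho> \<delta> \<eta> t L c :: real and p :: nat
  assumes B: "B > 0" and H: "(1 - e) * B \<ge> 1" and e4: "e \<le> 1/4"
    and \<rho>: "\<rho> > 0" and \<delta>: "0 < \<delta>" "\<delta> < 1" and \<eta>: "\<eta> > 0" and t: "t > 0" and c: "0 \<le> c"
  defines "\<kappa> \<equiv> 1 / (\<beta> + 1) - 1 / (2 * \<beta> + 1)"
  assumes budget: "(1 + \<eta>) * ((1 + \<eta>) * (2 * pi * (prior_info p / (2 * real p + 7) * ((1 - e)\<^sup>2 * \<rho> powr (2 * \<beta> + 1) / pi * \<kappa>) + t))) +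
     (1 + 1 / \<eta>) * (4 * (B powr (- 1 - 2 * \<beta>) / mass\<^sup>2 * enn2real (fourier_energy \<beta> q))) < 2 * pi * L"
    and risk: "c < (1 - 2 * e)\<^sup>2 * ((1 - e)\<^sup>2 * \<rho> / pi) * (1 - 1 / (\<beta> + 1) - \<delta>)"
  shows "\<forall>\<^sub>F n in sequentially. \<forall>T\<in>estimators n. ennreal c \<le> (SUP f\<in>sobolev_class \<beta> L. ennreal (real n powr (2 * \<beta> / (2 * \<beta> + 1))) * risk n T f)"
proof -
  define \<alpha> where "\<alpha> = 1 / (2 * \<beta> + 1)"
  have \<alpha>: "0 < \<alpha>" "\<alpha> < 1/2" using beta by (auto simp: \<alpha>_def field_simps)
  have \<alpha>b: "\<alpha> * (2 * \<beta> + 1) = 1" using beta by (simp add: \<alpha>_def)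
  define h where "h = (1 - e) * B"
  have h: "h > 0" "h \<ge> 1" using H by (auto simp: h_def)
  define \<Lambda> where "\<Lambda> = 2 * h / pi * \<rho>"
  have \<Lambda>: "\<Lambda> > 0" using h \<rho> by (simp add: \<Lambda>_def)
  define J where "J = prior_info p"
  have J: "J > 0" unfolding J_def prior_info_def by (intro divide_pos_pos mult_pos_pos) auto
  define I where "I = 2 * B / (1 - e)"
  have I: "I > 0" using B e by (simp add: I_def)
  define x where "x = (\<lambda>n. real n powr \<alpha>)"
  define N where "N = (\<lambda>n. nat \<lfloor>\<Lambda> * x n\<rfloor>)"
  define \<nu> where "\<nu> = (\<lambda>n. 1 / (real n * I))"
  define r where "r = (\<lambda>n k. (real (N n) / real k) powr \<beta> - 1)"
  define \<tau> where "\<tau> = (\<lambda>n k. sqrt (J * \<nu> n * r n k))"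
  define \<Theta> where "\<Theta> = (\<lambda>n. sqrt (J * \<nu> n * \<delta> powr (- \<beta>)))"
  define K where "K = (\<lambda>n. {k \<in> {1..N n}. \<delta> * real (N n) < real k})"
  \<comment> \<open>All frequencies in use are at most \<open>C * x n\<close>, and \<open>C * x n \<ge> 1\<close> for \<open>n \<ge> 1\<close>.\<close>
  define C where "C = 1 + pi / (2 * h) * \<Lambda>"
  have C: "C \<ge> 1" using h \<Lambda> by (simp add: C_def)
  define b where "b = (\<lambda>n. C * x n)"
  define w where "w = (\<lambda>n k. freq h k powr (2 * \<beta>) * (\<tau> n k)\<^sup>2)"
  let ?y = "\<lambda>k n. (real k / real (N n))"
  let ?W2 = "\<lambda>n. (\<Sum>k\<in>K n. (w n k)\<^sup>2)"
  let ?E0 = "(4 * (B powr (- 1 - 2 * \<beta>) / mass\<^sup>2 * enn2real (fourier_energy \<beta> q)))"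
  define S1 where "S1 = (\<lambda>M. (\<Sum>k\<in>{1..M}. (real k / real M) powr \<beta>) / real M)"
  define S2 where "S2 = (\<lambda>M. (\<Sum>k\<in>{1..M}. (real k / real M) powr (2 * \<beta>)) / real M)"
  define c1 where "c1 = J * \<delta> powr (- \<beta>) / I"
  have c1: "c1 > 0" using J \<delta> I by (simp add: c1_def)

  have npos: "\<forall>\<^sub>F n in sequentially. n \<ge> (1::nat)" by (rule eventually_ge_at_top)
  have x_top: "filterlim x at_top sequentially"
    unfolding x_def using \<alpha> by (intro filterlim_compose[OF real_powr_at_top filterlim_real_sequentially]) auto
  have x1: "x n \<ge> 1" if "n \<ge> 1" for n unfolding x_def using that \<alpha> by (intro ge_one_powr_ge_zero) auto
  have xp: "x n powr s = real n powr (\<alpha> * s)" for n s by (simp add: x_def powr_powr)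
  have xn: "x n powr (2 * \<beta> + 1) = real n" if "n \<ge> 1" for n using that by (simp add: xp \<alpha>b)
  have Nle: "real (N n) \<le> \<Lambda> * x n" for n
    unfolding N_def using \<Lambda> by (simp add: x_def)
  have Nge: "\<Lambda> * x n - 1 \<le> real (N n)" for n
    unfolding N_def by linarith
  have Nx: "(\<lambda>n. real (N n) / x n) \<longlonglongrightarrow> \<Lambda>"
  proof (rule tendsto_sandwich)
    show "\<forall>\<^sub>F n in sequentially. \<Lambda> - 1 / x n \<le> real (N n) / x n"
      using npos
    proof eventually_elim
      case (elim n)
      have "(\<Lambda> * x n - 1) / x n \<le> real (N n) / x n" using x1[OF elim] by (intro divide_right_mono Nge) auto
      then show ?case using x1[OF elim] by (simp add: diff_divide_distrib)
    qed
    show "\<forall>\<^sub>F n in sequentially. real (N n) / x n \<le> \<Lambda>"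
      using npos
    proof eventually_elim
      case (elim n)
      show ?case using Nle[of n] x1[OF elim] by (simp add: pos_divide_le_eq)
    qed
    have "(\<lambda>n. \<Lambda> - 1 / x n) \<longlonglongrightarrow> \<Lambda> - 0"
      by (intro tendsto_intros tendsto_divide_0[OF tendsto_const] filterlim_at_top_imp_at_infinity x_top)
    then show "(\<lambda>n. \<Lambda> - 1 / x n) \<longlonglongrightarrow> \<Lambda>" by simp
  qed simp
  have N_top: "filterlim N at_top sequentially"
  proof -
    have "filterlim (\<lambda>n. \<Lambda> * x n - 1) at_top sequentially"
      using filterlim_tendsto_add_at_top[OF tendsto_const[of "-1"] filterlim_tendsto_pos_mult_at_top[OF tendsto_const \<Lambda> x_top]] by simp
    then have "filterlim (\<lambda>n. real (N n)) at_top sequentially"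
      by (rule filterlim_at_top_mono) (use Nge in auto)
    then show ?thesis by (simp add: filterlim_sequentially_iff_filterlim_real)
  qed
  have \<Theta>sq: "(\<Theta> n)\<^sup>2 = c1 / real n" for n
    unfolding \<Theta>_def c1_def \<nu>_def using J I \<delta> by (simp add: field_simps)
  have \<Theta>0: "\<Theta> n \<ge> 0" for n unfolding \<Theta>_def using J I by (simp add: \<nu>_def)
  have \<Theta>eq: "\<Theta> n = sqrt c1 * real n powr (- (1/2))" if "n \<ge> 1" for n
  proof -
    have "\<Theta> n = sqrt (c1 / real n)" using \<Theta>sq[of n] \<Theta>0[of n] by (metis abs_of_nonneg real_sqrt_abs)
    then show ?thesis by (simp add: real_sqrt_divide powr_minus_divide powr_half_sqrt)
  qed
  have n_neg: "(\<lambda>n. real n powr s) \<longlonglongrightarrow> 0" if "s < 0" for s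
    using that by (intro tendsto_neg_powr filterlim_real_sequentially)
  have N\<Theta>_le: "real (N n) * \<Theta> n \<le> \<Lambda> * sqrt c1 * real n powr (\<alpha> - 1/2)" if n: "n \<ge> 1" for n
  proof -
    have "real (N n) * \<Theta> n \<le> (\<Lambda> * x n) * \<Theta> n" by (intro mult_right_mono Nle \<Theta>0)
    also have "\<dots> = \<Lambda> * sqrt c1 * (real n powr \<alpha> * real n powr (- (1/2)))" unfolding \<Theta>eq[OF n] x_def by simp
    also have "\<dots> = \<Lambda> * sqrt c1 * real n powr (\<alpha> - 1/2)" by (simp only: powr_add[symmetric]) simp
    finally show ?thesis .
  qed
  have N\<Theta>: "(\<lambda>n. real (N n) * \<Theta> n) \<longlonglongrightarrow> 0"
  proof (rule tendsto_sandwich[OF _ _ tendsto_const])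
    show "\<forall>\<^sub>F n in sequentially. 0 \<le> real (N n) * \<Theta> n" using \<Theta>0 by simp
    show "\<forall>\<^sub>F n in sequentially. real (N n) * \<Theta> n \<le> \<Lambda> * sqrt c1 * real n powr (\<alpha> - 1/2)"
      using npos by eventually_elim (rule N\<Theta>_le)
    show "(\<lambda>n. \<Lambda> * sqrt c1 * real n powr (\<alpha> - 1/2)) \<longlonglongrightarrow> 0"
      using \<alpha> by (intro tendsto_mult_right_zero n_neg) auto
  qed
  have bN\<Theta>: "(\<lambda>n. b n powr (\<beta> - min 1 \<beta>) * (real (N n) * \<Theta> n)) \<longlonglongrightarrow> 0"
  proof (rule tendsto_sandwich[OF _ _ tendsto_const])
    let ?s = "\<beta> - min 1 \<beta>"
    show "\<forall>\<^sub>F n in sequentially. 0 \<le> b n powr ?s * (real (N n) * \<Theta> n)" using \<Theta>0 by simp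
    show "\<forall>\<^sub>F n in sequentially. b n powr ?s * (real (N n) * \<Theta> n) \<le> C powr ?s * (\<Lambda> * sqrt c1) * real n powr (\<alpha> * ?s + (\<alpha> - 1/2))"
      using npos
    proof eventually_elim
      case (elim n)
      have "b n powr ?s * (real (N n) * \<Theta> n) \<le> b n powr ?s * (\<Lambda> * sqrt c1 * real n powr (\<alpha> - 1/2))"
        by (intro mult_left_mono N\<Theta>_le[OF elim]) simp
      moreover have "b n powr ?s = C powr ?s * real n powr (\<alpha> * ?s)"
        unfolding b_def using C x1[OF elim] by (simp add: powr_mult xp)
      ultimately show ?case by (simp add: powr_add mult_ac)
    qed
    \<comment> \<open>This is where \<open>\<beta> > 1/2\<close> enters: it forces \<open>min 1 \<beta> > 1/2\<close>.\<close>
    have "\<alpha> * ?s + (\<alpha> - 1/2) < 0"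
    proof -
      have "?s + 1 < (2 * \<beta> + 1) / 2" using beta by (auto simp: min_def)
      then have "\<alpha> * (?s + 1) < \<alpha> * ((2 * \<beta> + 1) / 2)" using \<alpha> by (intro mult_strict_left_mono) auto
      also have "\<dots> = 1/2" using \<alpha>b by simp
      finally show ?thesis by (simp add: algebra_simps)
    qed
    then show "(\<lambda>n. C powr ?s * (\<Lambda> * sqrt c1) * real n powr (\<alpha> * ?s + (\<alpha> - 1/2))) \<longlonglongrightarrow> 0"
      by (intro tendsto_mult_right_zero n_neg)
  qed

  have Kk: "k \<ge> 1 \<and> k \<le> N n \<and> 0 \<le> r n k \<and> r n k \<le> \<delta> powr (- \<beta>)" if k: "k \<in> K n" for n k
  proof -
    have k1: "1 \<le> k" "k \<le> N n" "\<delta> * real (N n) < real k" using k by (auto simp: K_def)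
    have "1 \<le> real (N n) / real k" using k1 by simp
    then have "1 powr \<beta> \<le> (real (N n) / real k) powr \<beta>" using beta by (intro powr_mono2) auto
    moreover have "(real (N n) / real k) powr \<beta> \<le> (1 / \<delta>) powr \<beta>"
      using k1 \<delta> beta by (intro powr_mono2) (auto simp: field_simps)
    moreover have "(1 / \<delta>) powr \<beta> = \<delta> powr (- \<beta>)" using \<delta> by (simp add: powr_divide powr_minus_divide)
    ultimately show ?thesis using k1 by (auto simp: r_def)
  qed
  have \<nu>0: "\<nu> n \<ge> 0" for n using I by (simp add: \<nu>_def)
  have \<tau>sq: "(\<tau> n k)\<^sup>2 = J * \<nu> n * r n k" if "k \<in> K n" for n k
    using Kk[OF that] J \<nu>0[of n] by (simp add: \<tau>_def)
  have \<tau>b: "0 \<le> \<tau> n k \<and> \<tau> n k \<le> \<Theta> n" if "k \<in> K n" for n k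
    unfolding \<tau>_def \<Theta>_def using Kk[OF that] J \<nu>0[of n] by (auto intro!: mult_left_mono)
  have rk: "r n k + 1 = (real (N n) / real k) powr \<beta>" for n k by (simp add: r_def)
  have inv: "(real (N n) / real k) powr \<beta> * (?y k n) powr \<beta> = 1" if "k \<in> K n" for n k
    using Kk[OF that] by (simp add: powr_mult[symmetric])

  define A where "A = (\<lambda>n. \<Sum>k\<in>K n. ((1 - 2 * e) * \<tau> n k)\<^sup>2 / (real n * ((\<tau> n k)\<^sup>2 * (2 * B) / (1 - e)) + prior_info p))"
  have term_eq: "((1 - 2 * e) * \<tau> n k)\<^sup>2 / (real n * ((\<tau> n k)\<^sup>2 * (2 * B) / (1 - e)) + prior_info p) = (1 - 2 * e)\<^sup>2 * \<nu> n * (1 - (?y k n) powr \<beta>)"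
    if n: "n \<ge> 1" and k: "k \<in> K n" for n k
  proof -
    have "real n * ((\<tau> n k)\<^sup>2 * (2 * B) / (1 - e)) = (real n * \<nu> n * I) * (J * r n k)"
      unfolding \<tau>sq[OF k] I_def by (simp add: mult_ac)
    also have "real n * \<nu> n * I = 1" using n I by (simp add: \<nu>_def)
    finally have den: "real n * ((\<tau> n k)\<^sup>2 * (2 * B) / (1 - e)) + prior_info p = J * (r n k + 1)"
      by (simp add: J_def algebra_simps)
    have pos: "r n k + 1 > 0" using Kk[OF k] by linarith
    have "((1 - 2 * e) * \<tau> n k)\<^sup>2 / (J * (r n k + 1)) = (1 - 2 * e)\<^sup>2 * \<nu> n * (r n k / (r n k + 1))"
    proof -
      have "((1 - 2 * e) * \<tau> n k)\<^sup>2 = J * ((1 - 2 * e)\<^sup>2 * \<nu> n * r n k)"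
        unfolding power_mult_distrib \<tau>sq[OF k] by (simp only: mult_ac)
      then show ?thesis using J by (simp only: mult_divide_mult_cancel_left) simp
    qed
    also have "r n k / (r n k + 1) = 1 - (?y k n) powr \<beta>"
      using inv[OF k] pos unfolding rk[symmetric] by (simp add: field_simps)
    finally show ?thesis unfolding den .
  qed
  have A_ge: "(1 - 2 * e)\<^sup>2 * \<nu> n * (real (N n) * (1 - S1 (N n) - \<delta>)) \<le> A n" if n: "n \<ge> 1" "N n \<ge> 1" for n
  proof -
    have le1: "(?y k n) powr \<beta> \<le> 1" if "k \<in> {1..N n}" for k
      using that n beta powr_mono2[of \<beta> "real k / real (N n)" 1] by (simp add: divide_le_eq_1)
    have "(\<Sum>k\<in>{1..N n}. 1 - (?y k n) powr \<beta>) = (\<Sum>k\<in>K n. 1 - (?y k n) powr \<beta>) + (\<Sum>k\<in>{1..N n} - K n. 1 - (?y k n) powr \<beta>)"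
      by (subst add.commute, rule sum.subset_diff) (auto simp: K_def)
    also have "(\<Sum>k\<in>{1..N n} - K n. 1 - (?y k n) powr \<beta>) \<le> (\<Sum>k\<in>{1..N n} - K n. 1)"
      by (intro sum_mono) auto
    also have "\<dots> = real (card ({1..N n} - K n))" by simp
    also have "\<dots> \<le> \<delta> * real (N n)"
    proof -
      \<comment> \<open>Each omitted frequency costs at most 1.\<close>
      have "{1..N n} - K n \<subseteq> {1..nat \<lfloor>\<delta> * real (N n)\<rfloor>}"
      proof
        fix k assume "k \<in> {1..N n} - K n"
        then have "1 \<le> k" "real k \<le> \<delta> * real (N n)" by (auto simp: K_def not_less)
        then show "k \<in> {1..nat \<lfloor>\<delta> * real (N n)\<rfloor>}" by (auto intro: le_nat_floor)
      qed
      then have "card ({1..N n} - K n) \<le> nat \<lfloor>\<delta> * real (N n)\<rfloor>"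
        using card_mono[of "{1..nat \<lfloor>\<delta> * real (N n)\<rfloor>}"] by simp
      then have "real (card ({1..N n} - K n)) \<le> real (nat \<lfloor>\<delta> * real (N n)\<rfloor>)" by simp
      also have "\<dots> \<le> \<delta> * real (N n)" using \<delta> by (intro of_nat_floor) auto
      finally show ?thesis .
    qed
    finally have "(\<Sum>k\<in>{1..N n}. 1 - (?y k n) powr \<beta>) - \<delta> * real (N n) \<le> (\<Sum>k\<in>K n. 1 - (?y k n) powr \<beta>)"
      by simp
    moreover have "(\<Sum>k\<in>{1..N n}. 1 - (?y k n) powr \<beta>) = real (N n) * (1 - S1 (N n))"
      using n unfolding S1_def by (simp add: sum_subtractf field_simps)
    ultimately have *: "real (N n) * (1 - S1 (N n) - \<delta>) \<le> (\<Sum>k\<in>K n. 1 - (?y k n) powr \<beta>)"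
      by (simp add: algebra_simps)
    have "A n = (1 - 2 * e)\<^sup>2 * \<nu> n * (\<Sum>k\<in>K n. 1 - (?y k n) powr \<beta>)"
      unfolding A_def sum_distrib_left by (intro sum.cong refl term_eq n)
    with * \<nu>0[of n] show ?thesis by (simp add: mult_left_mono)
  qed
  have S1lim: "(\<lambda>n. S1 (N n)) \<longlonglongrightarrow> 1 / (\<beta> + 1)"
    unfolding S1_def using filterlim_compose[OF riemann_sum_powr N_top, of \<beta>] beta by simp
  have S2lim: "(\<lambda>n. S2 (N n)) \<longlonglongrightarrow> 1 / (2 * \<beta> + 1)"
    unfolding S2_def using filterlim_compose[OF riemann_sum_powr N_top, of "2 * \<beta>"] beta by simp
  have Alim: "(\<lambda>n. x n powr (2 * \<beta>) * ((1 - 2 * e)\<^sup>2 * \<nu> n * (real (N n) * (1 - S1 (N n) - \<delta>)))) \<longlonglongrightarrow> (1 - 2 * e)\<^sup>2 * ((1 - e)\<^sup>2 * \<rho> / pi) * (1 - 1 / (\<beta> + 1) - \<delta>)"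
  proof -
    have l1: "(\<lambda>n. (1 - 2 * e)\<^sup>2 * (1 / I * (real (N n) / x n)) * (1 - S1 (N n) - \<delta>)) \<longlonglongrightarrow> (1 - 2 * e)\<^sup>2 * (1 / I * \<Lambda>) * (1 - 1 / (\<beta> + 1) - \<delta>)"
      by (intro tendsto_intros Nx S1lim)
    have l2: "1 / I * \<Lambda> = (1 - e)\<^sup>2 * \<rho> / pi"
      using B e unfolding I_def \<Lambda>_def h_def by (simp add: field_simps power2_eq_square)
    have l3: "\<forall>\<^sub>F n in sequentially. (1 - 2 * e)\<^sup>2 * (1 / I * (real (N n) / x n)) * (1 - S1 (N n) - \<delta>) = x n powr (2 * \<beta>) * ((1 - 2 * e)\<^sup>2 * \<nu> n * (real (N n) * (1 - S1 (N n) - \<delta>)))"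
      using npos
    proof eventually_elim
      case (elim n)
      have "x n powr (2 * \<beta>) * x n = real n" using xn[OF elim] x1[OF elim] by (simp add: powr_add)
      then have x\<nu>: "x n powr (2 * \<beta>) * \<nu> n = 1 / I / x n"
        using x1[OF elim] elim I unfolding \<nu>_def by (simp add: field_simps)
      have "x n powr (2 * \<beta>) * ((1 - 2 * e)\<^sup>2 * \<nu> n * (real (N n) * (1 - S1 (N n) - \<delta>))) = (1 - 2 * e)\<^sup>2 * (x n powr (2 * \<beta>) * \<nu> n * real (N n)) * (1 - S1 (N n) - \<delta>)"
        by (simp only: mult_ac)
      then show ?case unfolding x\<nu> by simp
    qed
    show ?thesis using Lim_transform_eventually[OF l1 l3] unfolding l2 .
  qed

  define Q where "Q = (\<lambda>n. J / (2 * real p + 7) * ((pi / (2 * h)) powr (2 * \<beta>) * (1 / I) * (real (N n) / x n) powr (2 * \<beta> + 1) * (S1 (N n) - S2 (N n))))"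
  have w_eq: "w n k = J * \<nu> n * (pi / (2 * h)) powr (2 * \<beta>) * real (N n) powr (2 * \<beta>) * ((?y k n) powr \<beta> - (?y k n) powr (2 * \<beta>))"
    if k: "k \<in> K n" for n k
  proof -
    have k1: "k \<ge> 1" "N n \<ge> 1" using Kk[OF k] by auto
    define y where "y = real k / real (N n)"
    have y: "y > 0" using k1 by (simp add: y_def)
    have "freq h k = pi / (2 * h) * (real (N n) * y)" using k1 by (simp add: freq_def y_def)
    then have f: "freq h k powr (2 * \<beta>) = (pi / (2 * h)) powr (2 * \<beta>) * (real (N n) powr (2 * \<beta>) * y powr (2 * \<beta>))"
      by (simp only: powr_mult)
    have "r n k = y powr (- \<beta>) - 1" unfolding r_def y_def by (simp add: powr_divide powr_minus_divide)
    then have "y powr (2 * \<beta>) * r n k = y powr \<beta> - y powr (2 * \<beta>)"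
      by (simp add: right_diff_distrib powr_add[symmetric])
    then show ?thesis unfolding w_def \<tau>sq[OF k] f y_def[symmetric] by (simp add: mult_ac)
  qed
  have wQ: "(\<Sum>k\<in>K n. w n k) / (2 * real p + 7) \<le> Q n" if n: "n \<ge> 1" "N n \<ge> 1" for n
  proof -
    define G where "G = J * \<nu> n * (pi / (2 * h)) powr (2 * \<beta>) * real (N n) powr (2 * \<beta>)"
    have G: "G \<ge> 0" unfolding G_def using J \<nu>0[of n] by simp
    have nn: "(?y k n) powr (2 * \<beta>) \<le> (?y k n) powr \<beta>" if "k \<in> {1..N n}" for k
      using that n beta by (intro powr_mono') auto
    have "(\<Sum>k\<in>K n. w n k) = G * (\<Sum>k\<in>K n. (?y k n) powr \<beta> - (?y k n) powr (2 * \<beta>))"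
      unfolding sum_distrib_left G_def by (intro sum.cong refl w_eq)
    also have "\<dots> \<le> G * (\<Sum>k\<in>{1..N n}. (?y k n) powr \<beta> - (?y k n) powr (2 * \<beta>))"
      using nn by (intro mult_left_mono sum_mono2 G) (auto simp: K_def)
    also have "(\<Sum>k\<in>{1..N n}. (?y k n) powr \<beta> - (?y k n) powr (2 * \<beta>)) = real (N n) * (S1 (N n) - S2 (N n))"
      using n unfolding S1_def S2_def by (simp add: sum_subtractf right_diff_distrib)
    also have "G * (real (N n) * (S1 (N n) - S2 (N n))) = J * ((pi / (2 * h)) powr (2 * \<beta>) * (\<nu> n * (real (N n) powr (2 * \<beta>) * real (N n))) * (S1 (N n) - S2 (N n)))"
      by (simp add: G_def mult_ac)
    also have "real (N n) powr (2 * \<beta>) * real (N n) = real (N n) powr (2 * \<beta> + 1)"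
      using n by (simp add: powr_add)
    also have "\<nu> n * real (N n) powr (2 * \<beta> + 1) = 1 / I * (real (N n) / x n) powr (2 * \<beta> + 1)"
      using n xn[OF n(1)] by (simp add: \<nu>_def powr_divide)
    finally have "(\<Sum>k\<in>K n. w n k) \<le> J * ((pi / (2 * h)) powr (2 * \<beta>) * (1 / I * (real (N n) / x n) powr (2 * \<beta> + 1)) * (S1 (N n) - S2 (N n)))" .
    then have "(\<Sum>k\<in>K n. w n k) / (2 * real p + 7) \<le> J * ((pi / (2 * h)) powr (2 * \<beta>) * (1 / I * (real (N n) / x n) powr (2 * \<beta> + 1)) * (S1 (N n) - S2 (N n))) / (2 * real p + 7)"
      by (intro divide_right_mono) auto
    also have "\<dots> = Q n" by (simp add: Q_def mult.assoc)
    finally show ?thesis .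
  qed
  have Qlim: "Q \<longlonglongrightarrow> J / (2 * real p + 7) * ((1 - e)\<^sup>2 * \<rho> powr (2 * \<beta> + 1) / pi * \<kappa>)"
  proof -
    have l1: "Q \<longlonglongrightarrow> J / (2 * real p + 7) * ((pi / (2 * h)) powr (2 * \<beta>) * (1 / I) * \<Lambda> powr (2 * \<beta> + 1) * (1 / (\<beta> + 1) - 1 / (2 * \<beta> + 1)))"
      unfolding Q_def using \<Lambda> by (intro tendsto_intros Nx S1lim S2lim) auto
    have l2: "(pi / (2 * h)) powr (2 * \<beta>) * (1 / I) * \<Lambda> powr (2 * \<beta> + 1) = (1 - e)\<^sup>2 * \<rho> powr (2 * \<beta> + 1) / pi"
    proof -
      have "\<Lambda> powr (2 * \<beta> + 1) = (2 * h / pi) powr (2 * \<beta> + 1) * \<rho> powr (2 * \<beta> + 1)"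
        unfolding \<Lambda>_def by (simp only: powr_mult)
      also have "(2 * h / pi) powr (2 * \<beta> + 1) = (2 * h / pi) powr (2 * \<beta>) * (2 * h / pi)"
        using h unfolding powr_add by simp
      finally have "(pi / (2 * h)) powr (2 * \<beta>) * (1 / I) * \<Lambda> powr (2 * \<beta> + 1) = ((pi / (2 * h)) powr (2 * \<beta>) * (2 * h / pi) powr (2 * \<beta>)) * (1 / I * (2 * h / pi)) * \<rho> powr (2 * \<beta> + 1)"
        by (simp add: mult_ac)
      also have "(pi / (2 * h)) powr (2 * \<beta>) * (2 * h / pi) powr (2 * \<beta>) = 1"
        using h by (simp add: powr_mult[symmetric])
      also have "1 / I * (2 * h / pi) = (1 - e)\<^sup>2 / pi"
        using B e unfolding I_def h_def by (simp add: field_simps power2_eq_square)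
      finally show ?thesis by simp
    qed
    show ?thesis using l1 unfolding l2 \<kappa>_def .
  qed

  have freq_le: "freq h k \<le> b n" if "k \<le> N n" "n \<ge> 1" for n k
  proof -
    have "freq h k \<le> pi / (2 * h) * real (N n)" unfolding freq_def using that h by (simp add: divide_right_mono)
    also have "\<dots> \<le> pi / (2 * h) * (\<Lambda> * x n)" using h by (intro mult_left_mono Nle) auto
    also have "\<dots> \<le> C * x n" unfolding C_def using x1[OF that(2)] by (simp add: algebra_simps)
    finally show ?thesis by (simp add: b_def)
  qed
  have w0: "w n k \<ge> 0" for n k by (simp add: w_def)
  have w_le: "w n k \<le> C powr (2 * \<beta>) * c1 / x n" if n: "n \<ge> 1" and k: "k \<in> K n" for n k
  proof -
    have "w n k \<le> (b n) powr (2 * \<beta>) * (\<Theta> n)\<^sup>2"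
      unfolding w_def using Kk[OF k] freq_le[OF _ n] \<tau>b[OF k] beta h
      by (intro mult_mono powr_mono2 power_mono) (auto simp: freq_def)
    also have "\<dots> = C powr (2 * \<beta>) * c1 * (x n powr (2 * \<beta>) / real n)"
      unfolding \<Theta>sq b_def using C x1[OF n] by (simp add: powr_mult)
    also have "x n powr (2 * \<beta>) / real n = 1 / x n"
      using xn[OF n] x1[OF n] n by (simp add: powr_add field_simps)
    finally show ?thesis by simp
  qed
  define W where "W = (\<lambda>n. \<Lambda> * (C powr (2 * \<beta>) * c1)\<^sup>2 / x n)"
  have wsq: "(?W2 n) \<le> W n" if n: "n \<ge> 1" for n
  proof -
    have "(?W2 n) \<le> (\<Sum>k\<in>K n. (C powr (2 * \<beta>) * c1 / x n)\<^sup>2)"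
      using w_le[OF n] w0 by (intro sum_mono power_mono) auto
    also have "\<dots> = real (card (K n)) * (C powr (2 * \<beta>) * c1 / x n)\<^sup>2" by simp
    also have "\<dots> \<le> (\<Lambda> * x n) * (C powr (2 * \<beta>) * c1 / x n)\<^sup>2"
    proof (intro mult_right_mono)
      have "card (K n) \<le> card {1..N n}" by (intro card_mono) (auto simp: K_def)
      then show "real (card (K n)) \<le> \<Lambda> * x n" using Nle[of n] by simp
    qed simp
    also have "\<dots> = W n" using x1[OF n] by (simp add: W_def power2_eq_square field_simps)
    finally show ?thesis .
  qed
  \<comment> \<open>The price of the exceptional event after normalisation: total squared amplitude, which has the order
of the risk, times an exponentially small probability.\<close>
  define D where "D = (\<lambda>n. x n powr (2 * \<beta>) * (9 * (\<Sum>k\<in>K n. (\<tau> n k)\<^sup>2) * exp (- 2 * t\<^sup>2 / (?W2 n))))"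
  have Wlim: "(\<lambda>n. exp (- (2 * t\<^sup>2 / W n))) \<longlonglongrightarrow> 0"
  proof -
    have "2 * t\<^sup>2 / W n = 2 * t\<^sup>2 / (\<Lambda> * (C powr (2 * \<beta>) * c1)\<^sup>2) * x n" for n by (simp add: W_def)
    moreover have "filterlim (\<lambda>n. 2 * t\<^sup>2 / (\<Lambda> * (C powr (2 * \<beta>) * c1)\<^sup>2) * x n) at_top sequentially"
      using t \<Lambda> C c1 by (intro filterlim_tendsto_pos_mult_at_top[OF tendsto_const _ x_top]) (auto intro!: divide_pos_pos mult_pos_pos)
    ultimately have "filterlim (\<lambda>n. 2 * t\<^sup>2 / W n) at_top sequentially" by simp
    then show ?thesis
      by (intro filterlim_compose[OF exp_at_bot]) (simp add: filterlim_uminus_at_bot)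
  qed
  have Dlim: "D \<longlonglongrightarrow> 0"
  proof (rule tendsto_sandwich[OF _ _ tendsto_const])
    show "\<forall>\<^sub>F n in sequentially. 0 \<le> D n" unfolding D_def by (intro always_eventually allI mult_nonneg_nonneg sum_nonneg) auto
    show "\<forall>\<^sub>F n in sequentially. D n \<le> 9 * (\<Lambda> * c1) * exp (- (2 * t\<^sup>2 / W n))"
      using npos
    proof eventually_elim
      case (elim n)
      have "(\<Sum>k\<in>K n. (\<tau> n k)\<^sup>2) \<le> (\<Sum>k\<in>K n. (\<Theta> n)\<^sup>2)" using \<tau>b by (intro sum_mono power_mono) auto
      also have "\<dots> = real (card (K n)) * (c1 / real n)" by (simp add: \<Theta>sq)
      also have "\<dots> \<le> (\<Lambda> * x n) * (c1 / real n)"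
      proof (intro mult_right_mono)
        have "card (K n) \<le> card {1..N n}" by (intro card_mono) (auto simp: K_def)
        then show "real (card (K n)) \<le> \<Lambda> * x n" using Nle[of n] by simp
      qed (use c1 in simp)
      finally have 1: "x n powr (2 * \<beta>) * (\<Sum>k\<in>K n. (\<tau> n k)\<^sup>2) \<le> x n powr (2 * \<beta>) * ((\<Lambda> * x n) * (c1 / real n))"
        by (intro mult_left_mono) auto
      also have "\<dots> = \<Lambda> * c1 * (x n powr (2 * \<beta> + 1) / real n)" using x1[OF elim] by (simp add: powr_add)
      also have "\<dots> = \<Lambda> * c1" using xn[OF elim] elim by simp
      finally have 2: "x n powr (2 * \<beta>) * (\<Sum>k\<in>K n. (\<tau> n k)\<^sup>2) \<le> \<Lambda> * c1" .
      have 3: "exp (- 2 * t\<^sup>2 / (?W2 n)) \<le> exp (- (2 * t\<^sup>2 / W n)) \<or> (?W2 n) = 0"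
      proof (cases "(?W2 n) = 0")
        case False
        then have "(?W2 n) > 0" using sum_nonneg[of "K n" "\<lambda>k. (w n k)\<^sup>2"] by auto
        then have "2 * t\<^sup>2 / W n \<le> 2 * t\<^sup>2 / (?W2 n)"
          using wsq[OF elim] by (intro frac_le) auto
        then show ?thesis by simp
      qed simp
      show ?case
      proof (cases "(?W2 n) = 0")
        case False
        have "(x n powr (2 * \<beta>) * (\<Sum>k\<in>K n. (\<tau> n k)\<^sup>2)) * exp (- 2 * t\<^sup>2 / (?W2 n)) \<le> (\<Lambda> * c1) * exp (- (2 * t\<^sup>2 / W n))"
          by (rule mult_mono[OF 2]) (use 3 False \<Lambda> c1 in auto)
        then show ?thesis unfolding D_def by (simp add: mult_ac)
      next
        case True
        have "finite (K n)" by (simp add: K_def)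
        then have z: "w n k = 0" if "k \<in> K n" for k
          using True that by (subst (asm) sum_nonneg_eq_0_iff) auto
        have "\<tau> n k = 0" if "k \<in> K n" for k
          using z[OF that] Kk[OF that] h by (simp add: w_def freq_def)
        then have "D n = 0" by (simp add: D_def)
        then show ?thesis using \<Lambda> c1 by simp
      qed
    qed
    show "(\<lambda>n. 9 * (\<Lambda> * c1) * exp (- (2 * t\<^sup>2 / W n))) \<longlonglongrightarrow> 0"
      by (rule tendsto_mult_right_zero[OF Wlim])
  qed

  have ev_N: "\<forall>\<^sub>F n in sequentially. N n \<ge> 1 \<and> 1 < (1 - \<delta>) * real (N n)"
  proof -
    have "\<forall>\<^sub>F n in sequentially. N n \<ge> max 1 (nat \<lceil>1 / (1 - \<delta>)\<rceil> + 1)" using N_top by (simp add: filterlim_at_top)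
    then show ?thesis
    proof eventually_elim
      case (elim n)
      then have "1 / (1 - \<delta>) < real (N n)" by linarith
      then show ?case using elim \<delta> by (simp add: field_simps)
    qed
  qed
  have ev_small: "\<forall>\<^sub>F n in sequentially. real (N n) * \<Theta> n * relative_size B \<le> e"
    using order_tendstoD(2)[OF tendsto_mult_left_zero[OF N\<Theta>, of "relative_size B"], of e] e
    by (auto elim!: eventually_mono)
  have ev_small': "\<forall>\<^sub>F n in sequentially. real (N n) * \<Theta> n * (2 * sqrt h) \<le> 1"
    using order_tendstoD(2)[OF tendsto_mult_left_zero[OF N\<Theta>, of "2 * sqrt h"], of 1]
    by (auto elim!: eventually_mono)
  define Z where "Z = (\<lambda>n. (1 + \<eta>) * ((1 + \<eta>) * (2 * pi * (Q n + t)) +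
       (1 + 1 / \<eta>) * ((2 * ((\<beta> + 1) * 2 powr \<beta>) * (b n powr (\<beta> - min 1 \<beta>) * (real (N n) * \<Theta> n)))\<^sup>2 * mode_tail h)) +
     (1 + 1 / \<eta>) * ?E0)"
  have "Z \<longlonglongrightarrow> (1 + \<eta>) * ((1 + \<eta>) * (2 * pi * (J / (2 * real p + 7) * ((1 - e)\<^sup>2 * \<rho> powr (2 * \<beta> + 1) / pi * \<kappa>) + t)) +
       (1 + 1 / \<eta>) * ((2 * ((\<beta> + 1) * 2 powr \<beta>) * 0)\<^sup>2 * mode_tail h)) +
     (1 + 1 / \<eta>) * ?E0"
    unfolding Z_def by (intro tendsto_add tendsto_mult tendsto_power tendsto_const Qlim bN\<Theta>)
  then have "\<forall>\<^sub>F n in sequentially. Z n < 2 * pi * L"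
    by (rule order_tendstoD(2)) (use budget in \<open>simp add: J_def\<close>)
  moreover have "\<forall>\<^sub>F n in sequentially. c < x n powr (2 * \<beta>) * ((1 - 2 * e)\<^sup>2 * \<nu> n * (real (N n) * (1 - S1 (N n) - \<delta>))) - D n"
    using order_tendstoD(1)[OF tendsto_diff[OF Alim Dlim], of c] risk by simp
  ultimately show ?thesis
    using npos ev_N ev_small ev_small'
  proof eventually_elim
    case (elim n)
    have n1: "n \<ge> 1" and N1: "N n \<ge> 1" using elim by auto
    have Ksub: "K n \<subseteq> {1..N n}" by (auto simp: K_def)
    have nontriv: "(\<Sum>k\<in>K n. (freq h k powr (2 * \<beta>) * (\<tau> n k)\<^sup>2)\<^sup>2) > 0"
    proof (rule sum_pos2)
      \<comment> \<open>The largest frequency \<open>N n\<close> has amplitude 0, the one before it does not.\<close>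
      let ?k = "N n - 1"
      have N2: "\<delta> * real (N n) < real (N n) - 1" "real (N n) > 1"
      proof -
        show "\<delta> * real (N n) < real (N n) - 1" using elim by (simp add: algebra_simps)
        moreover have "0 \<le> \<delta> * real (N n)" using \<delta> by simp
        ultimately show "real (N n) > 1" by linarith
      qed
      then show mem: "?k \<in> K n" unfolding K_def using N1 by (auto simp: of_nat_diff)
      have "1 < real (N n) / real ?k" using N2 Kk[OF mem] by (simp add: of_nat_diff)
      then have "1 powr \<beta> < (real (N n) / real ?k) powr \<beta>" using beta by (intro powr_less_mono2) auto
      then have "r n ?k > 0" by (simp add: r_def)
      then have "(\<tau> n ?k)\<^sup>2 > 0" unfolding \<tau>sq[OF mem] using J I n1 by (simp add: \<nu>_def)
      moreover have "freq h ?k > 0"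
      proof -
        have "0 < ?k" using Kk[OF mem] by linarith
        then have "0 < real ?k" by (simp only: of_nat_0_less_iff)
        then show ?thesis unfolding freq_def using h by (intro divide_pos_pos mult_pos_pos) auto
      qed
      ultimately show "0 < (freq h ?k powr (2 * \<beta>) * (\<tau> n ?k)\<^sup>2)\<^sup>2" by simp
    qed (auto simp: K_def)
    have bud: "(1 + \<eta>) * ((1 + \<eta>) * (2 * pi * ((\<Sum>k\<in>K n. freq h k powr (2 * \<beta>) * (\<tau> n k)\<^sup>2) / (2 * real p + 7) + t)) +
       (1 + 1 / \<eta>) * ((2 * ((\<beta> + 1) * 2 powr \<beta> * b n powr (\<beta> - min 1 \<beta>)) * (real (N n) * \<Theta> n))\<^sup>2 * mode_tail h)) +
     (1 + 1 / \<eta>) * ?E0 \<le> 2 * pi * L"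
    proof -
      have "(1 + \<eta>) * ((1 + \<eta>) * (2 * pi * ((\<Sum>k\<in>K n. w n k) / (2 * real p + 7) + t)) +
       (1 + 1 / \<eta>) * ((2 * ((\<beta> + 1) * 2 powr \<beta> * b n powr (\<beta> - min 1 \<beta>)) * (real (N n) * \<Theta> n))\<^sup>2 * mode_tail h)) +
     (1 + 1 / \<eta>) * ?E0 \<le> Z n"
        unfolding Z_def mult.assoc using \<eta> wQ[OF n1 N1]
        by (intro add_mono mult_left_mono order_refl) auto
      then show ?thesis using elim(1) unfolding w_def by linarith
    qed
    have b1: "b n \<ge> 1" "freq h (N n) \<le> b n"
    proof -
      show "b n \<ge> 1" unfolding b_def using mult_mono[OF C x1[OF n1]] C by simp
      show "freq h (N n) \<le> b n" by (rule freq_le[OF _ n1]) simp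
    qed
    show ?case
    proof
      fix T assume T: "T \<in> estimators n"
      note fam = family_lower_bound[OF B H e4 Ksub \<tau>b \<Theta>0 elim(5) elim(6)[unfolded h_def] \<eta> b1[unfolded h_def] less_imp_le[OF t] nontriv[unfolded h_def] bud[unfolded h_def] T]
      define R where "R = (SUP f\<in>sobolev_class \<beta> L. risk n T f)"
      have A0: "A n \<ge> 0" unfolding A_def using e B J[unfolded J_def]
        by (intro sum_nonneg divide_nonneg_nonneg add_nonneg_nonneg mult_nonneg_nonneg) auto
      have D0: "D n \<ge> 0" unfolding D_def by (intro mult_nonneg_nonneg sum_nonneg) auto
      have "ennreal c + ennreal (D n) = ennreal (c + D n)" using c D0 by simp
      also have "\<dots> \<le> ennreal (x n powr (2 * \<beta>) * A n)"
      proof (rule ennreal_leI)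
        have "x n powr (2 * \<beta>) * ((1 - 2 * e)\<^sup>2 * \<nu> n * (real (N n) * (1 - S1 (N n) - \<delta>))) \<le> x n powr (2 * \<beta>) * A n"
          by (intro mult_left_mono A_ge n1 N1) simp
        then show "c + D n \<le> x n powr (2 * \<beta>) * A n" using elim(2) by linarith
      qed
      also have "\<dots> = ennreal (x n powr (2 * \<beta>)) * ennreal (A n)" using A0 by (simp add: ennreal_mult)
      also have "\<dots> \<le> ennreal (x n powr (2 * \<beta>)) * (R + ennreal (9 * (\<Sum>k\<in>K n. (\<tau> n k)\<^sup>2) * exp (- 2 * t\<^sup>2 / (?W2 n))))"
        using fam unfolding A_def R_def w_def h_def by (intro mult_left_mono) auto
      also have "\<dots> = ennreal (x n powr (2 * \<beta>)) * R + ennreal (D n)"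
        unfolding distrib_left D_def by (subst ennreal_mult'[of "x n powr (2 * \<beta>)"]) auto
      finally have "ennreal c \<le> ennreal (x n powr (2 * \<beta>)) * R"
        by (simp add: ennreal_add_left_cancel_le add.commute)
      also have "\<dots> = (SUP f\<in>sobolev_class \<beta> L. ennreal (x n powr (2 * \<beta>)) * risk n T f)"
        unfolding R_def by (rule SUP_mult_left_ennreal)
      also have "x n powr (2 * \<beta>) = real n powr (2 * \<beta> / (2 * \<beta> + 1))"
        by (simp add: xp \<alpha>_def)
      finally show "ennreal c \<le> (SUP f\<in>sobolev_class \<beta> L. ennreal (real n powr (2 * \<beta> / (2 * \<beta> + 1))) * risk n T f)" .
    qed
  qed
qed

end

section \<open>The Pinsker constant\<close>

text \<open>The first factor is the cut-off frequency at which the energy of the family equals \<open>L\<close>, the second is the risk per unit of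
cut-off frequency, both after normalisation by powers of \<open>n\<close>.\<close>

lemma pinsker_const_eq:
  fixes \<beta> L :: real
  assumes b: "\<beta> > 0" and L: "L > 0"
  defines "M \<equiv> pi * (2 * \<beta> + 1) * (\<beta> + 1) / \<beta>"
  shows "pinsker_const \<beta> L = (L * M) powr (1 / (2 * \<beta> + 1)) * (\<beta> / (pi * (\<beta> + 1)))"
proof -
  have M: "M > 0" unfolding M_def using b by (intro divide_pos_pos mult_pos_pos) auto
  have "- (2 * \<beta> / (2 * \<beta> + 1)) = 1 / (2 * \<beta> + 1) - 1" using b by (simp add: field_simps)
  then have "pinsker_const \<beta> L = (2 * \<beta> + 1) * M powr (1 / (2 * \<beta> + 1) - 1) * L powr (1 / (2 * \<beta> + 1))"
    by (simp only: pinsker_const_def M_def)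
  also have "M powr (1 / (2 * \<beta> + 1) - 1) = M powr (1 / (2 * \<beta> + 1)) / M"
    using M by (simp add: powr_diff)
  also have "(2 * \<beta> + 1) * (M powr (1 / (2 * \<beta> + 1)) / M) * L powr (1 / (2 * \<beta> + 1)) = (L * M) powr (1 / (2 * \<beta> + 1)) * ((2 * \<beta> + 1) / M)"
    by (simp only: powr_mult) (simp add: mult_ac)
  also have "(2 * \<beta> + 1) / M = \<beta> / (pi * (\<beta> + 1))"
    unfolding M_def using b by (simp add: divide_simps)
  finally show ?thesis .
qed

text \<open>The left side is the information of the prior times its variance; 1 is the value for a Gaussian.\<close>

lemma prior_info_ratio_le: "prior_info p / (2 * real p + 7) \<le> 1 + 3 * inverse (real (Suc p))"
proof -
  have "prior_info p / (2 * real p + 7) = 1 + 3 / (real p + 1) / (2 * real p + 7)"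
    by (simp add: prior_info_def divide_simps) (simp add: algebra_simps)
  also have "3 / (real p + 1) / (2 * real p + 7) \<le> 3 / (real p + 1) / 1"
    by (intro divide_left_mono) auto
  finally show ?thesis by (simp add: divide_inverse add.commute)
qed

text \<open>A cut-off \<open>\<rho>\<close> slightly below the critical one leaves room in the budget and still gives a risk above
\<open>c\<close>. The remaining parameters are chosen in the order in which they depend on each other: the relative width \<open>e\<close> of
the transition zone (and with it the window), the exponent \<open>p\<close> of the prior, the slack \<open>\<eta>\<close> in the triangle inequality,
and finally the scale \<open>B\<close>, which must beat \<open>1 / \<eta>\<close> and the energy of the window.\<close>

lemma minimax_risk_eventually_ge:
  fixes \<beta> L c :: real
  assumes b: "\<beta> > 1/2" and L: "L > 0" and c: "0 \<le> c" "c < pinsker_const \<beta> L"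
  shows "\<forall>\<^sub>F n in sequentially. \<forall>T\<in>estimators n. ennreal c \<le> (SUP f\<in>sobolev_class \<beta> L. ennreal (real n powr (2 * \<beta> / (2 * \<beta> + 1))) * risk n T f)"
proof -
  define M where "M = pi * (2 * \<beta> + 1) * (\<beta> + 1) / \<beta>"
  have M: "M > 0" unfolding M_def using b by (intro divide_pos_pos mult_pos_pos) auto
  define \<Omega> where "\<Omega> = (L * M) powr (1 / (2 * \<beta> + 1))"
  define b' where "b' = \<beta> / (pi * (\<beta> + 1))"
  define \<kappa> where "\<kappa> = 1 / (\<beta> + 1) - 1 / (2 * \<beta> + 1)"
  have b': "b' > 0" using b by (simp add: b'_def)
  have \<Omega>: "\<Omega> > 0" using L M by (simp add: \<Omega>_def)
  have \<kappa>: "\<kappa> / pi = 1 / M" unfolding \<kappa>_def M_def using b by (simp add: divide_simps)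
  have c': "c / b' < \<Omega>"
    using c(2) pinsker_const_eq[of \<beta> L] b L b' unfolding \<Omega>_def M_def b'_def[symmetric] by (simp add: pos_divide_less_eq)
  define \<rho> where "\<rho> = (c / b' + \<Omega>) / 2"
  have \<rho>: "\<rho> > 0" "\<rho> < \<Omega>" "c < \<rho> * b'"
  proof -
    have "0 \<le> c / b'" using c b' by simp
    then show "\<rho> > 0" "\<rho> < \<Omega>" using \<Omega> c' by (auto simp: \<rho>_def)
    have "z < (z + \<Omega>) / 2" if "z < \<Omega>" for z using that by simp
    from this[OF c'] have "c / b' < \<rho>" by (simp only: \<rho>_def)
    then show "c < \<rho> * b'" using b' by (simp add: pos_divide_less_eq)
  qed
  define E where "E = \<rho> powr (2 * \<beta> + 1) / pi * \<kappa>"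
  have E0: "E \<ge> 0" unfolding E_def \<kappa>_def using b by (intro mult_nonneg_nonneg) (auto simp: field_simps)
  have EL: "E < L"
  proof -
    have "\<rho> powr (2 * \<beta> + 1) < \<Omega> powr (2 * \<beta> + 1)" using \<rho> b by (intro powr_less_mono2) auto
    also have "\<dots> = L * M" using b L M by (simp add: \<Omega>_def powr_powr)
    finally have "\<rho> powr (2 * \<beta> + 1) / M < L" using M by (simp add: pos_divide_less_eq)
    moreover have "E = \<rho> powr (2 * \<beta> + 1) / M" unfolding E_def using \<kappa> by (simp add: field_simps)
    ultimately show ?thesis by simp
  qed
  have "((\<lambda>e. (1 - 2 * e)\<^sup>2 * ((1 - e)\<^sup>2 * \<rho> / pi) * (1 - 1 / (\<beta> + 1) - e)) \<longlongrightarrow> (1 - 2 * 0)\<^sup>2 * ((1 - 0)\<^sup>2 * \<rho> / pi) * (1 - 1 / (\<beta> + 1) - 0)) (at_right 0)"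
    by (intro tendsto_intros) auto
  moreover have "(1 - 2 * 0)\<^sup>2 * ((1 - 0)\<^sup>2 * \<rho> / pi) * (1 - 1 / (\<beta> + 1) - 0) = \<rho> * b'"
    unfolding b'_def using b by (simp add: field_simps)
  ultimately have "\<forall>\<^sub>F e in at_right 0. c < (1 - 2 * e)\<^sup>2 * ((1 - e)\<^sup>2 * \<rho> / pi) * (1 - 1 / (\<beta> + 1) - e)"
    using \<rho>(3) by (intro order_tendstoD(1)) auto
  moreover have "\<forall>\<^sub>F e in at_right (0::real). e \<in> {0<..<1/4}" by (rule eventually_at_right_real) simp
  ultimately have "\<forall>\<^sub>F e in at_right 0. c < (1 - 2 * e)\<^sup>2 * ((1 - e)\<^sup>2 * \<rho> / pi) * (1 - 1 / (\<beta> + 1) - e) \<and> 0 < e \<and> e < 1/4"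
    by eventually_elim auto
  then obtain e :: real where er: "c < (1 - 2 * e)\<^sup>2 * ((1 - e)\<^sup>2 * \<rho> / pi) * (1 - 1 / (\<beta> + 1) - e)" "0 < e" "e < 1/4"
    using eventually_happens'[OF trivial_limit_at_right_real] by blast
  obtain q where q: "window q e \<beta>"
    using window_exists[of e \<beta>] er b unfolding window_def by auto
  interpret window q e \<beta> by (rule q)
  have "(\<lambda>p. (1 + 3 * inverse (real (Suc p))) * E) \<longlonglongrightarrow> (1 + 3 * 0) * E"
    by (intro tendsto_intros LIMSEQ_inverse_real_of_nat)
  then have "\<forall>\<^sub>F p in sequentially. (1 + 3 * inverse (real (Suc p))) * E < L"
    using EL by (intro order_tendstoD(2)) auto
  then have "\<forall>\<^sub>F p in sequentially. prior_info p / (2 * real p + 7) * E < L"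
    by eventually_elim (use prior_info_ratio_le E0 in \<open>meson le_less_trans mult_right_mono\<close>)
  then obtain p where p: "prior_info p / (2 * real p + 7) * E < L"
    using eventually_happens'[OF sequentially_bot] by blast
  define E' where "E' = prior_info p / (2 * real p + 7) * ((1 - e)\<^sup>2 * E)"
  have "(1 - e)\<^sup>2 * E \<le> 1 * E" using er E0 by (intro mult_right_mono) (auto simp: power_le_one)
  then have "E' \<le> prior_info p / (2 * real p + 7) * E"
    unfolding E'_def prior_info_def by (intro mult_left_mono) auto
  with p have E': "E' < L" by linarith
  have "((\<lambda>\<eta>. (1 + \<eta>) * ((1 + \<eta>) * (2 * pi * (E' + \<eta>)))) \<longlongrightarrow> (1 + 0) * ((1 + 0) * (2 * pi * (E' + 0)))) (at_right 0)"
    by (intro tendsto_intros)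
  then have "\<forall>\<^sub>F \<eta> in at_right 0. (1 + \<eta>) * ((1 + \<eta>) * (2 * pi * (E' + \<eta>))) < 2 * pi * L"
    using E' by (intro order_tendstoD(2)) auto
  moreover have "\<forall>\<^sub>F \<eta> in at_right (0::real). \<eta> \<in> {0<..<1}" by (rule eventually_at_right_real) simp
  ultimately have "\<forall>\<^sub>F \<eta> in at_right 0. (1 + \<eta>) * ((1 + \<eta>) * (2 * pi * (E' + \<eta>))) < 2 * pi * L \<and> 0 < \<eta>"
    by eventually_elim auto
  then obtain \<eta> :: real where \<eta>: "(1 + \<eta>) * ((1 + \<eta>) * (2 * pi * (E' + \<eta>))) < 2 * pi * L" "0 < \<eta>"
    using eventually_happens'[OF trivial_limit_at_right_real] by blast
  let ?E0 = "\<lambda>B. (1 + 1 / \<eta>) * (4 * (B powr (- 1 - 2 * \<beta>) / mass\<^sup>2 * enn2real (fourier_energy \<beta> q)))"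
  have "((\<lambda>B. (1 + \<eta>) * ((1 + \<eta>) * (2 * pi * (E' + \<eta>))) + ?E0 B) \<longlongrightarrow> (1 + \<eta>) * ((1 + \<eta>) * (2 * pi * (E' + \<eta>))) + (1 + 1 / \<eta>) * (4 * (0 / mass\<^sup>2 * enn2real (fourier_energy \<beta> q)))) at_top"
    using mass_bounds b by (intro tendsto_intros tendsto_neg_powr filterlim_ident) auto
  then have "\<forall>\<^sub>F B in at_top. (1 + \<eta>) * ((1 + \<eta>) * (2 * pi * (E' + \<eta>))) + ?E0 B < 2 * pi * L"
    using \<eta> by (intro order_tendstoD(2)) auto
  then have "\<forall>\<^sub>F B in at_top. (1 + \<eta>) * ((1 + \<eta>) * (2 * pi * (E' + \<eta>))) + ?E0 B < 2 * pi * L \<and> B \<ge> 2"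
    using eventually_ge_at_top[of "2::real"] by eventually_elim auto
  then obtain B where B: "(1 + \<eta>) * ((1 + \<eta>) * (2 * pi * (E' + \<eta>))) + ?E0 B < 2 * pi * L" "B \<ge> 2"
    using eventually_happens'[OF trivial_limit_at_top_linorder] by blast
  have H: "(1 - e) * B \<ge> 1"
    using mult_mono[of "1/2" "1 - e" 2 B] B er by simp
  show ?thesis
  proof (rule asymptotic_lower_bound[where B=B and \<rho>=\<rho> and \<delta>=e and \<eta>=\<eta> and t=\<eta> and p=p])
    show "(1 + \<eta>) * ((1 + \<eta>) * (2 * pi * (prior_info p / (2 * real p + 7) * ((1 - e)\<^sup>2 * \<rho> powr (2 * \<beta> + 1) / pi * (1 / (\<beta> + 1) - 1 / (2 * \<beta> + 1))) + \<eta>))) + ?E0 B < 2 * pi * L"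
      using B(1) unfolding E'_def E_def \<kappa>_def by (simp add: mult.assoc)
  qed (use B H er \<rho> \<eta> c in auto)
qed

theorem theorem3:
  fixes \<beta> L :: real
  assumes "\<beta> > 1/2" and "L > 0"
  shows "liminf (\<lambda>n. INF T\<in>estimators n. SUP f\<in>sobolev_class \<beta> L.
            ennreal (real n powr (2 * \<beta> / (2 * \<beta> + 1))) * risk n T f)
         \<ge> ennreal (pinsker_const \<beta> L)"
  unfolding le_Liminf_iff
proof (intro allI impI)
  fix y assume y: "y < ennreal (pinsker_const \<beta> L)"
  then obtain y' where y': "y = ennreal y'" "0 \<le> y'" by (cases y) auto
  have lt: "y' < pinsker_const \<beta> L" using y y' by (simp add: ennreal_less_iff)
  define c where "c = (y' + pinsker_const \<beta> L) / 2"
  have c: "0 \<le> c" "c < pinsker_const \<beta> L" "y' < c" using lt y' by (auto simp: c_def)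
  have yc: "y < ennreal c" using c y' by (simp add: ennreal_less_iff)
  from minimax_risk_eventually_ge[OF assms c(1,2)]
  show "\<forall>\<^sub>F n in sequentially. y < (INF T\<in>estimators n. SUP f\<in>sobolev_class \<beta> L. ennreal (real n powr (2 * \<beta> / (2 * \<beta> + 1))) * risk n T f)"
    by eventually_elim (rule less_le_trans[OF yc], rule INF_greatest, blast)
qed

end
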